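(* Let $1<\alpha<2$, let $s\geq s_0>-\frac{3}{4}(\alpha-1)$ and let $\omega=\frac{1}{\alpha}-\frac{1}{2}$. Then there exist $b'>-\frac{1}{2}$ and $b\in(\frac{1}{2},b'+1)$ and a constant $c>0$ such that $$\|\partial_x(u_1u_2)\|_{X_{s,\omega,b'}}\leq c\left(\|u_1\|_{X_{s,\omega,b}}\|u_2\|_{X_{s_0,\omega,b}}+\|u_1\|_{X_{s_0,\omega,b}}\|u_2\|_{X_{s,\omega,b}}\right)$$ for all $u_1,u_2\in\mathcal{S}(\mathbb{R}^2)$ (Schwartz functions of $(t,x)$).
   Context: The Fourier transform on $\mathbb{R}^n$ is $\mathcal{F}f(\xi)=(2\pi)^{-n/2}\int e^{-ix\cdot\xi}f(x)\,dx$; for functions of $(t,x)\in\mathbb{R}^2$ the dual variables are $(\tau,\xi)$. Write $\langle a\rangle=(1+|a|^2)^{1/2}$. For $0\leq\omega<\frac12$ and $s,b\in\mathbb{R}$, the space $X_{s,\omega,b}$ is the completion of $\mathcal{S}(\mathbb{R}^2)$ with respect to the norm $$\|u\|^2_{X_{s,\omega,b}}=\int_{\mathbb{R}^2}|\xi|^{-2\omega}\langle\xi\rangle^{2s-2\alpha\omega}\langle|\tau|+|\xi|^{1+\alpha}\rangle^{2\omega}\langle\tau-\xi|\xi|^{\alpha}\rangle^{2b}|\mathcal{F}u(\tau,\xi)|^2\,d\tau\,d\xi.$$ *)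

theory Defs
  imports "HOL-Analysis.Analysis"
begin

text \<open>Functions of (t,x) in R^2 are modelled as real \<times> real \<Rightarrow> complex; the first
  component is time t, the second space x. Dual variables (tau, xi) likewise.\<close>

definition pd :: "bool \<Rightarrow> (real \<times> real \<Rightarrow> complex) \<Rightarrow> (real \<times> real \<Rightarrow> complex)" where
  "pd d g = (\<lambda>(t, x). if d then vector_derivative (\<lambda>s. g (s, x)) (at t)
                           else vector_derivative (\<lambda>y. g (t, y)) (at x))"

definition dx :: "(real \<times> real \<Rightarrow> complex) \<Rightarrow> (real \<times> real \<Rightarrow> complex)" where
  "dx g = pd False g"

fun iterpd :: "bool list \<Rightarrow> (real \<times> real \<Rightarrow> complex) \<Rightarrow> (real \<times> real \<Rightarrow> complex)" where
  "iterpd [] f = f"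
| "iterpd (d # ds) f = pd d (iterpd ds f)"

definition schwartz :: "(real \<times> real \<Rightarrow> complex) \<Rightarrow> bool" where
  "schwartz f \<longleftrightarrow> (\<forall>ds.
      (\<forall>t x. (\<lambda>s. iterpd ds f (s, x)) differentiable (at t)
           \<and> (\<lambda>y. iterpd ds f (t, y)) differentiable (at x))
    \<and> continuous_on UNIV (iterpd ds f)
    \<and> (\<forall>a b :: nat. bounded (range (\<lambda>(t, x). complex_of_real (t ^ a * x ^ b) * iterpd ds f (t, x)))))"

text \<open>Fourier transform on R^2 with normalisation (2 pi)^(-n/2), n = 2.\<close>
definition fourier2 :: "(real \<times> real \<Rightarrow> complex) \<Rightarrow> (real \<times> real \<Rightarrow> complex)" where
  "fourier2 f = (\<lambda>(\<tau>, \<xi>). complex_of_real (1 / (2 * pi)) *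
      (LINT p|lborel. cis (- (fst p * \<tau> + snd p * \<xi>)) * f p))"

definition jb :: "real \<Rightarrow> real" where
  "jb a = sqrt (1 + a\<^sup>2)"

definition Xweight :: "real \<Rightarrow> real \<Rightarrow> real \<Rightarrow> real \<Rightarrow> real \<times> real \<Rightarrow> real" where
  "Xweight \<alpha> s \<omega> b = (\<lambda>(\<tau>, \<xi>).
      \<bar>\<xi>\<bar> powr (-2 * \<omega>) * jb \<xi> powr (2 * s - 2 * \<alpha> * \<omega>)
      * jb (\<bar>\<tau>\<bar> + \<bar>\<xi>\<bar> powr (1 + \<alpha>)) powr (2 * \<omega>)
      * jb (\<tau> - \<xi> * \<bar>\<xi>\<bar> powr \<alpha>) powr (2 * b))"

definition Xnorm :: "real \<Rightarrow> real \<Rightarrow> real \<Rightarrow> real \<Rightarrow> (real \<times> real \<Rightarrow> complex) \<Rightarrow> ennreal" where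
  "Xnorm \<alpha> s \<omega> b u =
    (let I = (\<integral>\<^sup>+ p. ennreal (Xweight \<alpha> s \<omega> b p * (cmod (fourier2 u p))\<^sup>2) \<partial>lborel)
     in if I = \<infinity> then \<infinity> else ennreal (sqrt (enn2real I)))"

end

theory Submission
  imports Defs "HOL-Probability.Probability"
begin

text \<open>
  On the Fourier side the claim is an \<open>L\<^sup>2\<close> bound for a bilinear operator whose kernel is a quotient
  of weights. The excess regularity above \<open>- \<rho>\<close>, where \<open>\<rho> < 3/4 (\<alpha> - 1)\<close>, is
  distributed over the two factors, so that only one negative regularity has to be treated.
  For three frequencies with sum zero, largest modulus \<open>N\<close> and smallest modulus \<open>L\<close>, one of the
  three modulations is at least of size \<open>L N\<^sup>\<alpha>\<close>; freezing the point that carries it and applying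
  Cauchy-Schwarz leaves an integral of \<open>h(y) \<langle>t - G(y)\<rangle>\<^sup>-\<^sup>2\<^sup>b\<close> along the phase
  \<open>G(y) = \<phi>(y) + \<phi>(x - y)\<close>, which is bounded as soon as \<open>h \<lesssim> |G'|\<close>. The phase is degenerate only
  at \<open>y = x/2\<close>, where a window of width \<open>N powr (- (\<alpha> - 1)/2)\<close> is estimated by its measure; this
  interaction of three comparable frequencies produces the threshold \<open>3/4 (\<alpha> - 1)\<close>. The value
  \<open>\<omega> = 1/\<alpha> - 1/2\<close> makes the interaction with a frequency of size \<open>N powr (- \<alpha>)\<close> scale invariant.
\<close>

section \<open>Japanese brackets\<close>

text \<open>The delicate interaction is that of a low input L with a high one N: the derivative
  costs N^2 in the squared kernel, the phase derivative returns only N^\<alpha>, and for small L the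
  resonance L N^\<alpha> is too weak to cover the gap. The singular factor of the weight supplies
  L^(2 \<omega>), which together with (L N^\<alpha>)^(- 2 \<omega>) makes N^(\<alpha> - 2), exactly
  what is missing. If the low input itself carries the large modulation, freezing it leaves a phase
  derivative of only N^(\<alpha> - 1) L, too small as L tends to 0; the output is then frozen
  instead and the modulation decay is integrated over the low frequency. This is the origin of
  \<open>tail\<close>, and there the factor mixing tau and xi provides the power - 2 \<omega>. The
  bound 4 \<rho> < 3 (\<alpha> - 1) is met twice: for comparable frequencies and, in
  \<open>hQ_le\<close>, for two high inputs with a low output.\<close>

lemma jb_ge_1: "1 \<le> jb a"
  by (simp add: jb_def)

lemma jb_sq: "(jb a)\<^sup>2 = 1 + a\<^sup>2"
  by (simp add: jb_def)

lemma jb_pos: "0 < jb a"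
  using jb_ge_1[of a] by linarith

lemma jb_ge_abs: "\<bar>a\<bar> \<le> jb a"
  by (simp add: jb_def real_le_rsqrt)

lemma jb_le: "jb a \<le> 1 + \<bar>a\<bar>"
  unfolding jb_def by (rule real_le_lsqrt) (auto simp: power2_eq_square algebra_simps)

lemma jb_mono: "\<bar>a\<bar> \<le> \<bar>c\<bar> \<Longrightarrow> jb a \<le> jb c"
  by (simp add: jb_def abs_le_square_iff)

lemma jb_minus: "jb (- a) = jb a"
  by (simp add: jb_def)

text \<open>A factor at least 1 also absorbs the summand 1 under the root. In this form inequalities
  between frequencies or modulations pass to their brackets.\<close>

lemma jb_scale: 
  assumes "1 \<le> k" "\<bar>a\<bar> \<le> k * \<bar>c\<bar>" shows "jb a \<le> k * jb c"
proof -
  have "a\<^sup>2 \<le> (k * c)\<^sup>2"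
    using assms by (metis abs_le_square_iff abs_mult abs_of_nonneg dual_order.trans zero_le_one)
  moreover have "1 \<le> k\<^sup>2" using assms by (simp add: one_le_power)
  ultimately have "1 + a\<^sup>2 \<le> k\<^sup>2 * (1 + c\<^sup>2)"
    by (simp add: algebra_simps power_mult_distrib)
  then have "sqrt (1 + a\<^sup>2) \<le> sqrt (k\<^sup>2 * (1 + c\<^sup>2))" by simp
  then show ?thesis using assms by (simp add: jb_def real_sqrt_mult)
qed

lemma jb_add: "jb (a + c) \<le> jb a + jb c"
proof (rule power2_le_imp_le)
  have "a * c \<le> jb a * jb c"
  proof -
    have "a * c \<le> \<bar>a\<bar> * \<bar>c\<bar>" by (metis abs_ge_self abs_mult)
    also have "\<dots> \<le> jb a * jb c" by (intro mult_mono jb_ge_abs) (auto simp: less_imp_le[OF jb_pos])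
    finally show ?thesis .
  qed
  then show "(jb (a + c))\<^sup>2 \<le> (jb a + jb c)\<^sup>2"
    by (simp add: jb_sq power2_sum)
qed (use jb_pos[of a] jb_pos[of c] in linarith)

lemma jb_le_double: "1 \<le> a \<Longrightarrow> jb a \<le> 2 * a"
  using jb_le[of a] by simp

section \<open>Frequency bounds\<close>

text \<open>\<open>- \<rho>\<close> is the lowest regularity; \<open>\<epsilon>\<close> is the room left by \<open>s\<^sub>0 > - (3 / 4) * (\<alpha> - 1)\<close> for the losses in
  \<open>b\<close> and \<open>b'\<close>.\<close>

locale dispersion_params =
  fixes \<alpha> \<omega> \<rho> \<epsilon> b b' :: real
  assumes alpha: "1 < \<alpha>" "\<alpha> < 2"
    and omega: "\<omega> = 1 / \<alpha> - 1 / 2"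
    and rho: "0 \<le> \<rho>"
    and eps: "0 < \<epsilon>" "4 * \<rho> + 12 * \<epsilon> \<le> 3 * (\<alpha> - 1)"
    and b_def: "b = 1 / 2 + \<epsilon> / 2" and b'_def: "b' = - 1 / 2 + \<epsilon>"
begin

text \<open>The identity for \<alpha> \<omega> drives every cancellation of powers of N. The third
  bound says 2 \<omega> <= \<open>e\<close>, so that the modulation decay may be weakened to the
  power - 2 \<omega>.\<close>

lemma omega_bounds: "0 < \<omega>" "2 * (\<alpha> * \<omega>) = 2 - \<alpha>" "2 * \<omega> \<le> 1 - 2 * \<epsilon>" "\<omega> \<le> \<alpha> * \<omega>"
proof -
  show w: "0 < \<omega>" using alpha by (simp add: omega)
  show eq: "2 * (\<alpha> * \<omega>) = 2 - \<alpha>" using alpha by (simp add: omega field_simps)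
  show le: "\<omega> \<le> \<alpha> * \<omega>" using w alpha by simp
  show "2 * \<omega> \<le> 1 - 2 * \<epsilon>" using le eq eps rho by argo
qed

lemma alpha_eps: "\<alpha> * \<epsilon> \<le> 2 * \<epsilon>" "0 \<le> \<alpha> * \<epsilon>"
  using alpha eps by auto

text \<open>\<open>- \<kappa>\<close> is the exponent of the bracket of xi in \<open>Xweight\<close>
  at regularity \<open>- \<rho>\<close>.\<close>

abbreviation "\<kappa> \<equiv> 2 * \<rho> + 2 * (\<alpha> * \<omega>)"
text \<open>\<open>- e\<close> equals \<open>2 * b'\<close>, the exponent of the output
  modulation.\<close>

abbreviation "e \<equiv> 1 - 2 * \<epsilon>"

lemma kappa_nonneg: "0 \<le> \<kappa>"
  using rho alpha omega_bounds by linarith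

lemma resonance_size:
  assumes "0 < L" "0 < N" "0 \<le> q"
  shows "jb (L * N powr \<alpha>) powr - q \<le> L powr - q * N powr - (\<alpha> * q)"
proof -
  have "jb (L * N powr \<alpha>) powr - q \<le> (L * N powr \<alpha>) powr - q"
    using assms jb_ge_abs[of "L * N powr \<alpha>"] by (intro powr_mono2') auto
  also have "\<dots> = L powr - q * N powr - (\<alpha> * q)"
    by (simp add: powr_mult powr_powr)
  finally show ?thesis .
qed

lemma jb_powr_small: "\<bar>a\<bar> \<le> 1 \<Longrightarrow> 0 \<le> q \<Longrightarrow> jb a powr q \<le> 2 powr q"
  using jb_le[of a] by (intro powr_mono2) (auto simp: less_imp_le[OF jb_pos])

lemma jb_powr_large: "1 \<le> a \<Longrightarrow> 0 \<le> q \<Longrightarrow> jb a powr q \<le> 2 powr q * a powr q"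
  using powr_mono2[of q "jb a" "2 * a"] jb_le_double[of a] 
  by (simp add: powr_mult less_imp_le[OF jb_pos])

lemma jb_powr_neg_le_1: "q \<le> 0 \<Longrightarrow> jb a powr q \<le> 1"
  using powr_mono[of q 0 "jb a"] jb_ge_1[of a] by simp

text \<open>The frequency part of the squared kernel when the smallest frequency \<open>L\<close> is an input (\<open>hP\<close>), an
  input carrying the largest modulation (\<open>hR\<close>), or the output (\<open>hQ\<close>).\<close>

definition "hP N L = N\<^sup>2 * L powr (2 * \<omega>) * jb L powr (2 * \<rho> - 2 * \<omega>) * jb (L * N powr \<alpha>) powr - e"
definition "hR N L = N\<^sup>2 * L powr (2 * \<omega>) * jb L powr \<kappa> * jb (L * N powr \<alpha>) powr (- e - 2 * \<omega>)"
definition "hQ N L = L powr (2 - 2 * \<omega>) * jb L powr - \<kappa> * jb N powr (4 * \<rho>) * jb (L * N powr \<alpha>) powr (2 * \<omega> - e)"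

lemma L_jb_powr:
  assumes "0 < L" shows "L powr (2 * \<omega>) * jb L powr (2 * \<rho> - 2 * \<omega>) \<le> jb L powr (2 * \<rho>)"
proof -
  have "L powr (2 * \<omega>) \<le> jb L powr (2 * \<omega>)"
    using assms jb_ge_abs[of L] omega_bounds by (intro powr_mono2) auto
  then have "L powr (2 * \<omega>) * jb L powr (2 * \<rho> - 2 * \<omega>) \<le> jb L powr (2 * \<omega>) * jb L powr (2 * \<rho> - 2 * \<omega>)"
    by (intro mult_right_mono) auto
  also have "\<dots> = jb L powr (2 * \<rho>)" by (simp add: powr_add[symmetric])
  finally show ?thesis .
qed

lemma hP_le:
  assumes "0 < L" "L \<le> N"
  shows "hP N L \<le> 2 powr (2 * \<rho>) * N powr \<alpha>"
proof (cases "L \<le> 1")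
  case True
  let ?Y = "jb (L * N powr \<alpha>)"
  have Y: "?Y powr - e \<le> L powr - (2 * \<omega>) * N powr - (\<alpha> * (2 * \<omega>))"
    using resonance_size[of L N "2 * \<omega>"] powr_mono[of "-e" "- (2*\<omega>)" ?Y] jb_ge_1[of "L * N powr \<alpha>"] omega_bounds assms
    by simp
  have J: "jb L powr (2 * \<rho> - 2 * \<omega>) \<le> 2 powr (2 * \<rho>)"
    using powr_mono[of "2 * \<rho> - 2 * \<omega>" "2 * \<rho>" "jb L"] jb_ge_1[of L] jb_powr_small[of L "2*\<rho>"] True assms rho omega_bounds
    by simp
  have "hP N L \<le> N\<^sup>2 * L powr (2 * \<omega>) * 2 powr (2 * \<rho>) * (L powr - (2 * \<omega>) * N powr - (\<alpha> * (2 * \<omega>)))"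
    unfolding hP_def by (intro mult_mono Y J order_refl) auto
  also have "\<dots> = 2 powr (2 * \<rho>) * (N powr 2 * N powr - (\<alpha> * (2 * \<omega>)))"
    using assms by (simp add: powr_minus divide_simps)
  also have "N powr 2 * N powr - (\<alpha> * (2 * \<omega>)) = N powr \<alpha>"
  proof -
    have "2 + - (\<alpha> * (2 * \<omega>)) = \<alpha>" using omega_bounds(2) by (simp add: mult.left_commute)
    then show ?thesis by (metis powr_add)
  qed
  finally show ?thesis .
next
  case False
  have e0: "0 \<le> e" using omega_bounds by simp
  have "hP N L \<le> N\<^sup>2 * (jb L powr (2 * \<rho>)) * jb (L * N powr \<alpha>) powr - e"
    unfolding hP_def using mult_mono[OF mult_left_mono[OF L_jb_powr[OF assms(1)], of "N\<^sup>2"] order_refl]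
    by (simp add: mult.assoc)
  also have "\<dots> \<le> N\<^sup>2 * (2 powr (2 * \<rho>) * N powr (2 * \<rho>)) * (L powr - e * N powr - (\<alpha> * e))"
    apply (intro mult_mono order_refl resonance_size)
    using False assms e0 jb_powr_large[of L "2 * \<rho>"] powr_mono2[of "2*\<rho>" L N] rho 
    by (auto intro!: order_trans[OF jb_powr_large])
  also have "\<dots> \<le> N\<^sup>2 * (2 powr (2 * \<rho>) * N powr (2 * \<rho>)) * (1 * N powr - (\<alpha> * e))"
    using False assms e0 powr_mono[of "-e" 0 L] by (intro mult_mono order_refl) auto
  also have "\<dots> = 2 powr (2 * \<rho>) * (N powr 2 * N powr (2 * \<rho>) * N powr - (\<alpha> * e))"
    using assms by simp
  also have "N powr 2 * N powr (2 * \<rho>) * N powr - (\<alpha> * e) = N powr (2 + 2 * \<rho> - \<alpha> * e)"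
    by (simp add: powr_add[symmetric])
  also have "\<dots> \<le> N powr \<alpha>"
  proof (intro powr_mono)
    have "2 + 2 * \<rho> - \<alpha> * e = 2 + 2 * \<rho> - \<alpha> + 2 * (\<alpha> * \<epsilon>)"
      by (simp add: algebra_simps)
    also have "\<dots> \<le> \<alpha>" using eps alpha_eps(1) alpha by argo
    finally show "2 + 2 * \<rho> - \<alpha> * e \<le> \<alpha>" .
  qed (use False assms in auto)
  finally show ?thesis by simp
qed

text \<open>Origin of the coefficient 12 of \<epsilon> in the locale: the exponents compare if and
  only if 4 \<rho> + 4 \<epsilon> + 4 \<alpha> \<epsilon> <= 3 (\<alpha> - 1), and \<alpha> < 2
  bounds the terms in \<epsilon> by 12 \<epsilon>.\<close>

lemma critical_exponent:
  assumes "1 \<le> N" shows "N powr (2 + 2 * \<rho> - (1 + \<alpha>) * e) \<le> N powr ((\<alpha> - 1) / 2)"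
proof (intro powr_mono)
  have "2 + 2 * \<rho> - (1 + \<alpha>) * e = 1 + 2 * \<rho> - \<alpha> + 2 * \<epsilon> + 2 * (\<alpha> * \<epsilon>)"
    by (simp add: algebra_simps)
  also have "\<dots> \<le> (\<alpha> - 1) / 2"
    using eps alpha_eps(1) by argo
  finally show "2 + 2 * \<rho> - (1 + \<alpha>) * e \<le> (\<alpha> - 1) / 2" .
qed (use assms in auto)

text \<open>For comparable frequencies the resonance has the full size N^(1 + \<alpha>). The
  restriction q <= 1 keeps the constant independent of q.\<close>

lemma resonance_size_comparable:
  assumes "0 < L" "N \<le> 4 * L" "0 < N" "0 \<le> q" "q \<le> 1"
  shows "jb (L * N powr \<alpha>) powr - q \<le> 4 * N powr - ((1 + \<alpha>) * q)"
proof -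
  have "jb (L * N powr \<alpha>) powr - q \<le> L powr - q * N powr - (\<alpha> * q)"
    using assms by (intro resonance_size) auto
  also have "L powr - q \<le> (N / 4) powr - q"
    using assms by (intro powr_mono2') auto
  also have "(N / 4) powr - q = 4 powr q * N powr - q"
    by (simp add: powr_divide powr_minus field_simps)
  also have "4 powr q \<le> (4::real)" using powr_mono[of q 1 "4::real"] assms by simp
  finally have "jb (L * N powr \<alpha>) powr - q \<le> 4 * (N powr - q * N powr - (\<alpha> * q))"
    by (simp add: mult_right_mono)
  also have "N powr - q * N powr - (\<alpha> * q) = N powr - ((1 + \<alpha>) * q)"
    by (simp add: powr_add[symmetric] algebra_simps)
  finally show ?thesis .
qed

text \<open>The additional resonance N against L lowers the bound from N^\<alpha> to the height of
  the window. This gain is needed because the phase derivative may vanish in this regime.\<close>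

lemma hP_le_comparable:
  assumes "0 < L" "L \<le> N" "N \<le> 4 * L"
  shows "hP N L \<le> 4 * 2 powr (2 * \<rho>) * max 1 N powr ((\<alpha> - 1) / 2)"
proof (cases "N \<le> 1")
  case True
  have "N powr \<alpha> \<le> 1" using True assms alpha powr_mono2[of \<alpha> N 1] by simp
  then have "hP N L \<le> 2 powr (2 * \<rho>) * 1" 
    using assms by (intro order_trans[OF hP_le[of L N] mult_left_mono]) auto
  also have "\<dots> \<le> 4 * 2 powr (2 * \<rho>) * max 1 N powr ((\<alpha> - 1) / 2)" using True by simp
  finally show ?thesis .
next
  case False
  have e0: "0 \<le> e" "e \<le> 1" using omega_bounds eps by auto
  have "hP N L \<le> N\<^sup>2 * (jb L powr (2 * \<rho>)) * jb (L * N powr \<alpha>) powr - e"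
    unfolding hP_def using mult_mono[OF mult_left_mono[OF L_jb_powr[OF assms(1)], of "N\<^sup>2"] order_refl]
    by (simp add: mult.assoc)
  also have "\<dots> \<le> N\<^sup>2 * (2 powr (2 * \<rho>) * N powr (2 * \<rho>)) * (4 * N powr - ((1 + \<alpha>) * e))"
    apply (intro mult_mono order_refl resonance_size_comparable)
    using False assms e0 rho powr_mono2[of "2*\<rho>" "jb L" "jb N"] jb_powr_large[of N "2 * \<rho>"] jb_mono[of L N] 
    by (auto simp: less_imp_le[OF jb_pos])
  also have "\<dots> = 4 * 2 powr (2 * \<rho>) * (N powr 2 * N powr (2 * \<rho>) * N powr - ((1 + \<alpha>) * e))"
    using assms by simp
  also have "N powr 2 * N powr (2 * \<rho>) * N powr - ((1 + \<alpha>) * e) = N powr (2 + 2 * \<rho> - (1 + \<alpha>) * e)"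
    by (simp add: powr_add[symmetric])
  also have "\<dots> \<le> N powr ((\<alpha> - 1) / 2)" using False by (intro critical_exponent) simp
  finally show ?thesis using False by simp
qed

text \<open>The target is the phase derivative when the smallest frequency is frozen. The
  restriction to L >= 1 is genuine: as L tends to 0 with N fixed, the left side behaves like L^(2
  \<omega>) with 2 \<omega> < 1, which no multiple of L dominates.\<close>

lemma hR_le:
  assumes "1 \<le> L" "L \<le> N"
  shows "hR N L \<le> 2 powr \<kappa> * (N powr (\<alpha> - 1) * L)"
proof -
  have e0: "0 \<le> e" "e \<le> 1" "0 \<le> e + 2 * \<omega>" using omega_bounds eps by auto
  have "hR N L \<le> N\<^sup>2 * L powr (2 * \<omega>) * (2 powr \<kappa> * L powr \<kappa>) * (L powr - (e + 2 * \<omega>) * N powr - (\<alpha> * (e + 2 * \<omega>)))"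
    unfolding hR_def
    using resonance_size[of L N "e + 2 * \<omega>"] assms e0 kappa_nonneg jb_powr_large[of L \<kappa>]
    by (intro mult_mono order_refl) auto
  also have "\<dots> = 2 powr \<kappa> * ((N powr 2 * N powr - (\<alpha> * (e + 2 * \<omega>))) * (L powr (2 * \<omega>) * L powr \<kappa> * L powr - (e + 2 * \<omega>)))"
    using assms by simp
  also have "\<dots> = 2 powr \<kappa> * (N powr (2 - \<alpha> * (e + 2 * \<omega>)) * L powr (\<kappa> - e))"
    by (simp add: powr_add[symmetric] algebra_simps)
  also have "\<dots> \<le> 2 powr \<kappa> * (N powr (\<alpha> - 1) * L powr 1)"
  proof (intro mult_left_mono mult_mono powr_mono)
    have "2 - \<alpha> * (e + 2 * \<omega>) = 2 - \<alpha> + 2 * (\<alpha> * \<epsilon>) - 2 * (\<alpha> * \<omega>)"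
      by (simp add: algebra_simps)
    also have "\<dots> \<le> \<alpha> - 1" using eps alpha_eps(1) omega_bounds(2) rho by argo
    finally show "2 - \<alpha> * (e + 2 * \<omega>) \<le> \<alpha> - 1" .
    show "\<kappa> - e \<le> 1"
      using omega_bounds alpha eps rho by (simp add: algebra_simps)
  qed (use assms in auto)
  finally show ?thesis using assms by simp
qed

text \<open>For N >= 1 the exponents balance if 4 \<rho> + 2 \<epsilon> + 2 \<alpha> \<epsilon> <= 3
  (\<alpha> - 1): two inputs of negative regularity contribute N^(4 \<rho>), while an output of
  moderate frequency returns nothing.\<close>

lemma hQ_le:
  assumes "0 < L" "L \<le> N"
  shows "hQ N L \<le> 2 powr (4 * \<rho>) * (N powr (\<alpha> - 1) * L)"
proof (cases "N \<le> 1")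
  case True
  have "hQ N L \<le> L powr (2 - 2 * \<omega>) * 1 * 2 powr (4 * \<rho>) * 1"
    unfolding hQ_def using True assms omega_bounds kappa_nonneg rho
    by (intro mult_mono order_refl jb_powr_neg_le_1 jb_powr_small) auto
  also have "\<dots> = 2 powr (4 * \<rho>) * (L powr (1 - 2 * \<omega>) * L powr 1)"
    using powr_add[of L "1 - 2 * \<omega>" 1] by simp
  also have "\<dots> \<le> 2 powr (4 * \<rho>) * (N powr (\<alpha> - 1) * L powr 1)"
  proof (intro mult_left_mono mult_right_mono)
    have "L powr (1 - 2 * \<omega>) \<le> N powr (1 - 2 * \<omega>)"
      using assms omega_bounds eps by (intro powr_mono2) auto
    \<comment> \<open>For N <= 1 a larger exponent gives a smaller power, and 1 - 2 \<omega> >=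
      \<alpha> - 1 because 2 \<omega> <= 2 \<alpha> \<omega> = 2 - \<alpha>.\<close>
    also have "\<dots> \<le> N powr (\<alpha> - 1)"
      using assms True omega_bounds(2,4) by (intro powr_mono') argo+
    finally show "L powr (1 - 2 * \<omega>) \<le> N powr (\<alpha> - 1)" .
  qed auto
  finally show ?thesis using assms by simp
next
  case False
  have Y: "jb (L * N powr \<alpha>) powr (2 * \<omega> - e) \<le> L powr (2 * \<omega> - e) * N powr (\<alpha> * (2 * \<omega> - e))"
    using resonance_size[of L N "e - 2 * \<omega>"] assms omega_bounds by (simp add: algebra_simps)
  have "hQ N L \<le> L powr (2 - 2 * \<omega>) * 1 * (2 powr (4 * \<rho>) * N powr (4 * \<rho>)) * (L powr (2 * \<omega> - e) * N powr (\<alpha> * (2 * \<omega> - e)))"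
    unfolding hQ_def using False assms omega_bounds kappa_nonneg rho
    by (intro mult_mono order_refl jb_powr_neg_le_1 jb_powr_large Y) auto
  also have "\<dots> = 2 powr (4 * \<rho>) * ((L powr (2 - 2 * \<omega>) * L powr (2 * \<omega> - e)) * (N powr (4 * \<rho>) * N powr (\<alpha> * (2 * \<omega> - e))))"
    by simp
  also have "\<dots> = 2 powr (4 * \<rho>) * ((L powr (2 * \<epsilon>) * L powr 1) * N powr (4 * \<rho> + \<alpha> * (2 * \<omega> - e)))"
    using powr_add[of L "2 * \<epsilon>" 1] by (simp add: powr_add[symmetric] add.commute)
  \<comment> \<open>The surplus power 2 \<epsilon> of L is charged to N, so that L remains to the
    first power.\<close>
  also have "\<dots> \<le> 2 powr (4 * \<rho>) * ((N powr (2 * \<epsilon>) * L powr 1) * N powr (4 * \<rho> + \<alpha> * (2 * \<omega> - e)))"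
    using assms eps by (intro mult_left_mono mult_right_mono powr_mono2) auto
  also have "\<dots> = 2 powr (4 * \<rho>) * (N powr (2 * \<epsilon> + (4 * \<rho> + \<alpha> * (2 * \<omega> - e))) * L)"
    using assms by (simp add: powr_add)
  also have "\<dots> \<le> 2 powr (4 * \<rho>) * (N powr (\<alpha> - 1) * L)"
  proof (intro mult_left_mono mult_right_mono powr_mono)
    have "2 * \<epsilon> + (4 * \<rho> + \<alpha> * (2 * \<omega> - e)) = 2 * \<epsilon> + 4 * \<rho> + 2 * (\<alpha> * \<omega>) - \<alpha> + 2 * (\<alpha> * \<epsilon>)"
      by (simp add: algebra_simps)
    also have "\<dots> \<le> \<alpha> - 1" using eps alpha_eps(1) omega_bounds(2) rho by argo
    finally show "2 * \<epsilon> + (4 * \<rho> + \<alpha> * (2 * \<omega> - e)) \<le> \<alpha> - 1" .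
  qed (use assms False in auto)
  finally show ?thesis .
qed

text \<open>Now the output bracket contributes N^(- \<kappa>), and all exponents add up to the same
  critical one as for \<open>hP\<close>.\<close>

lemma hQ_le_comparable:
  assumes "0 < L" "L \<le> N" "N \<le> 4 * L"
  shows "hQ N L \<le> 4 * 4 powr \<kappa> * 2 powr (4 * \<rho>) * max 1 N powr ((\<alpha> - 1) / 2)"
proof (cases "N \<le> 1")
  case True
  have 1: "1 \<le> 4 powr \<kappa>" using kappa_nonneg by (simp add: ge_one_powr_ge_zero)
  have "N powr (\<alpha> - 1) \<le> 1" using True assms alpha powr_mono2[of "\<alpha>-1" N 1] by simp
  then have "N powr (\<alpha> - 1) * L \<le> 1 * 1" using True assms by (intro mult_mono) auto
  then have "hQ N L \<le> 2 powr (4 * \<rho>) * 1" 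
    using assms by (intro order_trans[OF hQ_le[of L N] mult_left_mono]) auto
  also have "\<dots> \<le> (4 * 4 powr \<kappa>) * 2 powr (4 * \<rho>)" using 1 by simp
  finally show ?thesis using True by simp
next
  case False
  have Y: "jb (L * N powr \<alpha>) powr (2 * \<omega> - e) \<le> 4 * N powr ((1 + \<alpha>) * (2 * \<omega> - e))"
    using resonance_size_comparable[of L N "e - 2 * \<omega>"] assms omega_bounds eps by (simp add: algebra_simps)
  have J: "jb L powr - \<kappa> \<le> 4 powr \<kappa> * N powr - \<kappa>"
  proof -
    have "jb L powr - \<kappa> \<le> (N / 4) powr - \<kappa>"
      using assms False kappa_nonneg jb_ge_abs[of L] by (intro powr_mono2') auto
    also have "\<dots> = 4 powr \<kappa> * N powr - \<kappa>"
      unfolding powr_divide powr_minus[of _ \<kappa>] by (simp add: field_simps)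
    finally show ?thesis .
  qed
  have "hQ N L \<le> N powr (2 - 2 * \<omega>) * (4 powr \<kappa> * N powr - \<kappa>) * (2 powr (4 * \<rho>) * N powr (4 * \<rho>)) * (4 * N powr ((1 + \<alpha>) * (2 * \<omega> - e)))"
    unfolding hQ_def using False assms omega_bounds eps kappa_nonneg rho
    by (intro mult_mono order_refl J Y jb_powr_large powr_mono2) auto
  also have "\<dots> = 4 * 4 powr \<kappa> * 2 powr (4 * \<rho>) * (N powr (2 - 2 * \<omega>) * N powr - \<kappa> * N powr (4 * \<rho>) * N powr ((1 + \<alpha>) * (2 * \<omega> - e)))"
    by simp
  also have "(N powr (2 - 2 * \<omega>) * N powr - \<kappa> * N powr (4 * \<rho>) * N powr ((1 + \<alpha>) * (2 * \<omega> - e))) = N powr (2 + 2 * \<rho> - (1 + \<alpha>) * e)"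
    by (simp add: powr_add[symmetric] algebra_simps)
  also have "\<dots> \<le> N powr ((\<alpha> - 1) / 2)" using False by (intro critical_exponent) simp
  finally show ?thesis using False by simp
qed

end

section \<open>Phase and resonance\<close>

context dispersion_params
begin

text \<open>The dispersion relation: \<open>t - \<phi> x\<close> is the modulation of the point (t,
  x).\<close>

definition "\<phi> x = x * \<bar>x\<bar> powr \<alpha>"

text \<open>\<open>Gd x\<close> is the modulus of the derivative of the phase \<open>\<lambda>y. \<phi> y + \<phi> (x - y)\<close>. It vanishes at \<open>x / 2\<close>,
  which the second summand of \<open>hmax\<close> compensates.\<close>

definition "Gd x y = (1 + \<alpha>) * \<bar>\<bar>y\<bar> powr \<alpha> - \<bar>x - y\<bar> powr \<alpha>\<bar>"

text \<open>Height of the window whose width is its reciprocal, so that the window has integral 1.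
  For |x| >= 1 the square root balances both regions: at the edge of the window the phase
  derivative, of order |x|^(\<alpha> - 1) times the distance, is again of order
  \<open>cutoff x\<close>.\<close>

definition "cutoff x = max 1 \<bar>x\<bar> powr ((\<alpha> - 1) / 2)"

definition "hmax x y = Gd x y + cutoff x * of_bool (\<bar>2 * y - x\<bar> \<le> 1 / cutoff x)"

text \<open>For x other than 0, a bump in y of height |x|^\<alpha> and width |x|^(- \<alpha>), hence
  with an integral independent of x. The argument of the bracket is the resonance of a low input y
  with the output x.\<close>

definition "tail x y = \<bar>x\<bar> powr \<alpha> * jb (\<bar>y\<bar> * \<bar>x\<bar> powr \<alpha>) powr - (2 * b)"

lemma Gd_nonneg: "0 \<le> Gd x y"
  using alpha by (simp add: Gd_def)

lemma cutoff_ge_1: "1 \<le> cutoff x"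
  unfolding cutoff_def using alpha by (intro ge_one_powr_ge_zero) auto

lemma hmax_nonneg: "0 \<le> hmax x y"
  using Gd_nonneg[of x y] cutoff_ge_1[of x] by (simp add: hmax_def)

lemma tail_nonneg: "0 \<le> tail x y"
  by (simp add: tail_def)

lemma hmax_swap: "hmax x (x - y) = hmax x y"
  by (simp add: hmax_def Gd_def abs_minus_commute algebra_simps)

text \<open>Pulling out the power \<alpha> - 1 of the larger number avoids the mean value theorem
  and covers the value 0.\<close>

lemma powr_diff_ge:
  assumes "0 \<le> c" "c \<le> a"
  shows "a powr (\<alpha> - 1) * (a - c) \<le> a powr \<alpha> - c powr \<alpha>"
proof -
  have *: "x powr \<alpha> = x powr (\<alpha> - 1) * x" if "0 \<le> x" for x
    using that powr_add[of x "\<alpha> - 1" 1] by simp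
  have "c powr (\<alpha> - 1) * c \<le> a powr (\<alpha> - 1) * c"
    using assms alpha by (intro mult_right_mono powr_mono2) auto
  then show ?thesis using assms * by (simp add: algebra_simps)
qed

lemma Gd_ge:
  "max \<bar>y\<bar> \<bar>x - y\<bar> powr (\<alpha> - 1) * \<bar>\<bar>y\<bar> - \<bar>x - y\<bar>\<bar> \<le> Gd x y"
proof -
  have "max \<bar>y\<bar> \<bar>x - y\<bar> powr (\<alpha> - 1) * \<bar>\<bar>y\<bar> - \<bar>x - y\<bar>\<bar> \<le> \<bar>\<bar>y\<bar> powr \<alpha> - \<bar>x - y\<bar> powr \<alpha>\<bar>"
    using powr_diff_ge[of "\<bar>x - y\<bar>" "\<bar>y\<bar>"] powr_diff_ge[of "\<bar>y\<bar>" "\<bar>x - y\<bar>"] 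
    by (cases "\<bar>y\<bar> \<le> \<bar>x - y\<bar>") (auto simp: max_def abs_if)
  also have "\<dots> \<le> Gd x y" using alpha by (auto simp: Gd_def intro: order_trans[OF _ mult_right_mono[of 1 "1 + \<alpha>"]])
  finally show ?thesis .
qed

lemma hmax_ge_smallest:
  assumes "\<bar>x\<bar> \<le> \<bar>y\<bar>" "\<bar>x\<bar> \<le> \<bar>x - y\<bar>"
  shows "max \<bar>y\<bar> \<bar>x - y\<bar> powr (\<alpha> - 1) * \<bar>x\<bar> \<le> hmax x y"
proof -
  have "\<bar>\<bar>y\<bar> - \<bar>x - y\<bar>\<bar> = \<bar>x\<bar>" using assms by linarith
  then have "max \<bar>y\<bar> \<bar>x - y\<bar> powr (\<alpha> - 1) * \<bar>x\<bar> \<le> Gd x y"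
    using Gd_ge[of y x] by simp
  then show ?thesis using cutoff_ge_1[of x] by (simp add: hmax_def)
qed

text \<open>Here the smallest frequency y varies. Two bounds on h are needed because the size of the
  phase derivative depends on whether y is comparable to N.\<close>

lemma hmax_ge_other:
  assumes y: "\<bar>y\<bar> \<le> \<bar>x\<bar>" "\<bar>y\<bar> \<le> \<bar>x - y\<bar>" "y \<noteq> 0" and N: "N = max \<bar>x\<bar> \<bar>x - y\<bar>"
    and A: "0 \<le> A" "h \<le> A * N powr \<alpha>" 
    and comparable: "N \<le> 4 * \<bar>y\<bar> \<Longrightarrow> h \<le> A * max 1 N powr ((\<alpha> - 1) / 2)"
  shows "h \<le> 4 * A * hmax x y"
proof -
  define z where "z = x - y"
  have N0: "0 < N" using y N by linarith
  have zN: "N / 2 \<le> \<bar>z\<bar>" using y N abs_triangle_ineq[of y "x - y"] by (simp add: z_def)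
  have "(1/2) * N powr (\<alpha> - 1) \<le> (1/2) powr (\<alpha> - 1) * N powr (\<alpha> - 1)"
    using alpha powr_mono'[of "\<alpha> - 1" 1 "1/2::real"] by (intro mult_right_mono) auto
  also have "\<dots> = (N / 2) powr (\<alpha> - 1)" by (simp add: powr_mult[symmetric])
  also have "\<dots> \<le> \<bar>z\<bar> powr (\<alpha> - 1)" using zN N0 alpha by (intro powr_mono2) auto
  finally have zp: "N powr (\<alpha> - 1) / 2 \<le> \<bar>z\<bar> powr (\<alpha> - 1)" by simp
  have G: "\<bar>z\<bar> powr (\<alpha> - 1) * (\<bar>z\<bar> - \<bar>y\<bar>) \<le> Gd x y"
    using Gd_ge[of y x] y by (simp add: z_def max_def)
  have G': "N powr (\<alpha> - 1) / 2 * t \<le> Gd x y" if "t \<le> \<bar>z\<bar> - \<bar>y\<bar>" "0 \<le> t" for t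
    using mult_mono[OF zp that(1)] G that(2) by (auto intro: order_trans)
  show ?thesis
  proof (cases "N / 2 \<le> \<bar>z\<bar> - \<bar>y\<bar>")
    case True
    then have "N powr (\<alpha> - 1) / 2 * (N / 2) \<le> Gd x y" using G'[of "N/2"] N0 by simp
    moreover have "N powr \<alpha> = N powr (\<alpha> - 1) * N" using N0 powr_add[of N "\<alpha> - 1" 1] by simp
    ultimately have "N powr \<alpha> \<le> 4 * Gd x y" by simp
    also have "\<dots> \<le> 4 * hmax x y" using cutoff_ge_1[of x] by (simp add: hmax_def)
    finally have "A * N powr \<alpha> \<le> A * (4 * hmax x y)" using A by (intro mult_left_mono) auto
    then show ?thesis using A by simp
  next
    case False
    have Nx: "N = \<bar>x\<bar>"
    proof (rule ccontr)
      assume "N \<noteq> \<bar>x\<bar>"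
      then have "N = \<bar>x - y\<bar>" "\<bar>x\<bar> < \<bar>x - y\<bar>" using N by auto
      then show False using False y by (auto simp: z_def abs_if split: if_splits)
    qed
    have eqs: "N = \<bar>x\<bar>" "\<bar>z\<bar> - \<bar>y\<bar> = \<bar>2 * y - x\<bar>" "N \<le> 4 * \<bar>y\<bar>" "\<bar>2 * y - x\<bar> \<le> N"
      using False y unfolding z_def Nx by (auto simp: abs_if split: if_splits)
    have h: "h \<le> A * cutoff x" using comparable eqs by (simp add: cutoff_def)
    have "cutoff x \<le> 4 * hmax x y"
    proof (cases "\<bar>2 * y - x\<bar> \<le> 1 / cutoff x")
      case True
      then show ?thesis using Gd_nonneg[of x y] cutoff_ge_1[of x] by (simp add: hmax_def)
    next
      case F: False
      have "1 < N"
      proof (rule ccontr)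
        assume "\<not> 1 < N"
        then show False using F eqs by (simp add: cutoff_def)
      qed
      \<comment> \<open>Outside the window the distance to the critical point exceeds 1 /
        \<open>cutoff x\<close>, so one of the two factors survives in the lower bound for the
        derivative.\<close>
      then have sq: "N powr (\<alpha> - 1) = cutoff x * cutoff x"
        using eqs by (simp add: cutoff_def powr_add[symmetric])
      have "N powr (\<alpha> - 1) / 2 * (1 / cutoff x) \<le> Gd x y"
        using F eqs cutoff_ge_1[of x] by (intro G') auto
      then have "cutoff x \<le> 2 * Gd x y" using cutoff_ge_1[of x] by (simp add: sq)
      also have "\<dots> \<le> 4 * Gd x y" using Gd_nonneg[of x y] by simp
      also have "\<dots> \<le> 4 * hmax x y" using cutoff_ge_1[of x] by (simp add: hmax_def)
      finally show ?thesis .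
    qed
    then have "A * cutoff x \<le> A * (4 * hmax x y)" using A by (intro mult_left_mono) auto
    then show ?thesis using h by simp
  qed
qed

section \<open>The resonance function\<close>

lemma phi_minus: "\<phi> (- x) = - \<phi> x"
  by (simp add: \<phi>_def)

text \<open>Distributing the larger power over m + l leaves two nonnegative differences. The one
  with factor l suffices: l <= (m + l) / 2, so its subtracted power is at most half of the other, as
  \<alpha> >= 1.\<close>

lemma resonance_nonneg:
  assumes "0 \<le> l" "l \<le> m"
  shows "l * (m + l) powr \<alpha> / 2 \<le> \<phi> (m + l) - \<phi> m - \<phi> l"
proof -
  have 1: "m powr \<alpha> \<le> (m + l) powr \<alpha>" using assms alpha by (intro powr_mono2) auto
  have "l powr \<alpha> \<le> ((1/2) * (m + l)) powr \<alpha>" using assms alpha by (intro powr_mono2) auto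
  also have "\<dots> \<le> (1/2) * (m + l) powr \<alpha>"
    unfolding powr_mult using powr_mono'[of 1 \<alpha> "1/2::real"] alpha by (intro mult_right_mono) auto
  finally have 2: "l * (l powr \<alpha>) \<le> l * ((m + l) powr \<alpha> / 2)" using assms by (intro mult_left_mono) auto
  have "\<phi> (m + l) - \<phi> m - \<phi> l = m * ((m + l) powr \<alpha> - m powr \<alpha>) + (l * (m + l) powr \<alpha> - l * l powr \<alpha>)"
    using assms by (simp add: \<phi>_def algebra_simps)
  moreover have "0 \<le> m * ((m + l) powr \<alpha> - m powr \<alpha>)" using assms 1 by simp
  ultimately show ?thesis using 2 by linarith
qed

lemma resonance_same_sign:
  assumes "0 \<le> y * z"
  shows "min \<bar>y\<bar> \<bar>z\<bar> * \<bar>y + z\<bar> powr \<alpha> / 2 \<le> \<bar>\<phi> (y + z) - \<phi> y - \<phi> z\<bar>"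
proof -
  have nn: "min y z * (y + z) powr \<alpha> / 2 \<le> \<bar>\<phi> (y + z) - \<phi> y - \<phi> z\<bar>" if "0 \<le> y" "0 \<le> z" for y z
  proof (cases "y \<le> z")
    case True
    then show ?thesis using resonance_nonneg[of y z] that abs_ge_self[of "\<phi> (y + z) - \<phi> y - \<phi> z"]
      by (simp add: min_def add.commute)
  next
    case False
    then show ?thesis using resonance_nonneg[of z y] that abs_ge_self[of "\<phi> (y + z) - \<phi> y - \<phi> z"]
      by (simp add: min_def add.commute)
  qed
  consider "0 \<le> y" "0 \<le> z" | "y \<le> 0" "z \<le> 0" using assms by (auto simp: zero_le_mult_iff)
  then show ?thesis
  proof cases
    case 1 then show ?thesis using nn[of y z] by simp
  next
    case 2
    have "- y - z = - (y + z)" by simp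
    then have "\<phi> (- y - z) = - \<phi> (y + z)" by (simp only: phi_minus)
    then have "\<bar>\<phi> (y + z) - \<phi> y - \<phi> z\<bar> = \<bar>\<phi> (- y + - z) - \<phi> (- y) - \<phi> (- z)\<bar>"
      by (simp add: phi_minus)
    then show ?thesis using 2 nn[of "-y" "-z"] by simp
  qed
qed

text \<open>If the inputs have opposite signs, moving \<xi>2 to the other side writes \<xi>1 as a
  sum of two frequencies of equal sign, and up to sign the resonance function is unchanged.\<close>

lemma resonance:
  assumes "\<bar>\<xi>\<^sub>2\<bar> \<le> \<bar>\<xi>\<^sub>1\<bar>" "\<xi> = \<xi>\<^sub>1 + \<xi>\<^sub>2" "N = max \<bar>\<xi>\<bar> \<bar>\<xi>\<^sub>1\<bar>" "L = min \<bar>\<xi>\<bar> \<bar>\<xi>\<^sub>2\<bar>"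
  shows "L * N powr \<alpha> / 2 \<le> \<bar>\<phi> \<xi> - \<phi> \<xi>\<^sub>1 - \<phi> \<xi>\<^sub>2\<bar>"
proof (cases "0 \<le> \<xi>\<^sub>1 * \<xi>\<^sub>2")
  case True
  then have "N = \<bar>\<xi>\<bar>" "L = \<bar>\<xi>\<^sub>2\<bar>" using assms by (auto simp: zero_le_mult_iff)
  then show ?thesis using resonance_same_sign[OF True] assms by (simp add: min_absorb2)
next
  case False
  then have "0 \<le> \<xi> * - \<xi>\<^sub>2" "N = \<bar>\<xi>\<^sub>1\<bar>" using assms by (auto simp: zero_le_mult_iff mult_le_0_iff)
  moreover have "\<xi>\<^sub>1 = \<xi> + - \<xi>\<^sub>2" using assms by simp
  moreover have "\<bar>\<phi> \<xi> - \<phi> \<xi>\<^sub>1 - \<phi> \<xi>\<^sub>2\<bar> = \<bar>\<phi> \<xi>\<^sub>1 - \<phi> \<xi> - \<phi> (- \<xi>\<^sub>2)\<bar>"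
    by (simp add: phi_minus)
  ultimately show ?thesis using resonance_same_sign[of \<xi> "- \<xi>\<^sub>2"] assms(4) by simp
qed

end

section \<open>The interaction kernel\<close>

lemma jb_le_iff: "jb a \<le> jb c \<longleftrightarrow> \<bar>a\<bar> \<le> \<bar>c\<bar>"
  by (simp add: jb_def abs_le_square_iff)

text \<open>Moves the weaker decay exponent onto the dominant modulation.\<close>

lemma powr_exchange_le:
  fixes s S :: real
  assumes "0 < s" "s \<le> S" "q \<le> p"
  shows "s powr p * S powr q \<le> s powr q * S powr p"
proof -
  have "s powr (p - q) \<le> S powr (p - q)" using assms by (intro powr_mono2) auto
  then have "s powr q * S powr q * s powr (p - q) \<le> s powr q * S powr q * S powr (p - q)"
    by (intro mult_left_mono) auto
  then show ?thesis using assms by (simp add: powr_diff field_simps)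
qed

lemma powr_neg_scale:
  fixes Y S :: real
  assumes "0 < Y" "Y \<le> 6 * S" "0 \<le> q"
  shows "S powr - q \<le> 6 powr q * Y powr - q"
proof -
  have "S powr - q \<le> (Y / 6) powr - q" using assms by (intro powr_mono2') auto
  then show ?thesis by (simp add: powr_divide powr_minus divide_simps mult_ac)
qed

context dispersion_params
begin

text \<open>The anisotropic size of a space-time frequency, raised to 2 \<omega> in the weight. It
  appears in the numerator for the output and in the denominator for the inputs.\<close>

definition "V t x = jb (\<bar>t\<bar> + \<bar>x\<bar> powr (1 + \<alpha>))"

lemma V_pos: "0 < V t x" by (simp add: V_def jb_pos)

lemma abs_phi: "\<bar>\<phi> x\<bar> = \<bar>x\<bar> powr (1 + \<alpha>)"
  by (simp add: \<phi>_def abs_mult powr_add)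

lemma V_ge_modulation: "jb (t - \<phi> x) \<le> V t x"
  unfolding V_def using abs_phi[of x] abs_triangle_ineq4[of t "\<phi> x"] by (intro jb_mono) simp

lemma V_ge_frequency: "jb (\<bar>x\<bar> powr (1 + \<alpha>)) \<le> V t x"
  unfolding V_def by (intro jb_mono) simp

lemma two_powr_le: "2 powr (1 + \<alpha>) \<le> 8"
  using powr_mono[of "1 + \<alpha>" 3 "2::real"] alpha by simp

lemma V_ge_jb_powr: "jb x powr (1 + \<alpha>) \<le> 8 * V t x"
proof (cases "\<bar>x\<bar> \<le> 1")
  case True
  then have "jb x powr (1 + \<alpha>) \<le> 8" using jb_powr_small[of x "1 + \<alpha>"] alpha two_powr_le by simp
  then show ?thesis using jb_ge_1[of "\<bar>t\<bar> + \<bar>x\<bar> powr (1 + \<alpha>)"] by (simp add: V_def)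
next
  case False
  have "jb x powr (1 + \<alpha>) = jb \<bar>x\<bar> powr (1 + \<alpha>)" by (simp add: jb_def)
  also have "\<dots> \<le> 2 powr (1 + \<alpha>) * \<bar>x\<bar> powr (1 + \<alpha>)" using jb_powr_large[of "\<bar>x\<bar>" "1 + \<alpha>"] False alpha by simp
  also have "\<dots> \<le> 8 * V t x"
    using two_powr_le jb_ge_abs[of "\<bar>x\<bar> powr (1 + \<alpha>)"] V_ge_frequency[of x t] by (intro mult_mono) auto
  finally show ?thesis .
qed

text \<open>The power 1 + \<alpha> spoils subadditivity by at most 2^(1 + \<alpha>) <= 8, since the
  sum is at most twice the maximum.\<close>

lemma V_add: "V (t + t') (x + x') \<le> 8 * (V t x + V t' x')"
proof -
  have "\<bar>x + x'\<bar> powr (1 + \<alpha>) \<le> (2 * max \<bar>x\<bar> \<bar>x'\<bar>) powr (1 + \<alpha>)"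
    using alpha by (intro powr_mono2) auto
  also have "\<dots> \<le> 8 * max \<bar>x\<bar> \<bar>x'\<bar> powr (1 + \<alpha>)"
    unfolding powr_mult using two_powr_le by (intro mult_right_mono) auto
  also have "\<dots> \<le> 8 * (\<bar>x\<bar> powr (1 + \<alpha>) + \<bar>x'\<bar> powr (1 + \<alpha>))" by (auto simp: max_def)
  finally have "\<bar>t + t'\<bar> + \<bar>x + x'\<bar> powr (1 + \<alpha>) \<le> 8 * ((\<bar>t\<bar> + \<bar>x\<bar> powr (1 + \<alpha>)) + (\<bar>t'\<bar> + \<bar>x'\<bar> powr (1 + \<alpha>)))"
    by (simp add: algebra_simps)
  then have "V (t + t') (x + x') \<le> 8 * jb ((\<bar>t\<bar> + \<bar>x\<bar> powr (1 + \<alpha>)) + (\<bar>t'\<bar> + \<bar>x'\<bar> powr (1 + \<alpha>)))"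
    unfolding V_def by (intro jb_scale) auto
  also have "\<dots> \<le> 8 * (V t x + V t' x')" unfolding V_def by (intro mult_left_mono jb_add) auto
  finally show ?thesis .
qed

lemma V_le: "V t x \<le> jb (t - \<phi> x) + 2 * jb (\<bar>x\<bar> powr (1 + \<alpha>))"
proof -
  have "\<bar>t\<bar> + \<bar>x\<bar> powr (1 + \<alpha>) \<le> \<bar>t - \<phi> x\<bar> + 2 * \<bar>x\<bar> powr (1 + \<alpha>)"
    using abs_phi[of x] abs_triangle_ineq[of "t - \<phi> x" "\<phi> x"] by simp
  then have "V t x \<le> jb (\<bar>t - \<phi> x\<bar> + 2 * \<bar>x\<bar> powr (1 + \<alpha>))"
    unfolding V_def by (intro jb_mono) auto
  also have "\<dots> \<le> jb \<bar>t - \<phi> x\<bar> + jb (2 * \<bar>x\<bar> powr (1 + \<alpha>))" by (rule jb_add)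
  also have "jb \<bar>t - \<phi> x\<bar> = jb (t - \<phi> x)" by (simp add: jb_def)
  also have "jb (2 * \<bar>x\<bar> powr (1 + \<alpha>)) \<le> 2 * jb (\<bar>x\<bar> powr (1 + \<alpha>))" by (intro jb_scale) auto
  finally show ?thesis by simp
qed

text \<open>\<open>Kq\<close> vanishes if an input frequency is \<open>0\<close>, since then a weight in the denominator is \<open>0\<close>.\<close>

definition "Kq t\<^sub>1 x\<^sub>1 t\<^sub>2 x\<^sub>2 = (x\<^sub>1 + x\<^sub>2)\<^sup>2 * Xweight \<alpha> (- \<rho>) \<omega> b' (t\<^sub>1 + t\<^sub>2, x\<^sub>1 + x\<^sub>2) /
   (Xweight \<alpha> (- \<rho>) \<omega> b (t\<^sub>1, x\<^sub>1) * Xweight \<alpha> (- \<rho>) \<omega> b (t\<^sub>2, x\<^sub>2))"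

end

text \<open>The opposite order of the inputs follows from the symmetry of \<open>Kq\<close> and
  \<open>majorant\<close>. If one of the three frequencies vanishes, then \<open>Kq\<close> is
  0.\<close>

locale interaction = dispersion_params +
  fixes t\<^sub>1 x\<^sub>1 t\<^sub>2 x\<^sub>2 :: real
  assumes nz: "x\<^sub>1 \<noteq> 0" "x\<^sub>2 \<noteq> 0" "x\<^sub>1 + x\<^sub>2 \<noteq> 0" and ord: "\<bar>x\<^sub>2\<bar> \<le> \<bar>x\<^sub>1\<bar>"
begin

abbreviation "t \<equiv> t\<^sub>1 + t\<^sub>2"
abbreviation "x \<equiv> x\<^sub>1 + x\<^sub>2"
abbreviation "s \<equiv> jb (t - \<phi> x)"
abbreviation "s\<^sub>1 \<equiv> jb (t\<^sub>1 - \<phi> x\<^sub>1)"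
abbreviation "s\<^sub>2 \<equiv> jb (t\<^sub>2 - \<phi> x\<^sub>2)"
abbreviation "v \<equiv> V t x"
abbreviation "v\<^sub>1 \<equiv> V t\<^sub>1 x\<^sub>1"
abbreviation "v\<^sub>2 \<equiv> V t\<^sub>2 x\<^sub>2"
text \<open>By \<open>ord\<close> two of the three moduli determine the largest frequency, and two
  the smallest.\<close>

definition "N = max \<bar>x\<bar> \<bar>x\<^sub>1\<bar>"
definition "L = min \<bar>x\<bar> \<bar>x\<^sub>2\<bar>"
abbreviation "Y \<equiv> jb (L * N powr \<alpha>)"

lemma N_pos: "0 < N" and L_pos: "0 < L" and L_le_N: "L \<le> N" and N_bounds: "N \<le> 2 * \<bar>x\<^sub>1\<bar>"
  using nz ord by (auto simp: N_def L_def)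

lemma N_ge: "\<bar>x\<bar> \<le> N" "\<bar>x\<^sub>1\<bar> \<le> N"
  by (auto simp: N_def)

lemma L_eq: "\<bar>x\<^sub>2\<bar> \<le> \<bar>x\<bar> \<Longrightarrow> L = \<bar>x\<^sub>2\<bar>" "\<bar>x\<bar> \<le> \<bar>x\<^sub>2\<bar> \<Longrightarrow> L = \<bar>x\<bar>"
  by (auto simp: L_def)

lemma N_eq: "\<bar>x\<bar> \<le> \<bar>x\<^sub>2\<bar> \<Longrightarrow> N = \<bar>x\<^sub>1\<bar>"
  using ord by (auto simp: N_def)

text \<open>The resonance function is the sum of the input modulations minus that of the output, so
  it is at most three times the largest modulus; \<open>resonance\<close> loses a further factor 2.
  Writing S as a bracket lets the comparison pass to the arguments.\<close>

lemma Y_le: 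
  assumes "s \<le> S" "s\<^sub>1 \<le> S" "s\<^sub>2 \<le> S" "S = jb m"
  shows "Y \<le> 6 * S"
proof -
  have "L * N powr \<alpha> / 2 \<le> \<bar>\<phi> x - \<phi> x\<^sub>1 - \<phi> x\<^sub>2\<bar>" using resonance[OF ord refl N_def L_def] .
  also have "\<dots> = \<bar>(t\<^sub>1 - \<phi> x\<^sub>1) + (t\<^sub>2 - \<phi> x\<^sub>2) - (t - \<phi> x)\<bar>" by simp
  also have "\<dots> \<le> \<bar>m\<bar> + \<bar>m\<bar> + \<bar>m\<bar>" using assms by (simp add: jb_le_iff)
  finally have "\<bar>L * N powr \<alpha>\<bar> \<le> 6 * \<bar>m\<bar>" using L_pos by simp
  then show ?thesis unfolding assms(4) by (intro jb_scale) auto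
qed

lemma Kq_expand:
  "Kq t\<^sub>1 x\<^sub>1 t\<^sub>2 x\<^sub>2 = (\<bar>x\<bar> powr (2 - 2 * \<omega>) * jb x powr - \<kappa> * v powr (2 * \<omega>) * s powr - e)
     * (\<bar>x\<^sub>1\<bar> powr (2 * \<omega>) * jb x\<^sub>1 powr \<kappa> * v\<^sub>1 powr - (2 * \<omega>) * s\<^sub>1 powr - (2 * b))
     * (\<bar>x\<^sub>2\<bar> powr (2 * \<omega>) * jb x\<^sub>2 powr \<kappa> * v\<^sub>2 powr - (2 * \<omega>) * s\<^sub>2 powr - (2 * b))"
proof -
  have W: "Xweight \<alpha> (- \<rho>) \<omega> c (a, y) = \<bar>y\<bar> powr - (2 * \<omega>) * jb y powr - \<kappa> * V a y powr (2 * \<omega>) * jb (a - \<phi> y) powr (2 * c)" for c a y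
    by (simp add: Xweight_def V_def \<phi>_def algebra_simps)
  have e: "2 * b' = - e" by (simp add: b'_def)
  have x2: "x\<^sup>2 = \<bar>x\<bar> powr 2" using nz by simp
  have p: "\<bar>x\<bar> powr 2 * \<bar>x\<bar> powr - (2 * \<omega>) = \<bar>x\<bar> powr (2 - 2 * \<omega>)" 
    using powr_add[of "\<bar>x\<bar>" 2 "- (2 * \<omega>)"] by simp
  \<comment> \<open>Stated for arbitrary reals so that a single rewrite turns the quotient of
    weights into negative powers, grouped by the three points.\<close>
  have div: "(A * (B1 * C1 * D1 * E1)) / ((B2 powr - p * C2 powr - q * D2 powr p * E2 powr r) * (B3 powr - p * C3 powr - q * D3 powr p * E3 powr r)) 
    = ((A * B1) * C1 * D1 * E1) * (B2 powr p * C2 powr q * D2 powr - p * E2 powr - r) * (B3 powr p * C3 powr q * D3 powr - p * E3 powr - r)"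
    for A B1 C1 D1 E1 B2 C2 D2 E2 B3 C3 D3 E3 p q r :: real
    by (simp add: powr_minus divide_inverse)
  show ?thesis
    unfolding Kq_def W e x2 div p ..
qed

text \<open>Q is left open because v / (v1 v2) is controlled in two ways: by the bracket of L alone,
  or by the resonance when the low input carries the largest modulation. The brackets of the two
  high frequencies cancel up to 2^\<kappa>.\<close>

lemma Kq_le_low_input:
  assumes "\<bar>x\<^sub>2\<bar> \<le> \<bar>x\<bar>" "v \<le> Q * (v\<^sub>1 * v\<^sub>2)"
  shows "Kq t\<^sub>1 x\<^sub>1 t\<^sub>2 x\<^sub>2 \<le> 2 powr \<kappa> * (N\<^sup>2 * L powr (2 * \<omega>) * jb L powr \<kappa> * Q powr (2 * \<omega>)) *
    (s powr - e * s\<^sub>1 powr - (2 * b) * s\<^sub>2 powr - (2 * b))"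
proof -
  have L: "L = \<bar>x\<^sub>2\<bar>" "jb x\<^sub>2 = jb L" using L_eq(1)[OF assms(1)] by (auto simp: jb_def)
  have w: "0 \<le> 2 * \<omega>" "0 \<le> 2 - 2 * \<omega>" using omega_bounds eps by auto
  have 1: "\<bar>x\<bar> powr (2 - 2 * \<omega>) * \<bar>x\<^sub>1\<bar> powr (2 * \<omega>) \<le> N\<^sup>2"
  proof -
    have "\<bar>x\<bar> powr (2 - 2 * \<omega>) * \<bar>x\<^sub>1\<bar> powr (2 * \<omega>) \<le> N powr (2 - 2 * \<omega>) * N powr (2 * \<omega>)"
      using w N_ge N_pos by (intro mult_mono powr_mono2) auto
    also have "\<dots> = N\<^sup>2" using N_pos by (simp add: powr_add[symmetric])
    finally show ?thesis .
  qed
  have 2: "jb x powr - \<kappa> * jb x\<^sub>1 powr \<kappa> \<le> 2 powr \<kappa>"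
  proof -
    have "\<bar>x\<^sub>1\<bar> \<le> 2 * \<bar>x\<bar>" using assms abs_triangle_ineq4[of x x\<^sub>2] by simp
    then have "jb x\<^sub>1 powr \<kappa> \<le> (2 * jb x) powr \<kappa>"
      using kappa_nonneg jb_pos[of x\<^sub>1] by (intro powr_mono2 jb_scale) auto
    then have "jb x\<^sub>1 powr \<kappa> \<le> 2 powr \<kappa> * jb x powr \<kappa>" unfolding powr_mult .
    then show ?thesis unfolding powr_minus[of _ \<kappa>] using jb_pos[of x] by (simp add: field_simps)
  qed
  have 3: "v powr (2 * \<omega>) * (v\<^sub>1 powr - (2 * \<omega>) * v\<^sub>2 powr - (2 * \<omega>)) \<le> Q powr (2 * \<omega>)"
  proof -
    have "v powr (2 * \<omega>) \<le> (Q * (v\<^sub>1 * v\<^sub>2)) powr (2 * \<omega>)"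
      using assms w V_pos[of t x] by (intro powr_mono2) auto
    then show ?thesis using V_pos[of t\<^sub>1 x\<^sub>1] V_pos[of t\<^sub>2 x\<^sub>2] by (simp add: powr_mult powr_minus field_simps)
  qed
  have "Kq t\<^sub>1 x\<^sub>1 t\<^sub>2 x\<^sub>2 = (jb x powr - \<kappa> * jb x\<^sub>1 powr \<kappa>) * ((\<bar>x\<bar> powr (2 - 2 * \<omega>) * \<bar>x\<^sub>1\<bar> powr (2 * \<omega>)) * L powr (2 * \<omega>) * jb L powr \<kappa>
     * (v powr (2 * \<omega>) * (v\<^sub>1 powr - (2 * \<omega>) * v\<^sub>2 powr - (2 * \<omega>)))) * (s powr - e * s\<^sub>1 powr - (2 * b) * s\<^sub>2 powr - (2 * b))"
    unfolding Kq_expand L(2) L(1)[symmetric] by (simp only: mult_ac)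
  also have "\<dots> \<le> 2 powr \<kappa> * (N\<^sup>2 * L powr (2 * \<omega>) * jb L powr \<kappa> * Q powr (2 * \<omega>)) *
    (s powr - e * s\<^sub>1 powr - (2 * b) * s\<^sub>2 powr - (2 * b))"
    by (intro mult_mono 1 2 3 order_refl) auto
  finally show ?thesis .
qed

end

lemma le_mult_ge_1: "1 \<le> c \<Longrightarrow> 0 \<le> a \<Longrightarrow> a \<le> c * (a :: real)"
  using mult_right_mono[of 1 c a] by simp

context dispersion_params
begin

text \<open>Each of the first three terms lacks the decay of one point, namely the one that carries
  the dominant modulation and is frozen later; its frequency is the first argument of
  \<open>hmax\<close>. The last two serve a low input with dominant modulation: its decay is
  contained in \<open>tail\<close>, and the output is frozen.\<close>

definition "majorant t\<^sub>1 x\<^sub>1 t\<^sub>2 x\<^sub>2 =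
  (let s = jb (t\<^sub>1 + t\<^sub>2 - \<phi> (x\<^sub>1 + x\<^sub>2)) powr - (2 * b);
       s\<^sub>1 = jb (t\<^sub>1 - \<phi> x\<^sub>1) powr - (2 * b); s\<^sub>2 = jb (t\<^sub>2 - \<phi> x\<^sub>2) powr - (2 * b)
   in s\<^sub>1 * s\<^sub>2 * hmax (x\<^sub>1 + x\<^sub>2) x\<^sub>1 + s * s\<^sub>2 * hmax x\<^sub>1 (x\<^sub>1 + x\<^sub>2) + s * s\<^sub>1 * hmax x\<^sub>2 (x\<^sub>1 + x\<^sub>2)
      + s\<^sub>1 * tail (x\<^sub>1 + x\<^sub>2) x\<^sub>2 + s\<^sub>2 * tail (x\<^sub>1 + x\<^sub>2) x\<^sub>1)"

lemma majorant_commute: "majorant t\<^sub>1 x\<^sub>1 t\<^sub>2 x\<^sub>2 = majorant t\<^sub>2 x\<^sub>2 t\<^sub>1 x\<^sub>1"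
  using hmax_swap[of "x\<^sub>1 + x\<^sub>2" x\<^sub>1] by (simp add: majorant_def Let_def algebra_simps)

lemma Kq_commute: "Kq t\<^sub>1 x\<^sub>1 t\<^sub>2 x\<^sub>2 = Kq t\<^sub>2 x\<^sub>2 t\<^sub>1 x\<^sub>1"
  by (simp add: Kq_def algebra_simps)

text \<open>In these constants 128 and 112 bound quotients of \<open>V\<close>, 6 is the loss of
  \<open>Y_le\<close>, 8 that of \<open>V_ge_jb_powr\<close>, and 36 that of
  \<open>low_output_modulation\<close>.\<close>

definition "cP = 2 powr \<kappa> * 128 powr (2 * \<omega>) * 6 powr e * (4 * (4 * 2 powr (2 * \<rho>)))"
definition "cR = 2 powr \<kappa> * 112 powr (2 * \<omega>) * 6 powr e * 2 powr \<kappa>"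
definition "cT = 2 powr \<kappa> * 112 powr (2 * \<omega>) * 6 powr (2 * b) * (2 powr \<kappa> * 4)"
definition "cQ = 8 powr (2 * \<omega>) * 8 powr (2 * \<omega>) * 36 * (16 * 4 powr \<kappa> * 2 powr (4 * \<rho>))"

end

context interaction
begin

lemma majorant_ge:
  shows "s\<^sub>1 powr - (2 * b) * s\<^sub>2 powr - (2 * b) * hmax x x\<^sub>1 \<le> majorant t\<^sub>1 x\<^sub>1 t\<^sub>2 x\<^sub>2"
    and "s powr - (2 * b) * s\<^sub>2 powr - (2 * b) * hmax x\<^sub>1 x \<le> majorant t\<^sub>1 x\<^sub>1 t\<^sub>2 x\<^sub>2"
    and "s powr - (2 * b) * s\<^sub>1 powr - (2 * b) * hmax x\<^sub>2 x \<le> majorant t\<^sub>1 x\<^sub>1 t\<^sub>2 x\<^sub>2"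
    and "s\<^sub>1 powr - (2 * b) * tail x x\<^sub>2 \<le> majorant t\<^sub>1 x\<^sub>1 t\<^sub>2 x\<^sub>2"
  by (auto simp: majorant_def Let_def intro!: add_nonneg_nonneg mult_nonneg_nonneg hmax_nonneg tail_nonneg
    add_increasing add_increasing2)

lemma s_pos: "0 < s" "0 < s\<^sub>1" "0 < s\<^sub>2" and Y_pos: "0 < Y"
  by (rule jb_pos)+

lemma exponents: "0 \<le> e" "e \<le> 1" "- (2 * b) \<le> - e" "0 \<le> 2 * \<omega>" "2 * \<omega> \<le> 1" "2 * \<omega> - e \<le> 0" "- (2 * b) \<le> 2 * \<omega> - e"
  using omega_bounds eps by (auto simp: b_def)

section \<open>Interactions whose smallest frequency is an input\<close>

lemma low_input_basic:
  assumes P: "\<bar>x\<^sub>2\<bar> \<le> \<bar>x\<bar>"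
  shows "Kq t\<^sub>1 x\<^sub>1 t\<^sub>2 x\<^sub>2 \<le> 2 powr \<kappa> * 128 powr (2 * \<omega>) * (N\<^sup>2 * L powr (2 * \<omega>) * jb L powr (2 * \<rho> - 2 * \<omega>)) *
    (s powr - e * s\<^sub>1 powr - (2 * b) * s\<^sub>2 powr - (2 * b))"
proof -
  define j where "j = jb L powr (1 + \<alpha>)"
  have j: "0 < j" using jb_pos[of L] by (simp add: j_def)
  have j2: "j \<le> 8 * v\<^sub>2"
  proof -
    have "j = jb x\<^sub>2 powr (1 + \<alpha>)" using L_eq(1)[OF P] by (simp add: j_def jb_def)
    then show ?thesis using V_ge_jb_powr[of x\<^sub>2 t\<^sub>2] by simp
  qed
  have j1: "j \<le> 8 * v\<^sub>1"
  proof -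
    have "j \<le> jb x\<^sub>1 powr (1 + \<alpha>)" unfolding j_def 
      using ord L_eq(1)[OF P] alpha jb_pos[of L] by (intro powr_mono2 jb_mono) auto
    then show ?thesis using V_ge_jb_powr[of x\<^sub>1 t\<^sub>1] by simp
  qed
  \<comment> \<open>Both inputs have frequency at least L, so j may be replaced by 8 times either of
    their sizes, crosswise; this gives 8 (8 + 8) = 128.\<close>
  have "v * j \<le> 8 * (v\<^sub>1 * j + v\<^sub>2 * j)"
    using mult_right_mono[OF V_add[of t\<^sub>1 t\<^sub>2 x\<^sub>1 x\<^sub>2], of j] j by (simp add: algebra_simps)
  also have "\<dots> \<le> 8 * (v\<^sub>1 * (8 * v\<^sub>2) + v\<^sub>2 * (8 * v\<^sub>1))"
    using V_pos[of t\<^sub>1 x\<^sub>1] V_pos[of t\<^sub>2 x\<^sub>2] j1 j2 by (intro mult_left_mono add_mono) auto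
  finally have v: "v \<le> (128 / j) * (v\<^sub>1 * v\<^sub>2)" using j by (simp add: field_simps)
  have Q: "jb L powr \<kappa> * (128 / j) powr (2 * \<omega>) = 128 powr (2 * \<omega>) * jb L powr (2 * \<rho> - 2 * \<omega>)"
  proof -
    have "(128 / j) powr (2 * \<omega>) = 128 powr (2 * \<omega>) * jb L powr - ((1 + \<alpha>) * (2 * \<omega>))"
      unfolding j_def powr_divide powr_powr by (simp only: powr_minus divide_inverse)
    moreover have "jb L powr \<kappa> * jb L powr - ((1 + \<alpha>) * (2 * \<omega>)) = jb L powr (2 * \<rho> - 2 * \<omega>)"
      unfolding powr_add[symmetric] by (simp add: algebra_simps)
    ultimately show ?thesis by (simp add: mult_ac)
  qed
  have eq: "N\<^sup>2 * L powr (2 * \<omega>) * jb L powr \<kappa> * (128 / j) powr (2 * \<omega>) = 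
     128 powr (2 * \<omega>) * (N\<^sup>2 * L powr (2 * \<omega>) * jb L powr (2 * \<rho> - 2 * \<omega>))"
  proof -
    have "N\<^sup>2 * L powr (2 * \<omega>) * jb L powr \<kappa> * (128 / j) powr (2 * \<omega>) = N\<^sup>2 * L powr (2 * \<omega>) * (jb L powr \<kappa> * (128 / j) powr (2 * \<omega>))"
      by (simp only: mult.assoc)
    then show ?thesis unfolding Q by (simp only: mult_ac)
  qed
  show ?thesis using Kq_le_low_input[OF P v] unfolding eq by (simp only: mult.assoc)
qed

text \<open>S is the dominant modulation and R the decay of the other two points, so that one
  statement serves a dominant output as well as a dominant high input.\<close>

lemma low_input_hP:
  assumes P: "\<bar>x\<^sub>2\<bar> \<le> \<bar>x\<bar>" and S: "s powr - e * s\<^sub>1 powr - (2 * b) * s\<^sub>2 powr - (2 * b) \<le> R * S powr - e" 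
    "Y \<le> 6 * S" "0 \<le> R"
  shows "Kq t\<^sub>1 x\<^sub>1 t\<^sub>2 x\<^sub>2 \<le> 2 powr \<kappa> * 128 powr (2 * \<omega>) * 6 powr e * R * hP N L"
proof -
  have "S powr - e \<le> 6 powr e * Y powr - e" using S Y_pos exponents by (intro powr_neg_scale) auto
  then have "R * S powr - e \<le> R * (6 powr e * Y powr - e)" using S by (intro mult_left_mono) auto
  then have "s powr - e * s\<^sub>1 powr - (2 * b) * s\<^sub>2 powr - (2 * b) \<le> R * (6 powr e * Y powr - e)" using S by simp
  then have "Kq t\<^sub>1 x\<^sub>1 t\<^sub>2 x\<^sub>2 \<le> 2 powr \<kappa> * 128 powr (2 * \<omega>) * (N\<^sup>2 * L powr (2 * \<omega>) * jb L powr (2 * \<rho> - 2 * \<omega>)) *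
     (R * (6 powr e * Y powr - e))"
    by (intro order_trans[OF low_input_basic[OF P]] mult_left_mono) auto
  then show ?thesis unfolding hP_def by (simp only: mult_ac)
qed

lemma hmax_x2: "hmax x x\<^sub>2 = hmax x x\<^sub>1" "hmax x\<^sub>1 (- x\<^sub>2) = hmax x\<^sub>1 x"
  using hmax_swap[of x x\<^sub>1] hmax_swap[of x\<^sub>1 x] by simp_all

lemma hP_le': "hP N L \<le> 4 * 2 powr (2 * \<rho>) * N powr \<alpha>"
  by (rule order_trans[OF hP_le[OF L_pos L_le_N]]) (simp add: mult_right_mono)

text \<open>The low frequency enters as x2 when the output is frozen and as - x2 when the high input
  is frozen; z stands for either.\<close>

lemma hP_other:
  assumes "\<bar>x\<^sub>2\<bar> \<le> \<bar>x\<bar>" "\<bar>z\<bar> = \<bar>x\<^sub>2\<bar>" "\<bar>x\<^sub>2\<bar> \<le> \<bar>y\<bar>" "\<bar>x\<^sub>2\<bar> \<le> \<bar>y - z\<bar>" "N = max \<bar>y\<bar> \<bar>y - z\<bar>"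
  shows "hP N L \<le> 4 * (4 * 2 powr (2 * \<rho>)) * hmax y z"
proof (rule hmax_ge_other[OF _ _ _ assms(5) _ hP_le'])
  show "z \<noteq> 0" using assms(2) nz(2) by auto
  show "hP N L \<le> 4 * 2 powr (2 * \<rho>) * max 1 N powr ((\<alpha> - 1) / 2)" if "N \<le> 4 * \<bar>z\<bar>"
  proof (rule hP_le_comparable[OF L_pos L_le_N])
    show "N \<le> 4 * L" using that assms(2) L_eq(1)[OF assms(1)] by simp
  qed
qed (use assms(2-4) in auto)

lemma low_input_output_dominant:
  assumes P: "\<bar>x\<^sub>2\<bar> \<le> \<bar>x\<bar>" and dom: "s\<^sub>1 \<le> s" "s\<^sub>2 \<le> s"
  shows "Kq t\<^sub>1 x\<^sub>1 t\<^sub>2 x\<^sub>2 \<le> cP * majorant t\<^sub>1 x\<^sub>1 t\<^sub>2 x\<^sub>2"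
proof -
  let ?R = "s\<^sub>1 powr - (2 * b) * s\<^sub>2 powr - (2 * b)"
  have "Y \<le> 6 * s" using dom by (intro Y_le) auto
  then have "Kq t\<^sub>1 x\<^sub>1 t\<^sub>2 x\<^sub>2 \<le> 2 powr \<kappa> * 128 powr (2 * \<omega>) * 6 powr e * ?R * hP N L"
    by (intro low_input_hP[OF P, where S = s and R = ?R]) (auto simp: mult_ac)
  also have "\<dots> \<le> 2 powr \<kappa> * 128 powr (2 * \<omega>) * 6 powr e * ?R * (4 * (4 * 2 powr (2 * \<rho>)) * hmax x x\<^sub>2)"
    by (rule mult_left_mono[OF hP_other[OF P]]) (use P ord in \<open>auto simp: N_def\<close>)
  also have "\<dots> = cP * (?R * hmax x x\<^sub>1)" unfolding hmax_x2 cP_def by (simp only: mult_ac)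
  also have "\<dots> \<le> cP * majorant t\<^sub>1 x\<^sub>1 t\<^sub>2 x\<^sub>2" by (intro mult_left_mono majorant_ge) (simp add: cP_def)
  finally show ?thesis .
qed

lemma low_input_high_dominant:
  assumes P: "\<bar>x\<^sub>2\<bar> \<le> \<bar>x\<bar>" and dom: "s \<le> s\<^sub>1" "s\<^sub>2 \<le> s\<^sub>1"
  shows "Kq t\<^sub>1 x\<^sub>1 t\<^sub>2 x\<^sub>2 \<le> cP * majorant t\<^sub>1 x\<^sub>1 t\<^sub>2 x\<^sub>2"
proof -
  let ?R = "s powr - (2 * b) * s\<^sub>2 powr - (2 * b)"
  have "Y \<le> 6 * s\<^sub>1" using dom by (intro Y_le) auto
  \<comment> \<open>The output now has to be integrated, so its exponent is raised to 2 b at the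
    expense of the dominant modulation.\<close>
  moreover have "s powr - e * s\<^sub>1 powr - (2 * b) \<le> s powr - (2 * b) * s\<^sub>1 powr - e"
    using s_pos dom exponents by (intro powr_exchange_le) auto
  then have "s powr - e * s\<^sub>1 powr - (2 * b) * s\<^sub>2 powr - (2 * b) \<le> (s powr - (2 * b) * s\<^sub>1 powr - e) * s\<^sub>2 powr - (2 * b)"
    by (intro mult_right_mono) auto
  ultimately have "Kq t\<^sub>1 x\<^sub>1 t\<^sub>2 x\<^sub>2 \<le> 2 powr \<kappa> * 128 powr (2 * \<omega>) * 6 powr e * ?R * hP N L"
    by (intro low_input_hP[OF P, where S = s\<^sub>1 and R = ?R]) (auto simp: mult_ac)
  also have "\<dots> \<le> 2 powr \<kappa> * 128 powr (2 * \<omega>) * 6 powr e * ?R * (4 * (4 * 2 powr (2 * \<rho>)) * hmax x\<^sub>1 (- x\<^sub>2))"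
    by (rule mult_left_mono[OF hP_other[OF P]]) (use P ord in \<open>auto simp: N_def max.commute\<close>)
  also have "\<dots> = cP * (?R * hmax x\<^sub>1 x)" unfolding hmax_x2 cP_def by (simp only: mult_ac)
  also have "\<dots> \<le> cP * majorant t\<^sub>1 x\<^sub>1 t\<^sub>2 x\<^sub>2" by (intro mult_left_mono majorant_ge) (simp add: cP_def)
  finally show ?thesis .
qed

text \<open>The dominant modulation forces the low input to have size at least Y / 6, and the high
  input has size at least Y / 8 by its frequency; hence 112 = 8 (6 + 8).\<close>

lemma low_input_low_modulation:
  assumes P: "\<bar>x\<^sub>2\<bar> \<le> \<bar>x\<bar>" and dom: "s \<le> s\<^sub>2" "s\<^sub>1 \<le> s\<^sub>2"
  shows "Y \<le> 6 * s\<^sub>2" and "Kq t\<^sub>1 x\<^sub>1 t\<^sub>2 x\<^sub>2 \<le> 2 powr \<kappa> * 112 powr (2 * \<omega>) * (N\<^sup>2 * L powr (2 * \<omega>) * jb L powr \<kappa> * Y powr - (2 * \<omega>)) *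
    (s powr - e * s\<^sub>1 powr - (2 * b) * s\<^sub>2 powr - (2 * b))"
proof -
  show Y: "Y \<le> 6 * s\<^sub>2" using dom by (intro Y_le) auto
  have Y2: "Y \<le> 6 * v\<^sub>2" using Y V_ge_modulation[of t\<^sub>2 x\<^sub>2] by simp
  have Y1: "Y \<le> 8 * v\<^sub>1"
  proof -
    have "L * N powr \<alpha> \<le> N powr 1 * N powr \<alpha>" using L_le_N N_pos by (intro mult_right_mono) auto
    also have "\<dots> \<le> (2 * \<bar>x\<^sub>1\<bar>) powr (1 + \<alpha>)"
      unfolding powr_add[symmetric] using N_bounds N_pos alpha by (intro powr_mono2) auto
    also have "\<dots> \<le> 8 * \<bar>x\<^sub>1\<bar> powr (1 + \<alpha>)" unfolding powr_mult using two_powr_le by (intro mult_right_mono) auto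
    finally have "Y \<le> 8 * jb (\<bar>x\<^sub>1\<bar> powr (1 + \<alpha>))" using L_pos by (intro jb_scale) auto
    then show ?thesis using V_ge_frequency[of x\<^sub>1 t\<^sub>1] by simp
  qed
  have "v * Y \<le> 8 * (v\<^sub>1 * Y + v\<^sub>2 * Y)"
    using mult_right_mono[OF V_add[of t\<^sub>1 t\<^sub>2 x\<^sub>1 x\<^sub>2], of Y] Y_pos by (simp add: algebra_simps)
  also have "\<dots> \<le> 8 * (v\<^sub>1 * (6 * v\<^sub>2) + v\<^sub>2 * (8 * v\<^sub>1))"
    using V_pos[of t\<^sub>1 x\<^sub>1] V_pos[of t\<^sub>2 x\<^sub>2] Y1 Y2 by (intro mult_left_mono add_mono) auto
  finally have v: "v \<le> (112 / Y) * (v\<^sub>1 * v\<^sub>2)" using Y_pos by (simp add: field_simps)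
  have Q: "(112 / Y) powr (2 * \<omega>) = 112 powr (2 * \<omega>) * Y powr - (2 * \<omega>)"
    unfolding powr_divide by (simp only: powr_minus divide_inverse)
  show "Kq t\<^sub>1 x\<^sub>1 t\<^sub>2 x\<^sub>2 \<le> 2 powr \<kappa> * 112 powr (2 * \<omega>) * (N\<^sup>2 * L powr (2 * \<omega>) * jb L powr \<kappa> * Y powr - (2 * \<omega>)) *
    (s powr - e * s\<^sub>1 powr - (2 * b) * s\<^sub>2 powr - (2 * b))"
    using Kq_le_low_input[OF P v] unfolding Q by (simp only: mult_ac)
qed

text \<open>The low input is frozen. The weights contribute a further power - 2 \<omega> of the
  resonance, which is why \<open>hR\<close> has the exponent - e - 2 \<omega>.\<close>

lemma low_input_low_dominant_large:
  assumes P: "\<bar>x\<^sub>2\<bar> \<le> \<bar>x\<bar>" and dom: "s \<le> s\<^sub>2" "s\<^sub>1 \<le> s\<^sub>2" and L: "1 \<le> L"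
  shows "Kq t\<^sub>1 x\<^sub>1 t\<^sub>2 x\<^sub>2 \<le> cR * majorant t\<^sub>1 x\<^sub>1 t\<^sub>2 x\<^sub>2"
proof -
  let ?R = "s powr - (2 * b) * s\<^sub>1 powr - (2 * b)"
  have "s powr - e * s\<^sub>2 powr - (2 * b) \<le> s powr - (2 * b) * s\<^sub>2 powr - e"
    using s_pos dom exponents by (intro powr_exchange_le) auto
  also have "\<dots> \<le> s powr - (2 * b) * (6 powr e * Y powr - e)"
    using low_input_low_modulation(1)[OF assms(1-3)] Y_pos exponents by (intro mult_left_mono powr_neg_scale) auto
  finally have "s powr - e * s\<^sub>2 powr - (2 * b) * s\<^sub>1 powr - (2 * b) \<le> s powr - (2 * b) * (6 powr e * Y powr - e) * s\<^sub>1 powr - (2 * b)"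
    by (intro mult_right_mono) auto
  then have "s powr - e * s\<^sub>1 powr - (2 * b) * s\<^sub>2 powr - (2 * b) \<le> 6 powr e * Y powr - e * ?R"
    by (simp add: mult_ac)
  then have "Kq t\<^sub>1 x\<^sub>1 t\<^sub>2 x\<^sub>2 \<le> 2 powr \<kappa> * 112 powr (2 * \<omega>) * (N\<^sup>2 * L powr (2 * \<omega>) * jb L powr \<kappa> * Y powr - (2 * \<omega>)) * (6 powr e * Y powr - e * ?R)"
    by (intro order_trans[OF low_input_low_modulation(2)[OF assms(1-3)]] mult_left_mono) auto
  also have "\<dots> = 2 powr \<kappa> * 112 powr (2 * \<omega>) * 6 powr e * ?R * hR N L"
  proof -
    have "Y powr (- e - 2 * \<omega>) = Y powr - (2 * \<omega>) * Y powr - e" by (simp add: powr_add[symmetric])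
    then show ?thesis unfolding hR_def by (simp only: mult_ac)
  qed
  also have "\<dots> \<le> 2 powr \<kappa> * 112 powr (2 * \<omega>) * 6 powr e * ?R * (2 powr \<kappa> * hmax x\<^sub>2 x)"
  proof (intro mult_left_mono order_trans[OF hR_le[OF L L_le_N]])
    have "max \<bar>x\<bar> \<bar>x\<^sub>2 - x\<bar> powr (\<alpha> - 1) * \<bar>x\<^sub>2\<bar> \<le> hmax x\<^sub>2 x" using P ord by (intro hmax_ge_smallest) auto
    then show "N powr (\<alpha> - 1) * L \<le> hmax x\<^sub>2 x" using L_eq(1)[OF P] by (simp add: N_def)
  qed auto
  also have "\<dots> = cR * (?R * hmax x\<^sub>2 x)" unfolding cR_def by (simp only: mult_ac)
  also have "\<dots> \<le> cR * majorant t\<^sub>1 x\<^sub>1 t\<^sub>2 x\<^sub>2" by (intro mult_left_mono majorant_ge) (simp add: cR_def)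
  finally show ?thesis .
qed

text \<open>The output is frozen although the low input dominates, and the output decay is simply
  bounded by 1. The full exponent 2 b of the low modulation becomes decay in the resonance, which is
  integrable in the low frequency at scale N^(- \<alpha>).\<close>

lemma low_input_low_dominant_small:
  assumes P: "\<bar>x\<^sub>2\<bar> \<le> \<bar>x\<bar>" and dom: "s \<le> s\<^sub>2" "s\<^sub>1 \<le> s\<^sub>2" and L: "L \<le> 1"
  shows "Kq t\<^sub>1 x\<^sub>1 t\<^sub>2 x\<^sub>2 \<le> cT * majorant t\<^sub>1 x\<^sub>1 t\<^sub>2 x\<^sub>2"
proof -
  have b0: "0 \<le> 2 * b" using eps by (simp add: b_def)
  have se: "s powr - e \<le> 1" using exponents by (intro jb_powr_neg_le_1) auto
  have s2: "s\<^sub>2 powr - (2 * b) \<le> 6 powr (2 * b) * Y powr - (2 * b)"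
    using low_input_low_modulation(1)[OF assms(1-3)] Y_pos b0 by (intro powr_neg_scale) auto
  have J: "jb L powr \<kappa> \<le> 2 powr \<kappa>" using L L_pos kappa_nonneg by (intro jb_powr_small) auto
  have Yw: "Y powr - (2 * \<omega>) \<le> L powr - (2 * \<omega>) * N powr - (\<alpha> * (2 * \<omega>))"
    using L_pos N_pos exponents by (intro resonance_size) auto
  have "N\<^sup>2 * L powr (2 * \<omega>) * jb L powr \<kappa> * Y powr - (2 * \<omega>) \<le> 
    N\<^sup>2 * L powr (2 * \<omega>) * 2 powr \<kappa> * (L powr - (2 * \<omega>) * N powr - (\<alpha> * (2 * \<omega>)))"
    by (intro mult_mono J Yw order_refl) auto
  also have "\<dots> = 2 powr \<kappa> * (N powr 2 * N powr - (\<alpha> * (2 * \<omega>)))"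
    using L_pos N_pos by (simp add: powr_minus divide_simps)
  also have "N powr 2 * N powr - (\<alpha> * (2 * \<omega>)) = N powr \<alpha>"
  proof -
    have "2 + - (\<alpha> * (2 * \<omega>)) = \<alpha>" using omega_bounds(2) by (simp add: mult.left_commute)
    then show ?thesis by (metis powr_add)
  qed
  also have "N powr \<alpha> \<le> (2 * \<bar>x\<bar>) powr \<alpha>"
    using P abs_triangle_ineq4[of x x\<^sub>2] alpha N_pos by (intro powr_mono2) (auto simp: N_def)
  also have "\<dots> \<le> 4 * \<bar>x\<bar> powr \<alpha>"
    unfolding powr_mult using powr_mono[of \<alpha> 2 "2::real"] alpha by (intro mult_right_mono) auto
  finally have A: "N\<^sup>2 * L powr (2 * \<omega>) * jb L powr \<kappa> * Y powr - (2 * \<omega>) \<le> 2 powr \<kappa> * (4 * \<bar>x\<bar> powr \<alpha>)"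
    by (simp add: mult_left_mono)
  have B: "Y powr - (2 * b) \<le> jb (\<bar>x\<^sub>2\<bar> * \<bar>x\<bar> powr \<alpha>) powr - (2 * b)"
  proof (intro powr_mono2' jb_mono)
    have "\<bar>x\<^sub>2\<bar> * \<bar>x\<bar> powr \<alpha> \<le> L * N powr \<alpha>"
      using L_eq(1)[OF P] alpha N_ge by (intro mult_mono powr_mono2) auto
    then show "\<bar>\<bar>x\<^sub>2\<bar> * \<bar>x\<bar> powr \<alpha>\<bar> \<le> \<bar>L * N powr \<alpha>\<bar>" by simp
  qed (use b0 jb_pos in auto)
  have C: "s powr - e * s\<^sub>1 powr - (2 * b) * s\<^sub>2 powr - (2 * b) \<le> 1 * s\<^sub>1 powr - (2 * b) * (6 powr (2 * b) * jb (\<bar>x\<^sub>2\<bar> * \<bar>x\<bar> powr \<alpha>) powr - (2 * b))"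
    by (intro mult_mono se order_refl order_trans[OF s2] mult_left_mono B) auto
  have "Kq t\<^sub>1 x\<^sub>1 t\<^sub>2 x\<^sub>2 \<le> 2 powr \<kappa> * 112 powr (2 * \<omega>) * (2 powr \<kappa> * (4 * \<bar>x\<bar> powr \<alpha>)) * (1 * s\<^sub>1 powr - (2 * b) * (6 powr (2 * b) * jb (\<bar>x\<^sub>2\<bar> * \<bar>x\<bar> powr \<alpha>) powr - (2 * b)))"
    by (intro order_trans[OF low_input_low_modulation(2)[OF assms(1-3)]] mult_mono order_refl A C) auto
  also have "\<dots> = cT * (s\<^sub>1 powr - (2 * b) * tail x x\<^sub>2)" unfolding cT_def tail_def by (simp only: mult_ac mult_1_left)
  also have "\<dots> \<le> cT * majorant t\<^sub>1 x\<^sub>1 t\<^sub>2 x\<^sub>2" by (intro mult_left_mono majorant_ge) (simp add: cT_def)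
  finally show ?thesis .
qed

section \<open>Interactions whose smallest frequency is the output\<close>

lemma low_output_modulation:
  assumes Q: "\<bar>x\<bar> \<le> \<bar>x\<^sub>2\<bar>" and S: "s \<le> S" "Y \<le> 6 * S"
  shows "v powr (2 * \<omega>) * s powr - e * S powr - (2 * b) \<le> 36 * (s powr - (2 * b) * Y powr (2 * \<omega> - e))"
proof -
  have "\<bar>x\<bar> powr (1 + \<alpha>) \<le> L * N powr \<alpha>"
    using L_eq(2)[OF Q] alpha N_ge by (auto simp: powr_add intro!: mult_left_mono powr_mono2)
  then have "jb (\<bar>x\<bar> powr (1 + \<alpha>)) \<le> Y" by (intro jb_mono) auto
  \<comment> \<open>The output size is in the numerator. Its frequency part lies below the
    resonance, so only the output modulation and Y can make it large; each alternative is then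
    settled by exchanging exponents with the dominant modulation.\<close>
  then have "v \<le> s + 2 * Y" using V_le[of t x] by simp
  then have "v \<le> 3 * max s Y" by (auto simp: max_def)
  then have "v powr (2 * \<omega>) \<le> (3 * max s Y) powr (2 * \<omega>)" using exponents V_pos[of t x] by (intro powr_mono2) auto
  also have "\<dots> \<le> 3 * max s Y powr (2 * \<omega>)"
    unfolding powr_mult using exponents powr_mono[of "2 * \<omega>" 1 "3::real"] by (intro mult_right_mono) auto
  also have "\<dots> \<le> 3 * (s powr (2 * \<omega>) + Y powr (2 * \<omega>))" by (auto simp: max_def)
  finally have v: "v powr (2 * \<omega>) \<le> 3 * (s powr (2 * \<omega>) + Y powr (2 * \<omega>))" .
  have "v powr (2 * \<omega>) * s powr - e * S powr - (2 * b) \<le> 3 * (s powr (2 * \<omega>) + Y powr (2 * \<omega>)) * s powr - e * S powr - (2 * b)"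
    by (intro mult_right_mono v) auto
  also have "\<dots> = 3 * (s powr (2 * \<omega> - e) * S powr - (2 * b) + Y powr (2 * \<omega>) * (s powr - e * S powr - (2 * b)))"
    using powr_add[of s "2 * \<omega>" "- e"] by (simp add: algebra_simps)
  also have "\<dots> \<le> 3 * (s powr - (2 * b) * S powr (2 * \<omega> - e) + Y powr (2 * \<omega>) * (s powr - (2 * b) * S powr - e))"
    using s_pos S exponents by (intro mult_left_mono add_mono powr_exchange_le) auto
  also have "\<dots> \<le> 3 * (s powr - (2 * b) * (6 * Y powr (2 * \<omega> - e)) + Y powr (2 * \<omega>) * (s powr - (2 * b) * (6 * Y powr - e)))"
  proof -
    have "S powr - q \<le> 6 * Y powr - q" if "0 \<le> q" "q \<le> 1" for q
    proof -
      have "S powr - q \<le> 6 powr q * Y powr - q" using S Y_pos that by (intro powr_neg_scale) auto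
      also have "\<dots> \<le> 6 * Y powr - q" using that powr_mono[of q 1 "6::real"] by (intro mult_right_mono) auto
      finally show ?thesis .
    qed
    from this[of "e - 2 * \<omega>"] this[of e] show ?thesis using exponents
      by (intro mult_left_mono add_mono) auto
  qed
  also have "\<dots> = 36 * (s powr - (2 * b) * Y powr (2 * \<omega> - e))"
    using powr_add[of Y "2 * \<omega>" "- e"] by (simp add: algebra_simps)
  finally show ?thesis .
qed

text \<open>At each input the exponents 2 \<omega> + \<kappa> - 2 (1 + \<alpha>) \<omega> collapse
  to 2 \<rho>, which produces the two factors of the bracket of N.\<close>

lemma low_output_basic:
  assumes Q: "\<bar>x\<bar> \<le> \<bar>x\<^sub>2\<bar>"
  shows "Kq t\<^sub>1 x\<^sub>1 t\<^sub>2 x\<^sub>2 \<le> 8 powr (2 * \<omega>) * 8 powr (2 * \<omega>) * (L powr (2 - 2 * \<omega>) * jb L powr - \<kappa> * jb N powr (4 * \<rho>)) *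
    (v powr (2 * \<omega>) * s powr - e * s\<^sub>1 powr - (2 * b) * s\<^sub>2 powr - (2 * b))"
proof -
  have L: "\<bar>x\<bar> = L" "jb x = jb L" using L_eq(2)[OF Q] by (auto simp: jb_def)
  have N: "N = \<bar>x\<^sub>1\<bar>" by (rule N_eq[OF Q])
  have *: "\<bar>y\<bar> powr (2 * \<omega>) * jb y powr \<kappa> * V a y powr - (2 * \<omega>) \<le> 8 powr (2 * \<omega>) * jb N powr (2 * \<rho>)"
    if "\<bar>y\<bar> \<le> N" for a y
  proof -
    have 1: "\<bar>y\<bar> powr (2 * \<omega>) \<le> jb y powr (2 * \<omega>)" using exponents jb_ge_abs[of y] by (intro powr_mono2) auto
    have "V a y powr - (2 * \<omega>) \<le> (jb y powr (1 + \<alpha>) / 8) powr - (2 * \<omega>)"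
      using V_ge_jb_powr[of y a] jb_pos[of y] exponents by (intro powr_mono2') auto
    also have "\<dots> = 8 powr (2 * \<omega>) * jb y powr - ((1 + \<alpha>) * (2 * \<omega>))"
      unfolding powr_divide powr_powr mult_minus_right by (simp only: powr_minus divide_inverse inverse_inverse_eq mult.commute)
    finally have 2: "V a y powr - (2 * \<omega>) \<le> 8 powr (2 * \<omega>) * jb y powr - ((1 + \<alpha>) * (2 * \<omega>))" .
    have "\<bar>y\<bar> powr (2 * \<omega>) * jb y powr \<kappa> * V a y powr - (2 * \<omega>) \<le> 
      jb y powr (2 * \<omega>) * jb y powr \<kappa> * (8 powr (2 * \<omega>) * jb y powr - ((1 + \<alpha>) * (2 * \<omega>)))"
      by (intro mult_mono 1 2 order_refl) auto
    also have "\<dots> = 8 powr (2 * \<omega>) * (jb y powr (2 * \<omega>) * jb y powr \<kappa> * jb y powr - ((1 + \<alpha>) * (2 * \<omega>)))"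
      by (simp only: mult_ac)
    also have "jb y powr (2 * \<omega>) * jb y powr \<kappa> * jb y powr - ((1 + \<alpha>) * (2 * \<omega>)) = jb y powr (2 * \<rho>)"
      unfolding powr_add[symmetric] by (simp add: algebra_simps)
    also have "\<dots> \<le> jb N powr (2 * \<rho>)" using that rho jb_pos[of y] by (intro powr_mono2 jb_mono) auto
    finally show ?thesis by (simp add: mult_left_mono)
  qed
  have NN: "jb N powr (2 * \<rho>) * jb N powr (2 * \<rho>) = jb N powr (4 * \<rho>)" by (simp add: powr_add[symmetric])
  have "Kq t\<^sub>1 x\<^sub>1 t\<^sub>2 x\<^sub>2 = (L powr (2 - 2 * \<omega>) * jb L powr - \<kappa>) * 
     (\<bar>x\<^sub>1\<bar> powr (2 * \<omega>) * jb x\<^sub>1 powr \<kappa> * v\<^sub>1 powr - (2 * \<omega>)) *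
     (\<bar>x\<^sub>2\<bar> powr (2 * \<omega>) * jb x\<^sub>2 powr \<kappa> * v\<^sub>2 powr - (2 * \<omega>)) *
     (v powr (2 * \<omega>) * s powr - e * s\<^sub>1 powr - (2 * b) * s\<^sub>2 powr - (2 * b))"
    unfolding Kq_expand L by (simp only: mult_ac)
  also have "\<dots> \<le> (L powr (2 - 2 * \<omega>) * jb L powr - \<kappa>) * (8 powr (2 * \<omega>) * jb N powr (2 * \<rho>)) * (8 powr (2 * \<omega>) * jb N powr (2 * \<rho>)) *
     (v powr (2 * \<omega>) * s powr - e * s\<^sub>1 powr - (2 * b) * s\<^sub>2 powr - (2 * b))"
    using ord N by (intro mult_mono order_refl *) auto
  also have "\<dots> = 8 powr (2 * \<omega>) * 8 powr (2 * \<omega>) * (L powr (2 - 2 * \<omega>) * jb L powr - \<kappa> * (jb N powr (2 * \<rho>) * jb N powr (2 * \<rho>))) *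
    (v powr (2 * \<omega>) * s powr - e * s\<^sub>1 powr - (2 * b) * s\<^sub>2 powr - (2 * b))" by (simp only: mult_ac)
  finally show ?thesis unfolding NN .
qed

text \<open>R is the decay of the two points that are not frozen, and \<open>H\<close> the matching
  value of \<open>hmax\<close>; only these depend on which modulation dominates.\<close>

lemma low_output_hQ:
  assumes Q: "\<bar>x\<bar> \<le> \<bar>x\<^sub>2\<bar>" 
    and R: "v powr (2 * \<omega>) * s powr - e * s\<^sub>1 powr - (2 * b) * s\<^sub>2 powr - (2 * b) \<le> 36 * (R * Y powr (2 * \<omega> - e))" "0 \<le> R"
    and h: "hQ N L \<le> 16 * 4 powr \<kappa> * 2 powr (4 * \<rho>) * H" and M: "R * H \<le> majorant t\<^sub>1 x\<^sub>1 t\<^sub>2 x\<^sub>2"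
  shows "Kq t\<^sub>1 x\<^sub>1 t\<^sub>2 x\<^sub>2 \<le> cQ * majorant t\<^sub>1 x\<^sub>1 t\<^sub>2 x\<^sub>2"
proof -
  have "Kq t\<^sub>1 x\<^sub>1 t\<^sub>2 x\<^sub>2 \<le> 8 powr (2 * \<omega>) * 8 powr (2 * \<omega>) * (L powr (2 - 2 * \<omega>) * jb L powr - \<kappa> * jb N powr (4 * \<rho>)) * (36 * (R * Y powr (2 * \<omega> - e)))"
    by (intro order_trans[OF low_output_basic[OF Q]] mult_left_mono R) auto
  also have "\<dots> = 8 powr (2 * \<omega>) * 8 powr (2 * \<omega>) * 36 * R * hQ N L"
    unfolding hQ_def by (simp only: mult_ac)
  also have "\<dots> \<le> 8 powr (2 * \<omega>) * 8 powr (2 * \<omega>) * 36 * R * (16 * 4 powr \<kappa> * 2 powr (4 * \<rho>) * H)"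
    using R by (intro mult_left_mono h) auto
  also have "\<dots> = cQ * (R * H)" unfolding cQ_def by (simp only: mult_ac)
  also have "\<dots> \<le> cQ * majorant t\<^sub>1 x\<^sub>1 t\<^sub>2 x\<^sub>2" by (intro mult_left_mono M) (simp add: cQ_def)
  finally show ?thesis .
qed

lemma hQ_other:
  assumes "\<bar>x\<bar> \<le> \<bar>y\<bar>" "\<bar>x\<bar> \<le> \<bar>y - x\<bar>" "N = max \<bar>y\<bar> \<bar>y - x\<bar>" "L = \<bar>x\<bar>"
  shows "hQ N L \<le> 16 * 4 powr \<kappa> * 2 powr (4 * \<rho>) * hmax y x"
proof -
  have "hQ N L \<le> 2 powr (4 * \<rho>) * (N powr (\<alpha> - 1) * N powr 1)"
    using L_le_N N_pos by (intro order_trans[OF hQ_le[OF L_pos L_le_N]] mult_left_mono) auto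
  also have "N powr (\<alpha> - 1) * N powr 1 = N powr \<alpha>" unfolding powr_add[symmetric] by simp
  also have "2 powr (4 * \<rho>) * N powr \<alpha> \<le> (4 * 4 powr \<kappa>) * (2 powr (4 * \<rho>) * N powr \<alpha>)"
    using kappa_nonneg ge_one_powr_ge_zero[of 4 \<kappa>] by (intro le_mult_ge_1) auto
  finally have 1: "hQ N L \<le> 4 * 4 powr \<kappa> * 2 powr (4 * \<rho>) * N powr \<alpha>" by (simp only: mult.assoc)
  have "hQ N L \<le> 4 * (4 * 4 powr \<kappa> * 2 powr (4 * \<rho>)) * hmax y x"
  proof (rule hmax_ge_other[OF assms(1,2) nz(3) assms(3) _ 1])
    show "hQ N L \<le> 4 * 4 powr \<kappa> * 2 powr (4 * \<rho>) * max 1 N powr ((\<alpha> - 1) / 2)" if "N \<le> 4 * \<bar>x\<bar>"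
      by (rule hQ_le_comparable[OF L_pos L_le_N]) (use that assms(4) in \<open>simp only:\<close>)
  qed simp
  then show ?thesis by simp
qed

lemma low_output:
  assumes Q: "\<bar>x\<bar> \<le> \<bar>x\<^sub>2\<bar>"
  shows "Kq t\<^sub>1 x\<^sub>1 t\<^sub>2 x\<^sub>2 \<le> cQ * majorant t\<^sub>1 x\<^sub>1 t\<^sub>2 x\<^sub>2"
proof -
  have L: "L = \<bar>x\<bar>" and N: "N = \<bar>x\<^sub>1\<bar>" using L_eq(2)[OF Q] N_eq[OF Q] by auto
  consider "s\<^sub>1 \<le> s" "s\<^sub>2 \<le> s" | "s \<le> s\<^sub>1" "s\<^sub>2 \<le> s\<^sub>1" | "s \<le> s\<^sub>2" "s\<^sub>1 \<le> s\<^sub>2" by linarith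
  then show ?thesis
  proof cases
    case 1
    then have Y: "Y \<le> 6 * s" by (intro Y_le) auto
    \<comment> \<open>With S = s the general modulation bound carries the same factor on both sides.
      Dividing by it leaves the bound for the output alone.\<close>
    have "s powr - (2 * b) * (v powr (2 * \<omega>) * s powr - e) \<le> s powr - (2 * b) * (36 * Y powr (2 * \<omega> - e))"
      using low_output_modulation[OF Q order_refl Y] by (simp add: mult_ac)
    then have vs: "v powr (2 * \<omega>) * s powr - e \<le> 36 * Y powr (2 * \<omega> - e)" using s_pos by simp
    show ?thesis
    proof (rule low_output_hQ[OF Q])
      show "v powr (2 * \<omega>) * s powr - e * s\<^sub>1 powr - (2 * b) * s\<^sub>2 powr - (2 * b) \<le> 36 * ((s\<^sub>1 powr - (2 * b) * s\<^sub>2 powr - (2 * b)) * Y powr (2 * \<omega> - e))"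
        using mult_right_mono[OF vs, of "s\<^sub>1 powr - (2 * b) * s\<^sub>2 powr - (2 * b)"] by (simp add: mult_ac)
      have "max \<bar>x\<^sub>1\<bar> \<bar>x - x\<^sub>1\<bar> powr (\<alpha> - 1) * \<bar>x\<bar> \<le> hmax x x\<^sub>1" using Q ord by (intro hmax_ge_smallest) auto
      then have h: "N powr (\<alpha> - 1) * L \<le> hmax x x\<^sub>1" using L N ord by (simp add: max_absorb1)
      have "hQ N L \<le> 2 powr (4 * \<rho>) * hmax x x\<^sub>1"
        by (intro order_trans[OF hQ_le[OF L_pos L_le_N]] mult_left_mono h) auto
      also have "\<dots> \<le> (16 * 4 powr \<kappa>) * (2 powr (4 * \<rho>) * hmax x x\<^sub>1)"
        using kappa_nonneg ge_one_powr_ge_zero[of 4 \<kappa>] hmax_nonneg[of x x\<^sub>1] by (intro le_mult_ge_1) auto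
      finally show "hQ N L \<le> 16 * 4 powr \<kappa> * 2 powr (4 * \<rho>) * hmax x x\<^sub>1" by (simp only: mult.assoc)
    qed (auto intro: majorant_ge)
  next
    case 2
    then have "Y \<le> 6 * s\<^sub>1" by (intro Y_le) auto
    note m = low_output_modulation[OF Q 2(1) this]
    show ?thesis
    proof (rule low_output_hQ[OF Q])
      show "v powr (2 * \<omega>) * s powr - e * s\<^sub>1 powr - (2 * b) * s\<^sub>2 powr - (2 * b) \<le> 36 * ((s powr - (2 * b) * s\<^sub>2 powr - (2 * b)) * Y powr (2 * \<omega> - e))"
        using mult_right_mono[OF m, of "s\<^sub>2 powr - (2 * b)"] by (simp add: mult_ac)
      show "hQ N L \<le> 16 * 4 powr \<kappa> * 2 powr (4 * \<rho>) * hmax x\<^sub>1 x"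
        using Q ord L N by (intro hQ_other) auto
    qed (auto intro: majorant_ge)
  next
    case 3
    then have "Y \<le> 6 * s\<^sub>2" by (intro Y_le) auto
    note m = low_output_modulation[OF Q 3(1) this]
    show ?thesis
    proof (rule low_output_hQ[OF Q])
      show "v powr (2 * \<omega>) * s powr - e * s\<^sub>1 powr - (2 * b) * s\<^sub>2 powr - (2 * b) \<le> 36 * ((s powr - (2 * b) * s\<^sub>1 powr - (2 * b)) * Y powr (2 * \<omega> - e))"
        using mult_right_mono[OF m, of "s\<^sub>1 powr - (2 * b)"] by (simp add: mult_ac)
      show "hQ N L \<le> 16 * 4 powr \<kappa> * 2 powr (4 * \<rho>) * hmax x\<^sub>2 x"
        using Q ord L N by (intro hQ_other) auto
    qed (auto intro: majorant_ge)
  qed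
qed

lemma Kq_le_ordered: "Kq t\<^sub>1 x\<^sub>1 t\<^sub>2 x\<^sub>2 \<le> (cP + cR + cT + cQ) * majorant t\<^sub>1 x\<^sub>1 t\<^sub>2 x\<^sub>2"
proof -
  have c: "0 \<le> cP" "0 \<le> cR" "0 \<le> cT" "0 \<le> cQ" by (simp_all add: cP_def cR_def cT_def cQ_def)
  have m: "0 \<le> majorant t\<^sub>1 x\<^sub>1 t\<^sub>2 x\<^sub>2"
    using order_trans[OF _ majorant_ge(4)] tail_nonneg by simp
  have *: "Kq t\<^sub>1 x\<^sub>1 t\<^sub>2 x\<^sub>2 \<le> (cP + cR + cT + cQ) * majorant t\<^sub>1 x\<^sub>1 t\<^sub>2 x\<^sub>2"
    if "Kq t\<^sub>1 x\<^sub>1 t\<^sub>2 x\<^sub>2 \<le> c * majorant t\<^sub>1 x\<^sub>1 t\<^sub>2 x\<^sub>2" "c \<le> cP + cR + cT + cQ" for c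
    using that m by (intro order_trans[OF that(1)] mult_right_mono) auto
  show ?thesis
  proof (cases "\<bar>x\<bar> \<le> \<bar>x\<^sub>2\<bar>")
    case True
    show ?thesis using low_output[OF True] by (rule *) (use c in linarith)
  next
    case False
    then have P: "\<bar>x\<^sub>2\<bar> \<le> \<bar>x\<bar>" by simp
    consider "s\<^sub>1 \<le> s" "s\<^sub>2 \<le> s" | "s \<le> s\<^sub>1" "s\<^sub>2 \<le> s\<^sub>1" | "s \<le> s\<^sub>2" "s\<^sub>1 \<le> s\<^sub>2" "1 \<le> L" | "s \<le> s\<^sub>2" "s\<^sub>1 \<le> s\<^sub>2" "L \<le> 1" by linarith
    then show ?thesis
    proof cases
      case 1 show ?thesis using low_input_output_dominant[OF P 1] by (rule *) (use c in linarith)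
    next
      case 2 show ?thesis using low_input_high_dominant[OF P 2] by (rule *) (use c in linarith)
    next
      case 3 show ?thesis using low_input_low_dominant_large[OF P 3] by (rule *) (use c in linarith)
    next
      case 4 show ?thesis using low_input_low_dominant_small[OF P 4] by (rule *) (use c in linarith)
    qed
  qed
qed

end

context dispersion_params
begin

lemma Kq_le_majorant:
  assumes "x\<^sub>1 \<noteq> 0" "x\<^sub>2 \<noteq> 0" "x\<^sub>1 + x\<^sub>2 \<noteq> 0"
  shows "Kq t\<^sub>1 x\<^sub>1 t\<^sub>2 x\<^sub>2 \<le> (cP + cR + cT + cQ) * majorant t\<^sub>1 x\<^sub>1 t\<^sub>2 x\<^sub>2"
proof (cases "\<bar>x\<^sub>2\<bar> \<le> \<bar>x\<^sub>1\<bar>")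
  case True
  interpret interaction \<alpha> \<omega> \<rho> \<epsilon> b b' t\<^sub>1 x\<^sub>1 t\<^sub>2 x\<^sub>2 using assms True by unfold_locales auto
  show ?thesis by (rule Kq_le_ordered)
next
  case False
  interpret interaction \<alpha> \<omega> \<rho> \<epsilon> b b' t\<^sub>2 x\<^sub>2 t\<^sub>1 x\<^sub>1 using assms False by unfold_locales (auto simp: add.commute)
  show ?thesis using Kq_le_ordered by (simp only: Kq_commute[of t\<^sub>1] majorant_commute[of t\<^sub>1])
qed

end

section \<open>Integration along the phase\<close>

lemma nn_integral_lborel_reflect:
  fixes f :: "real \<Rightarrow> ennreal"
  assumes "f \<in> borel_measurable borel"
  shows "(\<integral>\<^sup>+v. f (c - v) \<partial>lborel) = (\<integral>\<^sup>+v. f v \<partial>lborel)"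
  using nn_integral_real_affine[OF assms, of "-1" c] by simp

lemma nn_integral_lborel_shift:
  fixes f :: "real \<Rightarrow> ennreal"
  assumes "f \<in> borel_measurable borel"
  shows "(\<integral>\<^sup>+v. f (v - c) \<partial>lborel) = (\<integral>\<^sup>+v. f v \<partial>lborel)"
  using nn_integral_real_affine[OF assms, of 1 "- c"] by simp

text \<open>Substitution on \<open>{a..a + real n}\<close> followed by monotone convergence. Only an
  inequality results, since g need not reach all values.\<close>

lemma nn_integral_substitution_atLeast:
  fixes f g g' :: "real \<Rightarrow> real"
  assumes f[measurable]: "f \<in> borel_measurable borel" and f0: "\<And>v. 0 \<le> f v"
    and g: "\<And>y. (g has_real_derivative g' y) (at y)"
    and g': "continuous_on UNIV g'" and nn: "\<And>y. a \<le> y \<Longrightarrow> 0 \<le> g' y"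
  shows "(\<integral>\<^sup>+y. ennreal (f (g y) * g' y) * indicator {a..} y \<partial>lborel) \<le> (\<integral>\<^sup>+v. ennreal (f v) \<partial>lborel)"
proof -
  have "continuous_on UNIV g"
    using DERIV_isCont[OF g] by (intro continuous_at_imp_continuous_on) auto
  then have [measurable]: "g \<in> borel_measurable borel" "g' \<in> borel_measurable borel"
    using g' by (simp_all only: borel_measurable_continuous_onI)
  let ?h = "\<lambda>(n::nat) y. ennreal (f (g y) * g' y) * indicator {a..a + real n} y"
  have le: "(\<integral>\<^sup>+y. ?h n y \<partial>lborel) \<le> (\<integral>\<^sup>+v. ennreal (f v) \<partial>lborel)" for n
  proof -
    have "(\<integral>\<^sup>+y. ?h n y \<partial>lborel) = (\<integral>\<^sup>+y. ennreal (f (g y) * g' y * indicator {a..a + real n} y) \<partial>lborel)"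
      by (intro nn_integral_cong) (auto simp: indicator_def)
    also have "\<dots> = (\<integral>\<^sup>+v. ennreal (f v * indicator {g a..g (a + real n)} v) \<partial>lborel)"
      by (rule nn_integral_substitution[symmetric])
        (use g nn in \<open>auto intro: continuous_on_subset[OF g'] simp: set_borel_measurable_def\<close>)
    also have "\<dots> \<le> (\<integral>\<^sup>+v. ennreal (f v) \<partial>lborel)"
      using f0 by (intro nn_integral_mono) (auto simp: indicator_def)
    finally show ?thesis .
  qed
  have sup: "(SUP n. ?h n y) = ennreal (f (g y) * g' y) * indicator {a..} y" for y
  proof (cases "a \<le> y")
    case True
    obtain n where "y - a \<le> real n" using real_arch_simple by blast
    then have n: "?h n y = ennreal (f (g y) * g' y)" using True by simp
    show ?thesis
    proof (rule antisym)
      show "(SUP n. ?h n y) \<le> ennreal (f (g y) * g' y) * indicator {a..} y"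
        by (intro SUP_least) (auto simp: indicator_def)
      show "ennreal (f (g y) * g' y) * indicator {a..} y \<le> (SUP n. ?h n y)"
        using True n by (intro SUP_upper2[of n]) auto
    qed
  qed auto
  have "(\<integral>\<^sup>+y. ennreal (f (g y) * g' y) * indicator {a..} y \<partial>lborel) = (\<integral>\<^sup>+y. (SUP n. ?h n y) \<partial>lborel)"
    by (simp only: sup)
  also have "\<dots> = (SUP n. \<integral>\<^sup>+y. ?h n y \<partial>lborel)"
    by (intro nn_integral_monotone_convergence_SUP)
      (auto simp: incseq_def le_fun_def intro!: mult_left_mono split: split_indicator)
  also have "\<dots> \<le> (\<integral>\<^sup>+v. ennreal (f v) \<partial>lborel)" by (intro SUP_least le)
  finally show ?thesis .
qed

text \<open>The two monotone branches of g cover the same values at most twice, whence the factor 2.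
  The left branch is reduced to the right one by reflection.\<close>

lemma nn_integral_substitution_valley:
  fixes f g g' :: "real \<Rightarrow> real"
  assumes f[measurable]: "f \<in> borel_measurable borel" and f0: "\<And>v. 0 \<le> f v"
    and g: "\<And>y. (g has_real_derivative g' y) (at y)"
    and g': "continuous_on UNIV g'"
    and pos: "\<And>y. a \<le> y \<Longrightarrow> 0 \<le> g' y" and neg: "\<And>y. y \<le> a \<Longrightarrow> g' y \<le> 0"
  shows "(\<integral>\<^sup>+y. ennreal (f (g y) * \<bar>g' y\<bar>) \<partial>lborel) \<le> 2 * (\<integral>\<^sup>+v. ennreal (f v) \<partial>lborel)"
proof -
  have "continuous_on UNIV g"
    using DERIV_isCont[OF g] by (intro continuous_at_imp_continuous_on) auto
  then have [measurable]: "g \<in> borel_measurable borel" "g' \<in> borel_measurable borel"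
    using g' by (simp_all only: borel_measurable_continuous_onI)
  let ?I = "\<integral>\<^sup>+v. ennreal (f v) \<partial>lborel"
  have A: "(\<integral>\<^sup>+y. ennreal (f (g y) * g' y) * indicator {a..} y \<partial>lborel) \<le> ?I"
    by (rule nn_integral_substitution_atLeast) (use assms in auto)
  have "(\<integral>\<^sup>+y. ennreal (f (g (- y)) * - g' (- y)) * indicator {- a..} y \<partial>lborel) \<le> ?I"
  proof (rule nn_integral_substitution_atLeast)
    show "((\<lambda>y. g (- y)) has_real_derivative - g' (- y)) (at y)" for y
    proof -
      have "(uminus has_real_derivative - 1) (at y)" by (auto intro!: derivative_eq_intros)
      from DERIV_chain2[OF g this] show ?thesis by simp
    qed
    show "continuous_on UNIV (\<lambda>y. - g' (- y))"
      by (intro continuous_intros continuous_on_compose2[OF g']) auto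
  qed (use f0 neg in auto)
  also have "(\<integral>\<^sup>+y. ennreal (f (g (- y)) * - g' (- y)) * indicator {- a..} y \<partial>lborel)
    = (\<integral>\<^sup>+y. ennreal (f (g y) * - g' y) * indicator {..a} y \<partial>lborel)"
    by (subst nn_integral_lborel_reflect[of _ 0, symmetric]) (auto intro!: nn_integral_cong split: split_indicator)
  finally have B: "(\<integral>\<^sup>+y. ennreal (f (g y) * - g' y) * indicator {..a} y \<partial>lborel) \<le> ?I" .
  have "(\<integral>\<^sup>+y. ennreal (f (g y) * \<bar>g' y\<bar>) \<partial>lborel) \<le> 
    (\<integral>\<^sup>+y. ennreal (f (g y) * g' y) * indicator {a..} y + ennreal (f (g y) * - g' y) * indicator {..a} y \<partial>lborel)"
  proof (intro nn_integral_mono)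
    fix y
    show "ennreal (f (g y) * \<bar>g' y\<bar>) \<le> ennreal (f (g y) * g' y) * indicator {a..} y + ennreal (f (g y) * - g' y) * indicator {..a} y"
      using pos[of y] neg[of y] by (cases "a \<le> y"; cases "y \<le> a") auto
  qed
  also have "\<dots> = (\<integral>\<^sup>+y. ennreal (f (g y) * g' y) * indicator {a..} y \<partial>lborel) + (\<integral>\<^sup>+y. ennreal (f (g y) * - g' y) * indicator {..a} y \<partial>lborel)"
    by (intro nn_integral_add) auto
  also have "\<dots> \<le> ?I + ?I" by (intro add_mono A B)
  finally show ?thesis by (simp add: mult_2)
qed

lemma jb_measurable[measurable]: "jb \<in> borel_measurable borel"
  unfolding jb_def by measurable

context dispersion_params
begin

lemma two_b: "2 * b = 1 + \<epsilon>" by (simp add: b_def)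

definition "decay v = jb v powr - (2 * b)"

lemma decay_measurable[measurable]: "decay \<in> borel_measurable borel"
  unfolding decay_def by measurable

lemma decay_nonneg: "0 \<le> decay v" and decay_le_1: "decay v \<le> 1"
  and decay_minus: "decay (- v) = decay v"
  using jb_pos[of v] eps two_b by (auto simp: decay_def jb_minus intro!: jb_powr_neg_le_1)

definition "CJ = (\<integral>\<^sup>+v. ennreal (decay v) \<partial>lborel)"

text \<open>Here b > 1/2 enters: the decay exponent is 1 + \<epsilon>, and a shifted power has an
  explicit primitive.\<close>

lemma CJ_finite: "CJ < \<infinity>"
proof -
  have le: "decay v \<le> 2 powr (2 * b) * (1 + \<bar>v\<bar>) powr - (2 * b)" for v
  proof -
    have "(1 + \<bar>v\<bar>) / 2 \<le> jb v" using jb_ge_1[of v] jb_ge_abs[of v] by simp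
    then have "decay v \<le> ((1 + \<bar>v\<bar>) / 2) powr - (2 * b)"
      unfolding decay_def using eps two_b by (intro powr_mono2') auto
    also have "\<dots> = 2 powr (2 * b) * (1 + \<bar>v\<bar>) powr - (2 * b)"
      unfolding powr_divide by (simp add: powr_minus divide_inverse)
    finally show ?thesis .
  qed
  have FTC: "(\<integral>\<^sup>+v. ennreal ((1 + v) powr - (2 * b)) * indicator {0..} v \<partial>lborel) = ennreal (0 - (- ((1 + 0) powr - \<epsilon> / \<epsilon>)))"
  proof (rule nn_integral_FTC_atLeast)
    show "((\<lambda>v. - ((1 + v) powr - \<epsilon> / \<epsilon>)) has_real_derivative (1 + v) powr - (2 * b)) (at v)" if "0 \<le> v" for v :: real
    proof -
      have "- (2 * b) = - \<epsilon> - 1" using two_b by simp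
      then show ?thesis using that eps by (auto intro!: derivative_eq_intros)
    qed
    show "((\<lambda>v::real. - ((1 + v) powr - \<epsilon> / \<epsilon>)) \<longlongrightarrow> 0) at_top"
    proof -
      have "((\<lambda>v::real. (1 + v) powr - \<epsilon>) \<longlongrightarrow> 0) at_top"
        using eps by (intro tendsto_neg_powr filterlim_tendsto_add_at_top[OF tendsto_const] filterlim_ident) auto
      from tendsto_minus[OF tendsto_divide[OF this tendsto_const[of \<epsilon>]]] eps show ?thesis by simp
    qed
  qed auto
  have "(\<integral>\<^sup>+v. ennreal (decay v) * indicator {0..} v \<partial>lborel) \<le> 
     (\<integral>\<^sup>+v. ennreal (2 powr (2 * b)) * (ennreal ((1 + v) powr - (2 * b)) * indicator {0..} v) \<partial>lborel)"
  proof (intro nn_integral_mono)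
    fix v :: real
    show "ennreal (decay v) * indicator {0..} v \<le> ennreal (2 powr (2 * b)) * (ennreal ((1 + v) powr - (2 * b)) * indicator {0..} v)"
      using le[of v] by (auto simp: ennreal_mult[symmetric] split: split_indicator intro!: ennreal_leI)
  qed
  also have "\<dots> = ennreal (2 powr (2 * b)) * (\<integral>\<^sup>+v. ennreal ((1 + v) powr - (2 * b)) * indicator {0..} v \<partial>lborel)"
    by (rule nn_integral_cmult) auto
  also have "\<dots> < \<infinity>" unfolding FTC by (simp add: ennreal_mult_less_top)
  finally have A: "(\<integral>\<^sup>+v. ennreal (decay v) * indicator {0..} v \<partial>lborel) < \<infinity>" .
  have B: "(\<integral>\<^sup>+v. ennreal (decay v) * indicator {..0} v \<partial>lborel) = (\<integral>\<^sup>+v. ennreal (decay v) * indicator {0..} v \<partial>lborel)"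
    by (subst nn_integral_lborel_reflect[of _ 0, symmetric]) (auto intro!: nn_integral_cong simp: decay_minus split: split_indicator)
  have "CJ \<le> (\<integral>\<^sup>+v. ennreal (decay v) * indicator {0..} v + ennreal (decay v) * indicator {..0} v \<partial>lborel)"
    unfolding CJ_def by (intro nn_integral_mono) (auto split: split_indicator)
  also have "\<dots> = (\<integral>\<^sup>+v. ennreal (decay v) * indicator {0..} v \<partial>lborel) + (\<integral>\<^sup>+v. ennreal (decay v) * indicator {..0} v \<partial>lborel)"
    by (intro nn_integral_add) auto
  also have "\<dots> < \<infinity>" using A B by simp
  finally show ?thesis .
qed

text \<open>Away from 0 the power rule applies on each side; at 0 the difference quotient is
  \<open>\<bar>h\<bar> powr \<alpha>\<close>.\<close>

lemma phi_has_derivative: "(\<phi> has_real_derivative (1 + \<alpha>) * \<bar>y\<bar> powr \<alpha>) (at y)"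
proof (cases y "0 :: real" rule: linorder_cases)
  case equal
  have "((\<lambda>h. (\<phi> (0 + h) - \<phi> 0) / h) \<longlongrightarrow> 0) (at 0)"
  proof (rule Lim_transform_eventually)
    have "((\<lambda>h. \<bar>h\<bar> powr \<alpha>) \<longlongrightarrow> \<bar>0\<bar> powr \<alpha>) (at 0)"
      using alpha by (intro tendsto_powr' tendsto_intros) auto
    then show "((\<lambda>h. \<bar>h\<bar> powr \<alpha>) \<longlongrightarrow> 0) (at 0)" by simp
    show "\<forall>\<^sub>F h in at 0. \<bar>h\<bar> powr \<alpha> = (\<phi> (0 + h) - \<phi> 0) / h"
      by (auto simp: eventually_at_filter \<phi>_def)
  qed
  then show ?thesis using equal by (simp add: DERIV_def)
next
  case greater
  have "((\<lambda>y. y * y powr \<alpha>) has_real_derivative (1 + \<alpha>) * \<bar>y\<bar> powr \<alpha>) (at y)"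
    using greater by (auto intro!: derivative_eq_intros simp: powr_diff algebra_simps)
  then show ?thesis
    by (rule has_field_derivative_transform_within_open[of _ _ _ "{0<..}"]) (use greater in \<open>auto simp: \<phi>_def\<close>)
next
  case less
  have "((\<lambda>y. y * (- y) powr \<alpha>) has_real_derivative (1 + \<alpha>) * \<bar>y\<bar> powr \<alpha>) (at y)"
    using less by (auto intro!: derivative_eq_intros simp: powr_diff algebra_simps)
  then show ?thesis
    by (rule has_field_derivative_transform_within_open[of _ _ _ "{..<0}"]) (use less in \<open>auto simp: \<phi>_def\<close>)
qed

lemma phi_measurable[measurable]: "\<phi> \<in> borel_measurable borel"
  unfolding \<phi>_def by measurable

lemma Gd_measurable[measurable (raw)]:
  assumes [measurable]: "f \<in> borel_measurable M" "g \<in> borel_measurable M"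
  shows "(\<lambda>p. Gd (f p) (g p)) \<in> borel_measurable M"
  unfolding Gd_def by measurable

lemma hmax_measurable[measurable (raw)]:
  assumes [measurable]: "f \<in> borel_measurable M" "g \<in> borel_measurable M"
  shows "(\<lambda>p. hmax (f p) (g p)) \<in> borel_measurable M"
  unfolding hmax_def Gd_def cutoff_def by measurable

lemma tail_measurable[measurable (raw)]:
  assumes [measurable]: "f \<in> borel_measurable M" "g \<in> borel_measurable M"
  shows "(\<lambda>p. tail (f p) (g p)) \<in> borel_measurable M"
  unfolding tail_def by measurable

text \<open>The phase has its only change of monotonicity at x / 2. For x < 0 it is a hill instead
  of a valley, so its negative is used.\<close>

lemma nn_integral_Gd: "(\<integral>\<^sup>+y. ennreal (decay (t - \<phi> y - \<phi> (x - y)) * Gd x y) \<partial>lborel) \<le> 2 * CJ"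
proof -
  define G' where "G' y = (1 + \<alpha>) * (\<bar>y\<bar> powr \<alpha> - \<bar>x - y\<bar> powr \<alpha>)" for y
  have Gd: "Gd x y = \<bar>G' y\<bar>" for y using alpha by (simp add: Gd_def G'_def abs_mult)
  have der: "((\<lambda>y. \<phi> y + \<phi> (x - y)) has_real_derivative G' y) (at y)" for y
    unfolding G'_def
    by (rule derivative_eq_intros phi_has_derivative DERIV_chain2[OF phi_has_derivative] refl)+ (simp add: algebra_simps)
  have cont: "continuous_on UNIV G'"
    unfolding G'_def using alpha by (intro continuous_intros continuous_on_powr') auto
  have mono: "\<bar>p\<bar> \<le> \<bar>q\<bar> \<Longrightarrow> (1 + \<alpha>) * \<bar>p\<bar> powr \<alpha> \<le> (1 + \<alpha>) * \<bar>q\<bar> powr \<alpha>" for p q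
    using alpha by (intro mult_left_mono powr_mono2) auto
  show ?thesis
  proof (cases "0 \<le> x")
    case True
    have "(\<integral>\<^sup>+y. ennreal (decay (t - (\<phi> y + \<phi> (x - y))) * \<bar>G' y\<bar>) \<partial>lborel) \<le> 2 * (\<integral>\<^sup>+v. ennreal (decay (t - v)) \<partial>lborel)"
    proof (rule nn_integral_substitution_valley[where f = "\<lambda>v. decay (t - v)", OF _ _ der cont])
      show "0 \<le> G' y" if "x / 2 \<le> y" for y
        using mono[of "x - y" y] that True by (simp add: G'_def algebra_simps)
      show "G' y \<le> 0" if "y \<le> x / 2" for y
        using mono[of y "x - y"] that True by (simp add: G'_def algebra_simps)
    qed (auto simp: decay_nonneg)
    then show ?thesis unfolding Gd CJ_def by (subst (asm) nn_integral_lborel_reflect) (auto simp: diff_diff_eq)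
  next
    case False
    have "(\<integral>\<^sup>+y. ennreal (decay (t + - (\<phi> y + \<phi> (x - y))) * \<bar>- G' y\<bar>) \<partial>lborel) \<le> 2 * (\<integral>\<^sup>+v. ennreal (decay (t + v)) \<partial>lborel)"
    proof (rule nn_integral_substitution_valley[where f = "\<lambda>v. decay (t + v)" and a = "x / 2", OF _ _ DERIV_minus[OF der] continuous_on_minus[OF cont]])
      show "0 \<le> - G' y" if "x / 2 \<le> y" for y
        using mono[of y "x - y"] that False by (simp add: G'_def algebra_simps)
      show "- G' y \<le> 0" if "y \<le> x / 2" for y
        using mono[of "x - y" y] that False by (simp add: G'_def algebra_simps)
    qed (auto simp: decay_nonneg)
    moreover have "t + - (\<phi> y + \<phi> (x - y)) = t - \<phi> y - \<phi> (x - y)" for y by simp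
    moreover have "(\<integral>\<^sup>+v. ennreal (decay (t + v)) \<partial>lborel) = CJ"
      unfolding CJ_def using nn_integral_lborel_shift[of "\<lambda>v. ennreal (decay v)" "- t"] by (simp add: add.commute)
    ultimately show ?thesis unfolding Gd by (simp only: abs_minus_cancel)
  qed
qed

text \<open>In the window the decay is merely bounded by 1: height times length of the window gives
  the summand 1, uniformly in x.\<close>

lemma nn_integral_hmax: "(\<integral>\<^sup>+y. ennreal (decay (t - \<phi> y - \<phi> (x - y)) * hmax x y) \<partial>lborel) \<le> 2 * CJ + 1"
proof -
  let ?D = "cutoff x"
  have D: "1 \<le> ?D" by (rule cutoff_ge_1)
  have "ennreal (decay (t - \<phi> y - \<phi> (x - y)) * hmax x y) \<le> 
     ennreal (decay (t - \<phi> y - \<phi> (x - y)) * Gd x y) + ennreal ?D * indicator {x / 2 - 1 / ?D / 2..x / 2 + 1 / ?D / 2} y" for y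
  proof -
    define d where "d = decay (t - \<phi> y - \<phi> (x - y))"
    have d: "0 \<le> d" "d \<le> 1" by (auto simp: d_def decay_nonneg decay_le_1)
    show "ennreal (d * hmax x y) \<le> ennreal (d * Gd x y) + ennreal ?D * indicator {x / 2 - 1 / ?D / 2..x / 2 + 1 / ?D / 2} y"
    proof (cases "\<bar>2 * y - x\<bar> \<le> 1 / ?D")
      case True
      then have y: "y \<in> {x / 2 - 1 / ?D / 2..x / 2 + 1 / ?D / 2}" by auto
      have "d * hmax x y = d * Gd x y + d * ?D" using True by (simp add: hmax_def distrib_left)
      also have "\<dots> \<le> d * Gd x y + 1 * ?D" using d D by (intro add_left_mono mult_right_mono) auto
      finally have "ennreal (d * hmax x y) \<le> ennreal (d * Gd x y + ?D)" by (simp add: ennreal_leI)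
      also have "\<dots> = ennreal (d * Gd x y) + ennreal ?D"
        using d D Gd_nonneg by (intro ennreal_plus) auto
      finally show ?thesis using y by simp
    next
      case False
      then show ?thesis by (simp add: hmax_def)
    qed
  qed
  then have "(\<integral>\<^sup>+y. ennreal (decay (t - \<phi> y - \<phi> (x - y)) * hmax x y) \<partial>lborel) \<le> 
     (\<integral>\<^sup>+y. ennreal (decay (t - \<phi> y - \<phi> (x - y)) * Gd x y) + ennreal ?D * indicator {x / 2 - 1 / ?D / 2..x / 2 + 1 / ?D / 2} y \<partial>lborel)"
    by (intro nn_integral_mono)
  also have "\<dots> = (\<integral>\<^sup>+y. ennreal (decay (t - \<phi> y - \<phi> (x - y)) * Gd x y) \<partial>lborel) + (\<integral>\<^sup>+y. ennreal ?D * indicator {x / 2 - 1 / ?D / 2..x / 2 + 1 / ?D / 2} y \<partial>lborel)"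
    by (intro nn_integral_add) measurable
  also have "\<dots> \<le> 2 * CJ + 1"
  proof (rule add_mono[OF nn_integral_Gd])
    have "(\<integral>\<^sup>+y. ennreal ?D * indicator {x / 2 - 1 / ?D / 2..x / 2 + 1 / ?D / 2} y \<partial>lborel) = ennreal ?D * ennreal (1 / ?D)"
      using D by (simp add: nn_integral_cmult_indicator)
    then show "(\<integral>\<^sup>+y. ennreal ?D * indicator {x / 2 - 1 / ?D / 2..x / 2 + 1 / ?D / 2} y \<partial>lborel) \<le> 1"
      using D by (simp add: ennreal_mult[symmetric])
  qed
  finally show ?thesis .
qed

end

lemma fst_borel_measurable[measurable]: "fst \<in> borel_measurable (borel :: ('a::second_countable_topology \<times> 'b::second_countable_topology) measure)"
  and snd_borel_measurable[measurable]: "snd \<in> borel_measurable (borel :: ('a::second_countable_topology \<times> 'b::second_countable_topology) measure)"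
  by (auto intro!: borel_measurable_continuous_onI continuous_intros)

lemma nn_integral_lborel_reflect_euclidean:
  fixes f :: "'a::euclidean_space \<Rightarrow> ennreal"
  assumes [measurable]: "f \<in> borel_measurable borel"
  shows "(\<integral>\<^sup>+w. f (z - w) \<partial>lborel) = (\<integral>\<^sup>+w. f w \<partial>lborel)"
proof -
  have "distr lborel borel ((-) z) = lborel"
    using lborel_affine[of "-1" z] by (simp add: density_1)
  then have "(\<integral>\<^sup>+w. f w \<partial>lborel) = (\<integral>\<^sup>+w. f w \<partial>distr lborel borel ((-) z))"
    by simp
  also have "\<dots> = (\<integral>\<^sup>+w. f (z - w) \<partial>lborel)"
    by (simp add: nn_integral_distr)
  finally show ?thesis by simp
qed

lemma nn_integral_lborel_plane:
  fixes f :: "real \<times> real \<Rightarrow> ennreal"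
  assumes "f \<in> borel_measurable borel"
  shows "(\<integral>\<^sup>+w. f w \<partial>lborel) = (\<integral>\<^sup>+y. \<integral>\<^sup>+r. f (r, y) \<partial>lborel \<partial>lborel)"
  using assms by (simp add: lborel_pair.nn_integral_snd lborel_prod)

lemma nn_integral_lborel_shift_euclidean:
  fixes f :: "'a::euclidean_space \<Rightarrow> ennreal"
  assumes [measurable]: "f \<in> borel_measurable borel"
  shows "(\<integral>\<^sup>+z. f (z - w) \<partial>lborel) = (\<integral>\<^sup>+z. f z \<partial>lborel)"
proof -
  have "(\<integral>\<^sup>+z. f z \<partial>lborel) = (\<integral>\<^sup>+z. f z \<partial>distr lborel borel ((+) (- w)))"
    by (simp only: lborel_distr_plus)
  also have "\<dots> = (\<integral>\<^sup>+z. f (z - w) \<partial>lborel)"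
    by (simp add: nn_integral_distr)
  finally show ?thesis by simp
qed

lemma ennreal_add_power2_le: "(a + c)\<^sup>2 \<le> 4 * (a\<^sup>2 + c\<^sup>2 :: ennreal)"
proof -
  have "(a + c)\<^sup>2 \<le> (2 * max a c)\<^sup>2"
    unfolding mult_2 by (intro power_mono add_mono) auto
  also have "\<dots> = 4 * (max a c)\<^sup>2" by (simp add: power_mult_distrib)
  also have "\<dots> \<le> 4 * (a\<^sup>2 + c\<^sup>2)" by (intro mult_left_mono) (auto simp: max_def)
  finally show ?thesis .
qed

section \<open>Schur tests\<close>

context
  fixes k :: "'a::euclidean_space \<Rightarrow> 'a \<Rightarrow> ennreal" and f g :: "'a \<Rightarrow> ennreal" and C :: ennreal
  assumes k[measurable]: "case_prod k \<in> borel_measurable (borel \<Otimes>\<^sub>M borel)"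
    and f[measurable]: "f \<in> borel_measurable borel" and g[measurable]: "g \<in> borel_measurable borel"
begin

text \<open>Cauchy-Schwarz separates k from the product of the inputs, whose squared integral
  factorizes after exchanging the integrations.\<close>

lemma schur_fix_output:
  assumes C: "\<And>z. (\<integral>\<^sup>+w. (k z w)\<^sup>2 \<partial>lborel) \<le> C"
  shows "(\<integral>\<^sup>+z. (\<integral>\<^sup>+w. k z w * (f w * g (z - w)) \<partial>lborel)\<^sup>2 \<partial>lborel) \<le> C * ((\<integral>\<^sup>+w. (f w)\<^sup>2 \<partial>lborel) * (\<integral>\<^sup>+w. (g w)\<^sup>2 \<partial>lborel))"
proof -
  have "(\<integral>\<^sup>+z. (\<integral>\<^sup>+w. k z w * (f w * g (z - w)) \<partial>lborel)\<^sup>2 \<partial>lborel) \<le> (\<integral>\<^sup>+z. C * (\<integral>\<^sup>+w. (f w)\<^sup>2 * (g (z - w))\<^sup>2 \<partial>lborel) \<partial>lborel)"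
  proof (intro nn_integral_mono)
    fix z
    have "(\<integral>\<^sup>+w. k z w * (f w * g (z - w)) \<partial>lborel)\<^sup>2 \<le> (\<integral>\<^sup>+w. (k z w)\<^sup>2 \<partial>lborel) * (\<integral>\<^sup>+w. (f w * g (z - w))\<^sup>2 \<partial>lborel)"
      by (intro Cauchy_Schwarz_nn_integral) measurable
    also have "\<dots> \<le> C * (\<integral>\<^sup>+w. (f w * g (z - w))\<^sup>2 \<partial>lborel)" by (intro mult_right_mono C) auto
    finally show "(\<integral>\<^sup>+w. k z w * (f w * g (z - w)) \<partial>lborel)\<^sup>2 \<le> C * (\<integral>\<^sup>+w. (f w)\<^sup>2 * (g (z - w))\<^sup>2 \<partial>lborel)"
      by (simp add: power_mult_distrib)
  qed
  also have "\<dots> = C * (\<integral>\<^sup>+z. \<integral>\<^sup>+w. (f w)\<^sup>2 * (g (z - w))\<^sup>2 \<partial>lborel \<partial>lborel)"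
    by (intro nn_integral_cmult) measurable
  also have "(\<integral>\<^sup>+z. \<integral>\<^sup>+w. (f w)\<^sup>2 * (g (z - w))\<^sup>2 \<partial>lborel \<partial>lborel) = (\<integral>\<^sup>+w. \<integral>\<^sup>+z. (f w)\<^sup>2 * (g (z - w))\<^sup>2 \<partial>lborel \<partial>lborel)"
    by (intro lborel_pair.Fubini') measurable
  also have "\<dots> = (\<integral>\<^sup>+w. (f w)\<^sup>2 * (\<integral>\<^sup>+z. (g z)\<^sup>2 \<partial>lborel) \<partial>lborel)"
    using nn_integral_lborel_shift_euclidean[of "\<lambda>z. (g z)\<^sup>2"] by (simp add: nn_integral_cmult)
  also have "\<dots> = (\<integral>\<^sup>+w. (f w)\<^sup>2 \<partial>lborel) * (\<integral>\<^sup>+z. (g z)\<^sup>2 \<partial>lborel)"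
    by (intro nn_integral_multc) measurable
  finally show ?thesis .
qed

text \<open>Here k stays with f under Cauchy-Schwarz. The other factor is the full norm of g by
  reflection, and the exchange of integrations leaves k squared to be integrated over the
  outputs.\<close>

lemma schur_fix_first:
  assumes C: "\<And>w. (\<integral>\<^sup>+z. (k z w)\<^sup>2 \<partial>lborel) \<le> C"
  shows "(\<integral>\<^sup>+z. (\<integral>\<^sup>+w. k z w * (f w * g (z - w)) \<partial>lborel)\<^sup>2 \<partial>lborel) \<le> C * ((\<integral>\<^sup>+w. (f w)\<^sup>2 \<partial>lborel) * (\<integral>\<^sup>+w. (g w)\<^sup>2 \<partial>lborel))"
proof -
  let ?G = "\<integral>\<^sup>+w. (g w)\<^sup>2 \<partial>lborel"
  have "(\<integral>\<^sup>+z. (\<integral>\<^sup>+w. k z w * (f w * g (z - w)) \<partial>lborel)\<^sup>2 \<partial>lborel) \<le> (\<integral>\<^sup>+z. (\<integral>\<^sup>+w. (f w)\<^sup>2 * (k z w)\<^sup>2 \<partial>lborel) * ?G \<partial>lborel)"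
  proof (intro nn_integral_mono)
    fix z
    have "(\<integral>\<^sup>+w. (f w * k z w) * g (z - w) \<partial>lborel)\<^sup>2 \<le> (\<integral>\<^sup>+w. (f w * k z w)\<^sup>2 \<partial>lborel) * (\<integral>\<^sup>+w. (g (z - w))\<^sup>2 \<partial>lborel)"
      by (intro Cauchy_Schwarz_nn_integral) measurable
    also have "(\<integral>\<^sup>+w. (g (z - w))\<^sup>2 \<partial>lborel) = ?G"
      by (rule nn_integral_lborel_reflect_euclidean) measurable
    finally show "(\<integral>\<^sup>+w. k z w * (f w * g (z - w)) \<partial>lborel)\<^sup>2 \<le> (\<integral>\<^sup>+w. (f w)\<^sup>2 * (k z w)\<^sup>2 \<partial>lborel) * ?G"
      by (simp add: power_mult_distrib mult_ac)
  qed
  also have "\<dots> = (\<integral>\<^sup>+z. \<integral>\<^sup>+w. (f w)\<^sup>2 * (k z w)\<^sup>2 \<partial>lborel \<partial>lborel) * ?G"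
    by (intro nn_integral_multc) measurable
  also have "(\<integral>\<^sup>+z. \<integral>\<^sup>+w. (f w)\<^sup>2 * (k z w)\<^sup>2 \<partial>lborel \<partial>lborel) = (\<integral>\<^sup>+w. \<integral>\<^sup>+z. (f w)\<^sup>2 * (k z w)\<^sup>2 \<partial>lborel \<partial>lborel)"
    by (intro lborel_pair.Fubini') measurable
  also have "\<dots> = (\<integral>\<^sup>+w. (f w)\<^sup>2 * (\<integral>\<^sup>+z. (k z w)\<^sup>2 \<partial>lborel) \<partial>lborel)"
    by (intro nn_integral_cong nn_integral_cmult) measurable
  also have "\<dots> * ?G \<le> (\<integral>\<^sup>+w. (f w)\<^sup>2 * C \<partial>lborel) * ?G"
    by (intro mult_right_mono nn_integral_mono mult_left_mono C) auto
  also have "(\<integral>\<^sup>+w. (f w)\<^sup>2 * C \<partial>lborel) = (\<integral>\<^sup>+w. (f w)\<^sup>2 \<partial>lborel) * C"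
    by (intro nn_integral_multc) measurable
  finally show ?thesis by (simp add: mult_ac)
qed

text \<open>Now k stays with g, and the variable y = z - w makes the second input the fixed
  point.\<close>

lemma schur_fix_second:
  assumes C: "\<And>y. (\<integral>\<^sup>+z. (k z (z - y))\<^sup>2 \<partial>lborel) \<le> C"
  shows "(\<integral>\<^sup>+z. (\<integral>\<^sup>+w. k z w * (f w * g (z - w)) \<partial>lborel)\<^sup>2 \<partial>lborel) \<le> C * ((\<integral>\<^sup>+w. (f w)\<^sup>2 \<partial>lborel) * (\<integral>\<^sup>+w. (g w)\<^sup>2 \<partial>lborel))"
proof -
  let ?F = "\<integral>\<^sup>+w. (f w)\<^sup>2 \<partial>lborel"
  have "(\<integral>\<^sup>+z. (\<integral>\<^sup>+w. k z w * (f w * g (z - w)) \<partial>lborel)\<^sup>2 \<partial>lborel) \<le> (\<integral>\<^sup>+z. (\<integral>\<^sup>+y. (g y)\<^sup>2 * (k z (z - y))\<^sup>2 \<partial>lborel) * ?F \<partial>lborel)"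
  proof (intro nn_integral_mono)
    fix z
    have "(\<integral>\<^sup>+w. (g (z - w) * k z w) * f w \<partial>lborel)\<^sup>2 \<le> (\<integral>\<^sup>+w. (g (z - w) * k z w)\<^sup>2 \<partial>lborel) * ?F"
      by (intro Cauchy_Schwarz_nn_integral) measurable
    also have "(\<integral>\<^sup>+w. (g (z - w) * k z w)\<^sup>2 \<partial>lborel) = (\<integral>\<^sup>+y. (g y * k z (z - y))\<^sup>2 \<partial>lborel)"
      by (subst nn_integral_lborel_reflect_euclidean[of _ z, symmetric]) auto
    finally show "(\<integral>\<^sup>+w. k z w * (f w * g (z - w)) \<partial>lborel)\<^sup>2 \<le> (\<integral>\<^sup>+y. (g y)\<^sup>2 * (k z (z - y))\<^sup>2 \<partial>lborel) * ?F"
      by (simp add: power_mult_distrib mult_ac)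
  qed
  also have "\<dots> = (\<integral>\<^sup>+z. \<integral>\<^sup>+y. (g y)\<^sup>2 * (k z (z - y))\<^sup>2 \<partial>lborel \<partial>lborel) * ?F"
    by (intro nn_integral_multc) measurable
  also have "(\<integral>\<^sup>+z. \<integral>\<^sup>+y. (g y)\<^sup>2 * (k z (z - y))\<^sup>2 \<partial>lborel \<partial>lborel) = (\<integral>\<^sup>+y. \<integral>\<^sup>+z. (g y)\<^sup>2 * (k z (z - y))\<^sup>2 \<partial>lborel \<partial>lborel)"
    by (intro lborel_pair.Fubini') measurable
  also have "\<dots> = (\<integral>\<^sup>+y. (g y)\<^sup>2 * (\<integral>\<^sup>+z. (k z (z - y))\<^sup>2 \<partial>lborel) \<partial>lborel)"
    by (intro nn_integral_cong nn_integral_cmult) measurable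
  also have "\<dots> * ?F \<le> (\<integral>\<^sup>+y. (g y)\<^sup>2 * C \<partial>lborel) * ?F"
    by (intro mult_right_mono nn_integral_mono mult_left_mono C) auto
  also have "(\<integral>\<^sup>+y. (g y)\<^sup>2 * C \<partial>lborel) = (\<integral>\<^sup>+y. (g y)\<^sup>2 \<partial>lborel) * C"
    by (intro nn_integral_multc) measurable
  finally show ?thesis by (simp add: mult_ac)
qed

end

context dispersion_params
begin

text \<open>The larger of the two brackets is at least half the bracket of the sum, so its factor
  yields the decay of the sum and the other factor is kept.\<close>

lemma decay_mult_le: "decay u * decay v \<le> 2 powr (2 * b) * decay (u + v) * (decay u + decay v)"
proof -
  have *: "decay v \<le> 2 powr (2 * b) * decay (u + v)" if "jb u \<le> jb v" for u v
  proof -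
    have "jb (u + v) / 2 \<le> jb v" using jb_add[of u v] that by simp
    then have "decay v \<le> (jb (u + v) / 2) powr - (2 * b)"
      unfolding decay_def using jb_pos[of "u + v"] eps two_b by (intro powr_mono2') auto
    also have "\<dots> = 2 powr (2 * b) * decay (u + v)"
      unfolding powr_divide decay_def by (simp add: powr_minus divide_inverse)
    finally show ?thesis .
  qed
  show ?thesis
  proof (cases "jb u \<le> jb v")
    case True
    have "decay u * decay v \<le> decay u * (2 powr (2 * b) * decay (u + v))"
      by (intro mult_left_mono *[OF True] decay_nonneg)
    also have "\<dots> = 2 powr (2 * b) * decay (u + v) * decay u" by simp
    also have "\<dots> \<le> 2 powr (2 * b) * decay (u + v) * (decay u + decay v)"
      using decay_nonneg by (intro mult_left_mono) auto
    finally show ?thesis .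
  next
    case False
    have "decay v * decay u \<le> decay v * (2 powr (2 * b) * decay (u + v))"
      using *[of v u] False decay_nonneg by (intro mult_left_mono) (auto simp: add.commute)
    also have "\<dots> = 2 powr (2 * b) * decay (u + v) * decay v" by simp
    also have "\<dots> \<le> 2 powr (2 * b) * decay (u + v) * (decay u + decay v)"
      using decay_nonneg by (intro mult_left_mono) auto
    finally show ?thesis by (simp add: mult.commute)
  qed
qed

lemma nn_integral_decay_shift: "(\<integral>\<^sup>+t. ennreal (decay (t - c)) \<partial>lborel) = CJ"
  unfolding CJ_def by (rule nn_integral_lborel_shift) measurable

lemma nn_integral_decay_reflect: "(\<integral>\<^sup>+t. ennreal (decay (c - t)) \<partial>lborel) = CJ"
  unfolding CJ_def by (rule nn_integral_lborel_reflect) measurable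

lemma nn_integral_decay_reflect': "(\<integral>\<^sup>+r. ennreal (decay (t - r - q)) \<partial>lborel) = CJ"
  using nn_integral_decay_reflect[of "t - q"] by (simp only: diff_diff_eq add.commute[of q])

text \<open>With p and q the values of \<phi> at the two inputs, the time integral of both decays is
  the decay at t minus the phase, which the one-dimensional estimate along the phase
  handles.\<close>

lemma decay_convolution:
  "(\<integral>\<^sup>+r. ennreal (decay (r - p) * decay (t - r - q)) \<partial>lborel) \<le> ennreal (2 powr (2 * b)) * (2 * CJ) * ennreal (decay (t - p - q))"
proof -
  have eq: "r - p + (t - r - q) = t - p - q" for r by simp
  have "(\<integral>\<^sup>+r. ennreal (decay (r - p) * decay (t - r - q)) \<partial>lborel) \<le> 
    (\<integral>\<^sup>+r. ennreal (2 powr (2 * b) * decay (t - p - q)) * (ennreal (decay (r - p)) + ennreal (decay ((t - q) - r))) \<partial>lborel)"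
  proof (intro nn_integral_mono)
    fix r
    have "ennreal (decay (r - p) * decay (t - r - q)) \<le> ennreal (2 powr (2 * b) * decay (t - p - q) * (decay (r - p) + decay (t - r - q)))"
      using decay_mult_le[of "r - p" "t - r - q"] unfolding eq by (rule ennreal_leI)
    also have "\<dots> = ennreal (2 powr (2 * b) * decay (t - p - q)) * (ennreal (decay (r - p)) + ennreal (decay (t - r - q)))"
      using decay_nonneg by (simp add: ennreal_mult)
    finally show "ennreal (decay (r - p) * decay (t - r - q)) \<le> ennreal (2 powr (2 * b) * decay (t - p - q)) * (ennreal (decay (r - p)) + ennreal (decay ((t - q) - r)))"
      by (simp only: diff_diff_eq add.commute[of r q])
  qed
  also have "\<dots> = ennreal (2 powr (2 * b) * decay (t - p - q)) * ((\<integral>\<^sup>+r. ennreal (decay (r - p)) \<partial>lborel) + (\<integral>\<^sup>+r. ennreal (decay ((t - q) - r)) \<partial>lborel))"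
    by (subst nn_integral_cmult, measurable, subst nn_integral_add, measurable)
  also have "\<dots> = ennreal (2 powr (2 * b)) * (2 * CJ) * ennreal (decay (t - p - q))"
    unfolding nn_integral_decay_shift nn_integral_decay_reflect using decay_nonneg by (simp add: ennreal_mult mult_2 algebra_simps)
  finally show ?thesis .
qed

text \<open>The first summand bounds the integrals with \<open>hmax\<close>, the second those with
  \<open>tail\<close>: one factor for time and one for frequency.\<close>

definition "CM = ennreal (2 powr (2 * b)) * (2 * CJ) * (2 * CJ + 1) + CJ * CJ"

lemma CM_finite: "CM < \<infinity>"
  using CJ_finite by (simp add: CM_def ennreal_mult_less_top)

lemma nn_integral_hmax_plane:
  "(\<integral>\<^sup>+w. ennreal (decay (fst w - \<phi> (snd w)) * decay (t - fst w - \<phi> (x - snd w)) * hmax x (snd w)) \<partial>lborel) \<le> CM"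
proof -
  let ?c = "ennreal (2 powr (2 * b)) * (2 * CJ)"
  have "(\<integral>\<^sup>+w. ennreal (decay (fst w - \<phi> (snd w)) * decay (t - fst w - \<phi> (x - snd w)) * hmax x (snd w)) \<partial>lborel)
    = (\<integral>\<^sup>+y. \<integral>\<^sup>+r. ennreal (decay (r - \<phi> y) * decay (t - r - \<phi> (x - y)) * hmax x y) \<partial>lborel \<partial>lborel)"
    by (subst nn_integral_lborel_plane) (auto intro!: measurable_compose[OF _ measurable_ennreal])
  also have "\<dots> \<le> (\<integral>\<^sup>+y. ?c * ennreal (decay (t - \<phi> y - \<phi> (x - y)) * hmax x y) \<partial>lborel)"
  proof (intro nn_integral_mono)
    fix y
    have "(\<integral>\<^sup>+r. ennreal (decay (r - \<phi> y) * decay (t - r - \<phi> (x - y)) * hmax x y) \<partial>lborel) = 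
      (\<integral>\<^sup>+r. ennreal (decay (r - \<phi> y) * decay (t - r - \<phi> (x - y))) * ennreal (hmax x y) \<partial>lborel)"
      using decay_nonneg hmax_nonneg by (simp add: ennreal_mult)
    also have "\<dots> = (\<integral>\<^sup>+r. ennreal (decay (r - \<phi> y) * decay (t - r - \<phi> (x - y))) \<partial>lborel) * ennreal (hmax x y)"
      by (intro nn_integral_multc) measurable
    also have "\<dots> \<le> (?c * ennreal (decay (t - \<phi> y - \<phi> (x - y)))) * ennreal (hmax x y)"
      by (intro mult_right_mono decay_convolution) auto
    also have "\<dots> = ?c * ennreal (decay (t - \<phi> y - \<phi> (x - y)) * hmax x y)"
      using decay_nonneg hmax_nonneg by (simp add: ennreal_mult mult.assoc)
    finally show "(\<integral>\<^sup>+r. ennreal (decay (r - \<phi> y) * decay (t - r - \<phi> (x - y)) * hmax x y) \<partial>lborel) \<le> ?c * ennreal (decay (t - \<phi> y - \<phi> (x - y)) * hmax x y)" .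
  qed
  also have "\<dots> = ?c * (\<integral>\<^sup>+y. ennreal (decay (t - \<phi> y - \<phi> (x - y)) * hmax x y) \<partial>lborel)"
    by (intro nn_integral_cmult) measurable
  also have "\<dots> \<le> ?c * (2 * CJ + 1)" by (intro mult_left_mono nn_integral_hmax) auto
  also have "\<dots> \<le> CM" by (simp add: CM_def)
  finally show ?thesis .
qed

lemma nn_integral_tail: "(\<integral>\<^sup>+y. ennreal (tail x y) \<partial>lborel) \<le> CJ"
proof (cases "x = 0")
  case True
  \<comment> \<open>\<open>0 powr \<alpha>\<close> is 0, so the bump vanishes; elsewhere scaling y
    by |x|^\<alpha> turns it into \<open>decay\<close>.\<close>
  then show ?thesis by (simp add: tail_def)
next
  case False
  let ?c = "\<bar>x\<bar> powr \<alpha>"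
  have c: "0 < ?c" using False by simp
  have tail: "tail x y = ?c * decay (0 + ?c * y)" for y
  proof -
    have "jb (\<bar>y\<bar> * ?c) = jb (?c * y)" by (simp add: jb_def power_mult_distrib mult.commute)
    then show ?thesis by (simp add: tail_def decay_def)
  qed
  have "CJ = ennreal \<bar>?c\<bar> * (\<integral>\<^sup>+y. ennreal (decay (0 + ?c * y)) \<partial>lborel)"
    unfolding CJ_def using c by (intro nn_integral_real_affine) auto
  also have "\<dots> = (\<integral>\<^sup>+y. ennreal ?c * ennreal (decay (0 + ?c * y)) \<partial>lborel)"
    using c by (subst nn_integral_cmult) auto
  also have "\<dots> = (\<integral>\<^sup>+y. ennreal (tail x y) \<partial>lborel)"
    unfolding tail using c decay_nonneg by (simp add: ennreal_mult)
  finally show ?thesis by simp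
qed

lemma nn_integral_tail_first:
  "(\<integral>\<^sup>+w. ennreal (decay (fst w - \<phi> (snd w)) * tail x (x - snd w)) \<partial>lborel) \<le> CM"
proof -
  have "(\<integral>\<^sup>+w. ennreal (decay (fst w - \<phi> (snd w)) * tail x (x - snd w)) \<partial>lborel)
    = (\<integral>\<^sup>+y. \<integral>\<^sup>+r. ennreal (decay (r - \<phi> y) * tail x (x - y)) \<partial>lborel \<partial>lborel)"
    by (subst nn_integral_lborel_plane) (auto intro!: measurable_compose[OF _ measurable_ennreal])
  also have "\<dots> = (\<integral>\<^sup>+y. CJ * ennreal (tail x (x - y)) \<partial>lborel)"
    using decay_nonneg tail_nonneg by (simp add: ennreal_mult nn_integral_multc nn_integral_decay_shift)
  also have "\<dots> = CJ * (\<integral>\<^sup>+y. ennreal (tail x (x - y)) \<partial>lborel)" by (intro nn_integral_cmult) measurable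
  also have "\<dots> \<le> CJ * CJ"
    by (subst nn_integral_lborel_reflect) (auto intro!: mult_left_mono nn_integral_tail)
  also have "\<dots> \<le> CM" by (simp add: CM_def)
  finally show ?thesis .
qed

lemma nn_integral_tail_second:
  "(\<integral>\<^sup>+w. ennreal (decay (t - fst w - \<phi> (x - snd w)) * tail x (snd w)) \<partial>lborel) \<le> CM"
proof -
  have "(\<integral>\<^sup>+w. ennreal (decay (t - fst w - \<phi> (x - snd w)) * tail x (snd w)) \<partial>lborel)
    = (\<integral>\<^sup>+y. \<integral>\<^sup>+r. ennreal (decay (t - r - \<phi> (x - y)) * tail x y) \<partial>lborel \<partial>lborel)"
    by (subst nn_integral_lborel_plane) (auto intro!: measurable_compose[OF _ measurable_ennreal])
  also have "\<dots> = (\<integral>\<^sup>+y. CJ * ennreal (tail x y) \<partial>lborel)"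
    using decay_nonneg tail_nonneg nn_integral_decay_reflect' by (simp add: ennreal_mult nn_integral_multc)
  also have "\<dots> = CJ * (\<integral>\<^sup>+y. ennreal (tail x y) \<partial>lborel)" by (intro nn_integral_cmult) measurable
  also have "\<dots> \<le> CJ * CJ" by (intro mult_left_mono nn_integral_tail) auto
  also have "\<dots> \<le> CM" by (simp add: CM_def)
  finally show ?thesis .
qed

end

section \<open>The bilinear operator\<close>

text \<open>Bounding the sum by its number of terms times the maximum costs the square of that
  number, which is harmless for five terms.\<close>

lemma ennreal_sum_power2_le:
  fixes a :: "'i \<Rightarrow> ennreal"
  assumes "finite A"
  shows "(\<Sum>i\<in>A. a i)\<^sup>2 \<le> of_nat ((card A)\<^sup>2) * (\<Sum>i\<in>A. (a i)\<^sup>2)"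
proof (cases "A = {}")
  case False
  define m where "m = Max (a ` A)"
  have "(\<Sum>i\<in>A. a i) \<le> of_nat (card A) * m"
    unfolding m_def using assms by (intro sum_bounded_above) auto
  then have "(\<Sum>i\<in>A. a i)\<^sup>2 \<le> (of_nat (card A) * m)\<^sup>2" by (intro power_mono) auto
  also have "\<dots> = of_nat ((card A)\<^sup>2) * m\<^sup>2" by (simp add: power_mult_distrib)
  also have "m\<^sup>2 \<le> (\<Sum>i\<in>A. (a i)\<^sup>2)"
  proof -
    have "m \<in> a ` A" unfolding m_def using assms False by (intro Max_in) auto
    then obtain i where "i \<in> A" "m = a i" by auto
    then show ?thesis using assms member_le_sum[of i A "\<lambda>i. (a i)\<^sup>2"] by auto
  qed
  finally show ?thesis by (simp add: mult_left_mono)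
qed simp

context dispersion_params
begin

text \<open>The summands of \<open>majorant\<close> in the coordinates of the bilinear operator:
  output z, inputs w and z - w.\<close>

definition H :: "nat \<Rightarrow> real \<times> real \<Rightarrow> real \<times> real \<Rightarrow> real" where
  "H i z w = (let d = decay (fst z - \<phi> (snd z)); d\<^sub>1 = decay (fst w - \<phi> (snd w)); d\<^sub>2 = decay (fst z - fst w - \<phi> (snd z - snd w)) in
    if i = 0 then d\<^sub>1 * d\<^sub>2 * hmax (snd z) (snd w)
    else if i = 1 then d * d\<^sub>2 * hmax (snd w) (snd z)
    else if i = 2 then d * d\<^sub>1 * hmax (snd z - snd w) (snd z)
    else if i = 3 then d\<^sub>1 * tail (snd z) (snd z - snd w)
    else d\<^sub>2 * tail (snd z) (snd w))"

lemma Xweight_zero: "Xweight a c d r (t, 0) = 0"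
  by (simp add: Xweight_def)

lemma H_nonneg: "0 \<le> H i z w"
  by (auto simp: H_def Let_def decay_nonneg hmax_nonneg tail_nonneg)

lemma H_measurable: "(\<lambda>(z, w). ennreal (sqrt (H i z w))) \<in> borel_measurable (borel \<Otimes>\<^sub>M borel)"
  unfolding H_def Let_def by measurable

lemma majorant_eq_sum: "majorant (fst w) (snd w) (fst z - fst w) (snd z - snd w) = (\<Sum>i<5. H i z w)"
  by (simp add: majorant_def Let_def H_def decay_def eval_nat_numeral)

lemma H_bound:
  assumes f: "f \<in> borel_measurable borel" and g: "g \<in> borel_measurable borel" and "i < 5"
  shows "(\<integral>\<^sup>+z. (\<integral>\<^sup>+w. ennreal (sqrt (H i z w)) * (f w * g (z - w)) \<partial>lborel)\<^sup>2 \<partial>lborel) 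
    \<le> CM * ((\<integral>\<^sup>+w. (f w)\<^sup>2 \<partial>lborel) * (\<integral>\<^sup>+w. (g w)\<^sup>2 \<partial>lborel))"
proof -
  have sq: "(ennreal (sqrt (H i z w)))\<^sup>2 = ennreal (H i z w)" for i z w
    using H_nonneg[of i z w] by (simp add: ennreal_power)
  \<comment> \<open>Since \<phi> is odd and the decay even, freezing an input leads to the same
    plane integral as freezing the output, with the two points interchanged.\<close>
  have neg: "decay (a - c - \<phi> (x - y)) = decay (c - a - \<phi> (y - x))" for a c x y
  proof -
    have "a - c - \<phi> (x - y) = - (c - a - \<phi> (y - x))" using phi_minus[of "y - x"] by simp
    then show ?thesis by (simp only: decay_minus)
  qed
  consider "i = 0" | "i = 1" | "i = 2" | "i = 3" | "i = 4" using \<open>i < 5\<close> by linarith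
  then show ?thesis
  proof cases
    case 1
    have "(\<integral>\<^sup>+w. ennreal (H i z w) \<partial>lborel) \<le> CM" for z
      using nn_integral_hmax_plane by (simp add: 1 H_def Let_def)
    then show ?thesis
      by (intro schur_fix_output[OF H_measurable f g]) (simp add: sq)
  next
    case 2
    have "(\<integral>\<^sup>+z. ennreal (H i z w) \<partial>lborel) \<le> CM" for w
      using nn_integral_hmax_plane[of "fst w" "snd w"] by (simp add: 2 H_def Let_def neg[of _ "fst w" _ "snd w"])
    then show ?thesis
      by (intro schur_fix_first[OF H_measurable f g]) (simp add: sq)
  next
    case 3
    have "(\<integral>\<^sup>+z. ennreal (H i z (z - y)) \<partial>lborel) \<le> CM" for y
      using nn_integral_hmax_plane[of "fst y" "snd y"] by (simp add: 3 H_def Let_def neg[of _ "fst y" _ "snd y"])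
    then show ?thesis
      by (intro schur_fix_second[OF H_measurable f g]) (simp add: sq)
  next
    case 4
    have "(\<integral>\<^sup>+w. ennreal (H i z w) \<partial>lborel) \<le> CM" for z
      using nn_integral_tail_first by (simp add: 4 H_def Let_def)
    then show ?thesis
      by (intro schur_fix_output[OF H_measurable f g]) (simp add: sq)
  next
    case 5
    have "(\<integral>\<^sup>+w. ennreal (H i z w) \<partial>lborel) \<le> CM" for z
      using nn_integral_tail_second by (simp add: 5 H_def Let_def)
    then show ?thesis
      by (intro schur_fix_output[OF H_measurable f g]) (simp add: sq)
  qed
qed

text \<open>\<open>Kq\<close> is a quotient of squared norms' weights, so its root is the kernel
  that acts on the functions themselves.\<close>

definition "K z w = sqrt (Kq (fst w) (snd w) (fst z - fst w) (snd z - snd w))"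

definition "cK = sqrt (cP + cR + cT + cQ)"

lemma majorant_nonneg: "0 \<le> majorant t\<^sub>1 x\<^sub>1 t\<^sub>2 x\<^sub>2"
  by (auto simp: majorant_def Let_def intro!: add_nonneg_nonneg mult_nonneg_nonneg hmax_nonneg tail_nonneg)

lemma K_le: "K z w \<le> cK * (\<Sum>i<5. sqrt (H i z w))"
proof -
  have c: "0 \<le> cP + cR + cT + cQ" by (simp add: cP_def cR_def cT_def cQ_def)
  have "Kq (fst w) (snd w) (fst z - fst w) (snd z - snd w) \<le> (cP + cR + cT + cQ) * majorant (fst w) (snd w) (fst z - fst w) (snd z - snd w)"
  proof (cases "snd w = 0 \<or> snd z - snd w = 0 \<or> snd z = 0")
    \<comment> \<open>With a zero output frequency the factor from the derivative is 0; with a zero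
      input frequency the denominator is 0 and division yields 0.\<close>
    case True
    then have "Kq (fst w) (snd w) (fst z - fst w) (snd z - snd w) = 0"
      by (auto simp: Kq_def Xweight_zero simp del: prod.collapse)
    then show ?thesis using c majorant_nonneg by simp
  next
    case False
    then show ?thesis by (intro Kq_le_majorant) auto
  qed
  then have "K z w \<le> sqrt ((cP + cR + cT + cQ) * (\<Sum>i<5. H i z w))"
    unfolding K_def majorant_eq_sum[symmetric] by simp
  also have "\<dots> = cK * sqrt (\<Sum>i<5. H i z w)" by (simp add: cK_def real_sqrt_mult)
  also have "\<dots> \<le> cK * (\<Sum>i<5. sqrt (H i z w))"
  proof (intro mult_left_mono)
    have "sqrt (\<Sum>i\<in>A. H i z w) \<le> (\<Sum>i\<in>A. sqrt (H i z w))" if "finite A" for A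
      using that
    proof induction
      case (insert i A)
      have "sqrt (H i z w + (\<Sum>i\<in>A. H i z w)) \<le> sqrt (H i z w) + sqrt (\<Sum>i\<in>A. H i z w)"
        by (intro sqrt_add_le_add_sqrt H_nonneg sum_nonneg)
      with insert show ?case by simp
    qed simp
    then show "sqrt (\<Sum>i<5. H i z w) \<le> (\<Sum>i<5. sqrt (H i z w))" by simp
    show "0 \<le> cK" using c by (simp add: cK_def)
  qed
  finally show ?thesis .
qed

definition "CB = ennreal (cK\<^sup>2) * (25 * (5 * CM))"

lemma CB_finite: "CB < \<infinity>"
  using CM_finite by (simp add: CB_def ennreal_mult_less_top)

lemma bilinear_K:
  assumes f[measurable]: "f \<in> borel_measurable borel" and g[measurable]: "g \<in> borel_measurable borel"
  shows "(\<integral>\<^sup>+z. (\<integral>\<^sup>+w. ennreal (K z w) * (f w * g (z - w)) \<partial>lborel)\<^sup>2 \<partial>lborel) 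
    \<le> CB * ((\<integral>\<^sup>+w. (f w)\<^sup>2 \<partial>lborel) * (\<integral>\<^sup>+w. (g w)\<^sup>2 \<partial>lborel))"
proof -
  let ?X = "(\<integral>\<^sup>+w. (f w)\<^sup>2 \<partial>lborel) * (\<integral>\<^sup>+w. (g w)\<^sup>2 \<partial>lborel)"
  note H_measurable[measurable]
  define J where "J i z = (\<integral>\<^sup>+w. ennreal (sqrt (H i z w)) * (f w * g (z - w)) \<partial>lborel)" for i z
  have [measurable]: "J i \<in> borel_measurable borel" for i unfolding J_def by measurable
  have cK: "0 \<le> cK" by (simp add: cK_def cP_def cR_def cT_def cQ_def)
  have "(\<integral>\<^sup>+w. ennreal (K z w) * (f w * g (z - w)) \<partial>lborel) \<le> ennreal cK * (\<Sum>i<5. J i z)" for z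
  proof -
    have "(\<integral>\<^sup>+w. ennreal (K z w) * (f w * g (z - w)) \<partial>lborel) \<le> (\<integral>\<^sup>+w. ennreal cK * (\<Sum>i<5. ennreal (sqrt (H i z w)) * (f w * g (z - w))) \<partial>lborel)"
    proof (intro nn_integral_mono)
      fix w
      have "ennreal (K z w) \<le> ennreal (cK * (\<Sum>i<5. sqrt (H i z w)))" by (rule ennreal_leI[OF K_le])
      also have "\<dots> = ennreal cK * (\<Sum>i<5. ennreal (sqrt (H i z w)))"
        using cK H_nonneg by (simp add: ennreal_mult sum_nonneg)
      finally have "ennreal (K z w) * (f w * g (z - w)) \<le> ennreal cK * (\<Sum>i<5. ennreal (sqrt (H i z w))) * (f w * g (z - w))"
        by (intro mult_right_mono) auto
      then show "ennreal (K z w) * (f w * g (z - w)) \<le> ennreal cK * (\<Sum>i<5. ennreal (sqrt (H i z w)) * (f w * g (z - w)))"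
        by (simp only: sum_distrib_right mult.assoc)
    qed
    also have "\<dots> = ennreal cK * (\<integral>\<^sup>+w. (\<Sum>i<5. ennreal (sqrt (H i z w)) * (f w * g (z - w))) \<partial>lborel)"
      by (intro nn_integral_cmult) measurable
    also have "\<dots> = ennreal cK * (\<Sum>i<5. J i z)"
    proof -
      have "(\<lambda>w. ennreal (sqrt (H i z w)) * (f w * g (z - w))) \<in> borel_measurable lborel" for i by measurable
      then show ?thesis unfolding J_def by (simp add: nn_integral_sum)
    qed
    finally show ?thesis .
  qed
  then have "(\<integral>\<^sup>+z. (\<integral>\<^sup>+w. ennreal (K z w) * (f w * g (z - w)) \<partial>lborel)\<^sup>2 \<partial>lborel) \<le> (\<integral>\<^sup>+z. (ennreal cK * (\<Sum>i<5. J i z))\<^sup>2 \<partial>lborel)"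
    by (intro nn_integral_mono power_mono) auto
  also have "\<dots> \<le> (\<integral>\<^sup>+z. ennreal (cK\<^sup>2) * (25 * (\<Sum>i<5. (J i z)\<^sup>2)) \<partial>lborel)"
  proof (intro nn_integral_mono)
    fix z
    show "(ennreal cK * (\<Sum>i<5. J i z))\<^sup>2 \<le> ennreal (cK\<^sup>2) * (25 * (\<Sum>i<5. (J i z)\<^sup>2))"
      unfolding power_mult_distrib using ennreal_sum_power2_le[of "{..<5::nat}" "\<lambda>i. J i z"] cK
      by (intro mult_mono) (auto simp: ennreal_power)
  qed
  also have "\<dots> = ennreal (cK\<^sup>2) * (25 * (\<Sum>i<5. \<integral>\<^sup>+z. (J i z)\<^sup>2 \<partial>lborel))"
    by (simp add: nn_integral_cmult nn_integral_sum)
  also have "\<dots> \<le> ennreal (cK\<^sup>2) * (25 * (\<Sum>i<5::nat. CM * ?X))"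
    unfolding J_def by (intro mult_left_mono sum_mono H_bound f g) auto
  also have "\<dots> = CB * ?X" by (simp add: CB_def mult.assoc)
  finally show ?thesis .
qed

end

section \<open>Fourier transform of a product\<close>

text \<open>The bounded factor h is meant for characters coupling the two variables. Integrability
  on the product justifies the exchanges of integrals below.\<close>

lemma integrable_tensor:
  fixes F :: "'a::euclidean_space \<Rightarrow> complex" and G :: "'b::euclidean_space \<Rightarrow> complex"
  assumes F: "integrable lborel F" and G: "integrable lborel G"
    and h[measurable]: "case_prod h \<in> borel_measurable (borel \<Otimes>\<^sub>M borel)" and h1: "\<And>p q. cmod (h p q) \<le> 1"
  shows "integrable (lborel \<Otimes>\<^sub>M lborel) (\<lambda>(p, q). h p q * (F p * G q))"
proof (rule Bochner_Integration.integrable_bound)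
  have [measurable]: "F \<in> borel_measurable borel" "G \<in> borel_measurable borel"
    using F G by (auto dest: borel_measurable_integrable)
  show "integrable (lborel \<Otimes>\<^sub>M lborel) (\<lambda>(p, q). F p * G q)"
  proof (rule lborel_pair.Fubini_integrable)
    show "integrable lborel (\<lambda>p. \<integral>q. cmod (case (p, q) of (p, q) \<Rightarrow> F p * G q) \<partial>lborel)"
      using F by (simp add: norm_mult)
    show "AE p in lborel. integrable lborel (\<lambda>q. case (p, q) of (p, q) \<Rightarrow> F p * G q)"
      using G by simp
  qed measurable
  show "(\<lambda>(p, q). h p q * (F p * G q)) \<in> borel_measurable (lborel \<Otimes>\<^sub>M lborel)" by measurable
  show "AE x in lborel \<Otimes>\<^sub>M lborel. cmod (case x of (p, q) \<Rightarrow> h p q * (F p * G q)) \<le> cmod (case x of (p, q) \<Rightarrow> F p * G q)"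
    by (rule AE_I2) (simp add: norm_mult h1 mult_left_le_one_le split: prod.split)
qed

lemma cis_measurable[measurable]: "cis \<in> borel_measurable borel"
  by (intro borel_measurable_continuous_onI continuous_intros)

section \<open>Gaussians and their Fourier transforms\<close>

lemma gaussian_fourier_real:
  fixes c v :: real
  assumes c: "0 < c"
  shows "integrable lborel (\<lambda>u. complex_of_real (exp (- (c\<^sup>2 * u\<^sup>2) / 2)))"
    and "(LINT u|lborel. cis (v * u) * complex_of_real (exp (- (c\<^sup>2 * u\<^sup>2) / 2))) = complex_of_real (sqrt (2 * pi) / c * exp (- (v\<^sup>2 / c\<^sup>2) / 2))"
proof -
  let ?g = "\<lambda>y. complex_of_real (exp (- (y\<^sup>2) / 2))"
  have g_eq: "?g y = complex_of_real (sqrt (2 * pi)) * complex_of_real (std_normal_density y)" for y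
    by (simp add: std_normal_density_def)
  have gi: "integrable lborel ?g" unfolding g_eq by (intro integrable_mult_right integrable_of_real) simp
  \<comment> \<open>For c = 1 the claim is the characteristic function of the standard normal law up
    to normalisation; an affine substitution gives every other width.\<close>
  have "complex_of_real (exp (- (w\<^sup>2) / 2)) = char std_normal_distribution w" for w
    by (simp add: char_std_normal_distribution)
  also have "char std_normal_distribution w = (LINT y|lborel. std_normal_density y *\<^sub>R cis (w * y))" for w
    unfolding char_def by (subst integral_density) (auto simp: cis_conv_exp)
  finally have char: "complex_of_real (exp (- (w\<^sup>2) / 2)) = (LINT y|lborel. std_normal_density y *\<^sub>R cis (w * y))" for w .
  have std: "(LINT y|lborel. cis (w * y) * ?g y) = complex_of_real (sqrt (2 * pi) * exp (- (w\<^sup>2) / 2))" for w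
  proof -
    have "(LINT y|lborel. cis (w * y) * ?g y) = (LINT y|lborel. complex_of_real (sqrt (2 * pi)) * (std_normal_density y *\<^sub>R cis (w * y)))"
      unfolding g_eq by (simp only: scaleR_conv_of_real mult_ac)
    also have "\<dots> = complex_of_real (sqrt (2 * pi)) * complex_of_real (exp (- (w\<^sup>2) / 2))"
      unfolding char by (rule integral_mult_right_zero)
    finally show ?thesis by simp
  qed
  have eq: "complex_of_real (exp (- (c\<^sup>2 * u\<^sup>2) / 2)) = ?g (0 + c * u)" for u by (simp add: power_mult_distrib)
  show "integrable lborel (\<lambda>u. complex_of_real (exp (- (c\<^sup>2 * u\<^sup>2) / 2)))"
    unfolding eq using c by (intro lborel_integrable_real_affine gi) auto
  have "complex_of_real (sqrt (2 * pi) * exp (- ((v / c)\<^sup>2) / 2)) = (LINT y|lborel. cis ((v / c) * y) * ?g y)"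
    by (rule std[symmetric])
  also have "\<dots> = \<bar>c\<bar> *\<^sub>R (LINT u|lborel. cis ((v / c) * (0 + c * u)) * ?g (0 + c * u))"
    using c by (intro lborel_integral_real_affine) auto
  also have "\<dots> = complex_of_real c * (LINT u|lborel. cis (v * u) * complex_of_real (exp (- (c\<^sup>2 * u\<^sup>2) / 2)))"
    using c by (simp add: scaleR_conv_of_real power_mult_distrib)
  finally show "(LINT u|lborel. cis (v * u) * complex_of_real (exp (- (c\<^sup>2 * u\<^sup>2) / 2))) = complex_of_real (sqrt (2 * pi) / c * exp (- (v\<^sup>2 / c\<^sup>2) / 2))"
    using c by (simp add: field_simps power_divide)
qed

text \<open>A damping factor in frequency that disappears as c tends to 0 and makes the inversion
  integral converge for every integrable function.\<close>

definition gauss :: "real \<Rightarrow> real \<times> real \<Rightarrow> complex" where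
  "gauss c w = complex_of_real (exp (- (c\<^sup>2 * (w \<bullet> w)) / 2))"

lemma gauss_measurable[measurable]: "gauss c \<in> borel_measurable borel"
  unfolding gauss_def by measurable

lemma gauss_prod: "gauss c (a, d) = complex_of_real (exp (- (c\<^sup>2 * a\<^sup>2) / 2)) * complex_of_real (exp (- (c\<^sup>2 * d\<^sup>2) / 2))"
  by (simp add: gauss_def inner_prod_def power2_eq_square algebra_simps of_real_mult[symmetric] exp_add[symmetric] add_divide_distrib diff_divide_distrib del: of_real_mult)

lemma gaussian_fourier_plane:
  fixes v :: "real \<times> real"
  assumes c: "0 < c"
  shows "integrable lborel (gauss c)"
    and "(LINT w|lborel. cis (v \<bullet> w) * gauss c w) = complex_of_real (2 * pi / c\<^sup>2 * exp (- ((v \<bullet> v) / c\<^sup>2) / 2))"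
proof -
  let ?e = "\<lambda>u::real. complex_of_real (exp (- (c\<^sup>2 * u\<^sup>2) / 2))"
  note e = gaussian_fourier_real[OF c]
  have "integrable (lborel \<Otimes>\<^sub>M lborel) (\<lambda>(p, q). 1 * (?e p * ?e q))"
    by (intro integrable_tensor e) auto
  then show int: "integrable lborel (gauss c)"
    unfolding lborel_prod by (rule Bochner_Integration.integrable_cong[THEN iffD1, rotated 2]) (auto simp: gauss_prod)
  have "integrable lborel (\<lambda>w. cis (v \<bullet> w) * gauss c w)"
    by (rule Bochner_Integration.integrable_bound[OF int]) (auto simp: norm_mult)
  then have i2: "integrable (lborel \<Otimes>\<^sub>M lborel) (\<lambda>w. cis (v \<bullet> w) * gauss c w)"
    unfolding lborel_prod .
  have "(LINT w|lborel. cis (v \<bullet> w) * gauss c w) = (LINT a|lborel. LINT d|lborel. cis (v \<bullet> (a, d)) * gauss c (a, d))"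
    using lborel_pair.integral_fst'[OF i2] by (simp add: lborel_prod)
  also have "\<dots> = (LINT a|lborel. LINT d|lborel. (cis (fst v * a) * ?e a) * (cis (snd v * d) * ?e d))"
    by (simp add: gauss_prod inner_prod_def cis_mult[symmetric] mult_ac)
  also have "\<dots> = (LINT a|lborel. cis (fst v * a) * ?e a) * (LINT d|lborel. cis (snd v * d) * ?e d)"
    by simp
  also have "\<dots> = complex_of_real (2 * pi / c\<^sup>2 * exp (- ((v \<bullet> v) / c\<^sup>2) / 2))"
    unfolding e(2) of_real_mult[symmetric]
  proof (rule arg_cong[where f = complex_of_real])
    have "sqrt (2 * pi) / c * exp (- ((fst v)\<^sup>2 / c\<^sup>2) / 2) * (sqrt (2 * pi) / c * exp (- ((snd v)\<^sup>2 / c\<^sup>2) / 2)) =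
      (sqrt (2 * pi) * sqrt (2 * pi)) / (c * c) * (exp (- ((fst v)\<^sup>2 / c\<^sup>2) / 2) * exp (- ((snd v)\<^sup>2 / c\<^sup>2) / 2))"
      by simp
    also have "exp (- ((fst v)\<^sup>2 / c\<^sup>2) / 2) * exp (- ((snd v)\<^sup>2 / c\<^sup>2) / 2) = exp (- ((v \<bullet> v) / c\<^sup>2) / 2)"
      by (simp add: exp_add[symmetric] inner_prod_def power2_eq_square add_divide_distrib)
    finally show "sqrt (2 * pi) / c * exp (- ((fst v)\<^sup>2 / c\<^sup>2) / 2) * (sqrt (2 * pi) / c * exp (- ((snd v)\<^sup>2 / c\<^sup>2) / 2)) =
      2 * pi / c\<^sup>2 * exp (- ((v \<bullet> v) / c\<^sup>2) / 2)" by (simp add: power2_eq_square)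
  qed
  finally show "(LINT w|lborel. cis (v \<bullet> w) * gauss c w) = complex_of_real (2 * pi / c\<^sup>2 * exp (- ((v \<bullet> v) / c\<^sup>2) / 2))" .
qed

lemma integral_lborel_scale_plane:
  fixes f :: "real \<times> real \<Rightarrow> complex"
  assumes [measurable]: "f \<in> borel_measurable borel" and c: "0 < c"
  shows "(LINT p|lborel. f p) = complex_of_real (c\<^sup>2) * (LINT y|lborel. f (q - c *\<^sub>R y))"
proof -
  have eq: "(lborel :: (real \<times> real) measure) = density (distr lborel borel (\<lambda>y. q + (- c) *\<^sub>R y)) (\<lambda>_. ennreal (c\<^sup>2))"
    using lborel_affine[of "- c" q] c by (simp add: power2_eq_square)
  have "(LINT p|lborel. f p) = (LINT p|density (distr lborel borel (\<lambda>y. q + (- c) *\<^sub>R y)) (\<lambda>_. ennreal (c\<^sup>2)). f p)"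
    using eq by (rule arg_cong)
  also have "\<dots> = (LINT p|distr lborel borel (\<lambda>y. q + (- c) *\<^sub>R y). c\<^sup>2 *\<^sub>R f p)"
    by (intro integral_density) auto
  also have "\<dots> = (LINT y|lborel. c\<^sup>2 *\<^sub>R f (q + (- c) *\<^sub>R y))"
    by (intro integral_distr) auto
  finally show ?thesis by (simp add: scaleR_conv_of_real)
qed

lemma fourier2_inner: "fourier2 f w = complex_of_real (1 / (2 * pi)) * (LINT p|lborel. cis (- (p \<bullet> w)) * f p)"
  by (simp add: fourier2_def inner_prod_def case_prod_beta)

lemma fourier2_measurable[measurable]:
  assumes [measurable]: "f \<in> borel_measurable borel"
  shows "fourier2 f \<in> borel_measurable borel"
  unfolding fourier2_inner[abs_def] by measurable

lemma cmod_fourier2_le: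
  assumes "integrable lborel f"
  shows "cmod (fourier2 f w) \<le> (1 / (2 * pi)) * (LINT p|lborel. cmod (f p))"
proof -
  have "cmod (LINT p|lborel. cis (- (p \<bullet> w)) * f p) \<le> (LINT p|lborel. cmod (cis (- (p \<bullet> w)) * f p))"
    by (rule integral_norm_bound)
  moreover have "cmod (complex_of_real (1 / (2 * pi))) = 1 / (2 * pi)" unfolding norm_of_real by simp
  ultimately show ?thesis unfolding fourier2_inner norm_mult by (auto simp: norm_mult intro!: divide_right_mono)
qed

lemma integral_derivative_eq_0:
  fixes F f :: "real \<Rightarrow> complex"
  assumes F: "\<And>x. (F has_vector_derivative f x) (at x)" and f: "continuous_on UNIV f" "integrable lborel f"
    and lim: "(F \<longlongrightarrow> 0) at_top" "(F \<longlongrightarrow> 0) at_bot"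
  shows "(LINT x|lborel. f x) = 0"
proof -
  have "(LBINT x=-\<infinity>..\<infinity>. f x) = 0 - 0"
  proof (rule interval_integral_FTC_integrable)
    show "isCont f x" for x using f(1) by (simp add: continuous_on_eq_continuous_at)
    show "set_integrable lborel (einterval (- \<infinity>) \<infinity>) f" using f(2) by (simp add: set_integrable_def)
  qed (use F lim in \<open>auto simp: ereal_tendsto_simps\<close>)
  then show ?thesis by (simp add: interval_lebesgue_integral_def set_lebesgue_integral_def)
qed

text \<open>The damping makes Fubini legitimate. The frequency integral then falls on the Gaussian
  alone and gives a Gaussian of width c around q, which the substitution p = q - c y
  normalises.\<close>

lemma regularization_fourier:
  assumes f: "integrable lborel f" and c: "0 < c"
  shows "complex_of_real (1 / (2 * pi)) * (LINT w|lborel. cis (q \<bullet> w) * (gauss c w * fourier2 f w))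
     = (LINT y|lborel. complex_of_real (1 / (2 * pi)) * gauss 1 y * f (q - c *\<^sub>R y))"
proof -
  have [measurable]: "f \<in> borel_measurable borel" using f by (auto dest: borel_measurable_integrable)
  let ?k = "complex_of_real (1 / (2 * pi))"
  note G = gaussian_fourier_plane[OF c]
  have int: "integrable (lborel \<Otimes>\<^sub>M lborel) (\<lambda>(w, p). cis ((q - p) \<bullet> w) * (gauss c w * f p))"
  proof (rule integrable_tensor[OF G(1) f])
    show "(\<lambda>(w, p). cis ((q - p) \<bullet> w)) \<in> borel_measurable (borel \<Otimes>\<^sub>M borel)" by measurable
  qed simp
  have "(LINT w|lborel. cis (q \<bullet> w) * (gauss c w * fourier2 f w))
    = (LINT w|lborel. ?k * (LINT p|lborel. cis ((q - p) \<bullet> w) * (gauss c w * f p)))"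
  proof (intro Bochner_Integration.integral_cong refl)
    fix w
    have "(LINT p|lborel. cis ((q - p) \<bullet> w) * (gauss c w * f p)) = (LINT p|lborel. (cis (q \<bullet> w) * gauss c w) * (cis (- (p \<bullet> w)) * f p))"
    proof -
      have "cis ((q - p) \<bullet> w) = cis (q \<bullet> w) * cis (- (p \<bullet> w))" for p
        by (simp add: inner_diff_left cis_mult)
      then show ?thesis by (simp only: mult_ac)
    qed
    also have "\<dots> = (cis (q \<bullet> w) * gauss c w) * (LINT p|lborel. cis (- (p \<bullet> w)) * f p)"
      by (rule integral_mult_right_zero)
    finally show "cis (q \<bullet> w) * (gauss c w * fourier2 f w) = ?k * (LINT p|lborel. cis ((q - p) \<bullet> w) * (gauss c w * f p))"
      by (simp only: fourier2_inner mult_ac)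
  qed
  also have "\<dots> = ?k * (LINT w|lborel. LINT p|lborel. cis ((q - p) \<bullet> w) * (gauss c w * f p))"
    by (rule integral_mult_right_zero)
  also have "(LINT w|lborel. LINT p|lborel. cis ((q - p) \<bullet> w) * (gauss c w * f p)) = (LINT p|lborel. LINT w|lborel. cis ((q - p) \<bullet> w) * (gauss c w * f p))"
    by (rule lborel_pair.Fubini_integral[OF int, symmetric])
  also have "\<dots> = (LINT p|lborel. complex_of_real (2 * pi / c\<^sup>2 * exp (- (((q - p) \<bullet> (q - p)) / c\<^sup>2) / 2)) * f p)"
    unfolding mult.assoc[symmetric] integral_mult_left_zero G(2) ..
  also have "\<dots> = complex_of_real (c\<^sup>2) * (LINT y|lborel. complex_of_real (2 * pi / c\<^sup>2 * exp (- (((q - (q - c *\<^sub>R y)) \<bullet> (q - (q - c *\<^sub>R y))) / c\<^sup>2) / 2)) * f (q - c *\<^sub>R y))"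
    by (rule integral_lborel_scale_plane[OF _ c]) measurable
  also have "\<dots> = (LINT y|lborel. complex_of_real (c\<^sup>2) * (complex_of_real (2 * pi / c\<^sup>2 * exp (- (((q - (q - c *\<^sub>R y)) \<bullet> (q - (q - c *\<^sub>R y))) / c\<^sup>2) / 2)) * f (q - c *\<^sub>R y)))"
    by (rule integral_mult_right_zero[symmetric])
  also have "\<dots> = (LINT y|lborel. complex_of_real (2 * pi) * (gauss 1 y * f (q - c *\<^sub>R y)))"
    using c by (intro Bochner_Integration.integral_cong refl) (simp add: gauss_def power2_eq_square)
  finally have "?k * (LINT w|lborel. cis (q \<bullet> w) * (gauss c w * fourier2 f w)) = ?k * (?k * (LINT y|lborel. complex_of_real (2 * pi) * (gauss 1 y * f (q - c *\<^sub>R y))))"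
    by simp
  also have "\<dots> = ?k * (LINT y|lborel. gauss 1 y * f (q - c *\<^sub>R y))"
    by simp
  also have "\<dots> = (LINT y|lborel. ?k * (gauss 1 y * f (q - c *\<^sub>R y)))"
    by (rule integral_mult_right_zero[symmetric])
  finally show ?thesis by (simp only: mult.assoc)
qed

text \<open>Only the Gaussian means of \<open>f\<close> are recovered from its transform, so Fourier inversion is not needed.\<close>

lemma fourier2_mult_le:
  assumes f: "integrable lborel f" "continuous_on UNIV f" "\<And>p. cmod (f p) \<le> B"
    and g: "integrable lborel g"
  shows "ennreal (cmod (fourier2 (\<lambda>p. f p * g p) z)) \<le> (\<integral>\<^sup>+w. ennreal (cmod (fourier2 f w)) * ennreal (cmod (fourier2 g (z - w))) \<partial>lborel)"
proof -
  have [measurable]: "f \<in> borel_measurable borel" "g \<in> borel_measurable borel"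
    using f g by (auto dest: borel_measurable_integrable)
  let ?k = "complex_of_real (1 / (2 * pi))"
  \<comment> \<open>The convolution formula carries the factor 1 / (2 pi); being at most 1, it is
    dropped.\<close>
  have k: "cmod ?k \<le> 1" unfolding norm_of_real using pi_gt3 by (simp add: field_simps)
  define X where "X = (\<integral>\<^sup>+w. ennreal (cmod (fourier2 f w)) * ennreal (cmod (fourier2 g (z - w))) \<partial>lborel)"
  define c where "c n = 1 / real (Suc n)" for n
  have c: "0 < c n" for n by (simp add: c_def)
  have gauss_1: "cmod (gauss r w) \<le> 1" for r w by (simp add: gauss_def)
  \<comment> \<open>The convolution of the transforms with damping: it is bounded by X for every n,
    and it converges to the transform of the product.\<close>
  define A where "A n = ?k * (LINT w|lborel. gauss (c n) w * fourier2 f w * fourier2 g (z - w))" for n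
  define m where "m n q = (LINT y|lborel. ?k * gauss 1 y * f (q - c n *\<^sub>R y))" for n q
  have A_le: "ennreal (cmod (A n)) \<le> X" for n
  proof -
    let ?h = "\<lambda>w. gauss (c n) w * fourier2 f w * fourier2 g (z - w)"
    have "ennreal (cmod (A n)) \<le> ennreal (cmod (LINT w|lborel. ?h w))"
      unfolding A_def norm_mult using k by (intro ennreal_leI mult_left_le_one_le) auto
    also have "\<dots> \<le> (\<integral>\<^sup>+w. ennreal (cmod (?h w)) \<partial>lborel)"
    proof (cases "integrable lborel ?h")
      case True then show ?thesis by (rule integral_norm_bound_ennreal)
    next
      \<comment> \<open>A non-integrable integrand has integral 0 by convention, so the bound
        persists and no integrability of the transforms is needed.\<close>
      case False then show ?thesis by (simp add: not_integrable_integral_eq)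
    qed
    also have "\<dots> \<le> X"
      unfolding X_def
    proof (intro nn_integral_mono)
      fix w
      have "cmod (?h w) \<le> cmod (fourier2 f w) * cmod (fourier2 g (z - w))"
        unfolding norm_mult mult.assoc using gauss_1 by (intro mult_left_le_one_le) auto
      then show "ennreal (cmod (?h w)) \<le> ennreal (cmod (fourier2 f w)) * ennreal (cmod (fourier2 g (z - w)))"
        by (simp add: ennreal_mult[symmetric] ennreal_leI)
    qed
    finally show ?thesis .
  qed
  \<comment> \<open>Expanding the transform of g and exchanging integrals isolates the damped
    inversion integral of f, that is, the Gaussian mean \<open>m n q\<close>.\<close>
  have A_eq: "A n = ?k * (LINT q|lborel. cis (- (q \<bullet> z)) * g q * m n q)" for n
  proof -
    note G = gaussian_fourier_plane(1)[OF c]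
    define Bf where "Bf = (1 / (2 * pi)) * (LINT p|lborel. cmod (f p))"
    have Ff: "integrable lborel (\<lambda>w. gauss (c n) w * fourier2 f w)"
    proof (rule Bochner_Integration.integrable_bound)
      show "integrable lborel (\<lambda>w. complex_of_real Bf * gauss (c n) w)" by (intro integrable_mult_right G)
      have "cmod (fourier2 f w) \<le> \<bar>Bf\<bar>" for w using cmod_fourier2_le[OF f(1), of w] by (simp add: Bf_def)
      then show "AE w in lborel. cmod (gauss (c n) w * fourier2 f w) \<le> cmod (complex_of_real Bf * gauss (c n) w)"
        by (intro AE_I2) (simp add: norm_mult mult.commute mult_right_mono)
    qed measurable
    have int: "integrable (lborel \<Otimes>\<^sub>M lborel) (\<lambda>(w, q). cis (- (q \<bullet> (z - w))) * ((gauss (c n) w * fourier2 f w) * g q))"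
    proof (rule integrable_tensor[OF Ff g])
      show "(\<lambda>(w, q). cis (- (q \<bullet> (z - w)))) \<in> borel_measurable (borel \<Otimes>\<^sub>M borel)" by measurable
    qed simp
    have "(LINT w|lborel. gauss (c n) w * fourier2 f w * fourier2 g (z - w)) 
      = (LINT w|lborel. ?k * (LINT q|lborel. cis (- (q \<bullet> (z - w))) * ((gauss (c n) w * fourier2 f w) * g q)))"
    proof (intro Bochner_Integration.integral_cong refl)
      fix w
      have "(LINT q|lborel. cis (- (q \<bullet> (z - w))) * ((gauss (c n) w * fourier2 f w) * g q)) = (LINT q|lborel. (gauss (c n) w * fourier2 f w) * (cis (- (q \<bullet> (z - w))) * g q))"
        by (simp only: mult_ac)
      also have "\<dots> = (gauss (c n) w * fourier2 f w) * (LINT q|lborel. cis (- (q \<bullet> (z - w))) * g q)"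
        by (rule integral_mult_right_zero)
      finally show "gauss (c n) w * fourier2 f w * fourier2 g (z - w) = ?k * (LINT q|lborel. cis (- (q \<bullet> (z - w))) * ((gauss (c n) w * fourier2 f w) * g q))"
        by (simp only: fourier2_inner[of g] mult_ac)
    qed
    also have "\<dots> = ?k * (LINT w|lborel. LINT q|lborel. cis (- (q \<bullet> (z - w))) * ((gauss (c n) w * fourier2 f w) * g q))"
      by (rule integral_mult_right_zero)
    also have "(LINT w|lborel. LINT q|lborel. cis (- (q \<bullet> (z - w))) * ((gauss (c n) w * fourier2 f w) * g q))
      = (LINT q|lborel. LINT w|lborel. cis (- (q \<bullet> (z - w))) * ((gauss (c n) w * fourier2 f w) * g q))"
      by (rule lborel_pair.Fubini_integral[OF int, symmetric])
    also have "?k * \<dots> = (LINT q|lborel. ?k * (LINT w|lborel. cis (- (q \<bullet> (z - w))) * ((gauss (c n) w * fourier2 f w) * g q)))"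
      by (rule integral_mult_right_zero[symmetric])
    also have "\<dots> = (LINT q|lborel. cis (- (q \<bullet> z)) * g q * m n q)"
    proof (intro Bochner_Integration.integral_cong refl)
      fix q
      have "(LINT w|lborel. cis (- (q \<bullet> (z - w))) * ((gauss (c n) w * fourier2 f w) * g q)) = (LINT w|lborel. (cis (- (q \<bullet> z)) * g q) * (cis (q \<bullet> w) * (gauss (c n) w * fourier2 f w)))"
      proof (intro Bochner_Integration.integral_cong refl)
        fix w
        have "- (q \<bullet> (z - w)) = - (q \<bullet> z) + q \<bullet> w" by (simp add: inner_diff_right)
        then have "cis (- (q \<bullet> (z - w))) = cis (- (q \<bullet> z)) * cis (q \<bullet> w)" by (simp only: cis_mult)
        then show "cis (- (q \<bullet> (z - w))) * ((gauss (c n) w * fourier2 f w) * g q) = (cis (- (q \<bullet> z)) * g q) * (cis (q \<bullet> w) * (gauss (c n) w * fourier2 f w))"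
          by (simp only: mult_ac)
      qed
      also have "\<dots> = (cis (- (q \<bullet> z)) * g q) * (LINT w|lborel. cis (q \<bullet> w) * (gauss (c n) w * fourier2 f w))"
        by (rule integral_mult_right_zero)
      finally show "?k * (LINT w|lborel. cis (- (q \<bullet> (z - w))) * ((gauss (c n) w * fourier2 f w) * g q)) = cis (- (q \<bullet> z)) * g q * m n q"
        unfolding m_def regularization_fourier[OF f(1) c, symmetric] by (simp only: mult_ac)
    qed
    finally show ?thesis unfolding A_def by simp
  qed
  have G1: "integrable lborel (gauss 1)" by (rule gaussian_fourier_plane) simp
  have G1': "(LINT y|lborel. gauss 1 y) = complex_of_real (2 * pi)"
    using gaussian_fourier_plane(2)[of 1 0] by simp
  have B0: "0 \<le> B" using order_trans[OF norm_ge_zero f(3)] by blast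
  have m_lim: "(\<lambda>n. m n q) \<longlonglongrightarrow> f q" for q
  proof -
    have "(\<lambda>n. m n q) \<longlonglongrightarrow> (LINT y|lborel. ?k * gauss 1 y * f q)"
      unfolding m_def
    proof (rule integral_dominated_convergence[where w = "\<lambda>y. B * cmod (gauss 1 y)"])
      show "integrable lborel (\<lambda>y. B * cmod (gauss 1 y))" using G1 by (intro integrable_mult_right integrable_norm)
      have "c \<longlonglongrightarrow> 0" unfolding c_def by (rule LIMSEQ_Suc[OF lim_1_over_n])
      then have "(\<lambda>n. q - c n *\<^sub>R y) \<longlonglongrightarrow> q" for y
        by (auto intro!: tendsto_eq_intros)
      then have "(\<lambda>n. f (q - c n *\<^sub>R y)) \<longlonglongrightarrow> f q" for y
        by (rule isCont_tendsto_compose[rotated])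
          (use f(2) in \<open>simp add: continuous_on_eq_continuous_at del: split_paired_All\<close>)
      then show "AE y in lborel. (\<lambda>n. ?k * gauss 1 y * f (q - c n *\<^sub>R y)) \<longlonglongrightarrow> ?k * gauss 1 y * f q"
        by (intro AE_I2 tendsto_intros)
      show "AE y in lborel. cmod (?k * gauss 1 y * f (q - c n *\<^sub>R y)) \<le> B * cmod (gauss 1 y)" for n
      proof (rule AE_I2)
        fix y
        have "cmod ?k * cmod (gauss 1 y) * cmod (f (q - c n *\<^sub>R y)) \<le> 1 * cmod (gauss 1 y) * B"
          using k f(3) B0 by (intro mult_mono) auto
        also have "\<dots> = B * cmod (gauss 1 y)" by simp
        finally show "cmod (?k * gauss 1 y * f (q - c n *\<^sub>R y)) \<le> B * cmod (gauss 1 y)" unfolding norm_mult .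
      qed
    qed measurable
    also have "(LINT y|lborel. ?k * gauss 1 y * f q) = ?k * complex_of_real (2 * pi) * f q"
      using G1' by simp
    finally show ?thesis by simp
  qed
  \<comment> \<open>The normalised Gaussian has mass 1, so averaging does not increase the bound of
    f. This gives the majorant for the limit under the integral.\<close>
  have m_bound: "cmod (m n q) \<le> B" for n q
  proof -
    have "cmod (m n q) \<le> (LINT y|lborel. cmod (?k * gauss 1 y * f (q - c n *\<^sub>R y)))"
      unfolding m_def by (rule integral_norm_bound)
    also have "\<dots> \<le> (LINT y|lborel. B * (1 / (2 * pi)) * cmod (gauss 1 y))"
    proof (rule integral_mono')
      show "integrable lborel (\<lambda>y. B * (1 / (2 * pi)) * cmod (gauss 1 y))"
        using G1 by (intro integrable_mult_right integrable_norm)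
      fix y
      have "cmod ?k = 1 / (2 * pi)" unfolding norm_of_real by simp
      then have "cmod (?k * gauss 1 y * f (q - c n *\<^sub>R y)) = 1 / (2 * pi) * cmod (gauss 1 y) * cmod (f (q - c n *\<^sub>R y))"
        by (simp only: norm_mult)
      also have "\<dots> \<le> 1 / (2 * pi) * cmod (gauss 1 y) * B" using f(3) by (intro mult_left_mono) auto
      finally show "cmod (?k * gauss 1 y * f (q - c n *\<^sub>R y)) \<le> B * (1 / (2 * pi)) * cmod (gauss 1 y)" by (simp only: mult_ac)
    qed (use B0 in auto)
    also have "\<dots> = B * (1 / (2 * pi)) * (LINT y|lborel. cmod (gauss 1 y))" by (rule integral_mult_right_zero)
    also have "(LINT y|lborel. cmod (gauss 1 y)) = 2 * pi"
    proof -
      have "complex_of_real (LINT y|lborel. cmod (gauss 1 y)) = (LINT y|lborel. complex_of_real (cmod (gauss 1 y)))" 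
        by (rule integral_of_real[OF integrable_norm[OF G1], symmetric])
      also have "\<dots> = complex_of_real (2 * pi)"
      proof -
        have "complex_of_real (cmod (gauss 1 y)) = gauss 1 y" for y by (simp add: gauss_def)
        then show ?thesis by (simp only: G1')
      qed
      finally show ?thesis by (simp only: of_real_eq_iff)
    qed
    finally show ?thesis by simp
  qed
  have m_meas[measurable]: "m n \<in> borel_measurable borel" for n unfolding m_def by measurable
  have "A \<longlonglongrightarrow> ?k * (LINT q|lborel. cis (- (q \<bullet> z)) * g q * f q)"
    unfolding A_eq
  proof (intro tendsto_mult tendsto_const)
    show "(\<lambda>n. LINT q|lborel. cis (- (q \<bullet> z)) * g q * m n q) \<longlonglongrightarrow> (LINT q|lborel. cis (- (q \<bullet> z)) * g q * f q)"
    proof (rule integral_dominated_convergence[where w = "\<lambda>q. B * cmod (g q)"])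
      show "integrable lborel (\<lambda>q. B * cmod (g q))" using g by (intro integrable_mult_right integrable_norm)
      show "AE q in lborel. (\<lambda>n. cis (- (q \<bullet> z)) * g q * m n q) \<longlonglongrightarrow> cis (- (q \<bullet> z)) * g q * f q"
        by (intro AE_I2 tendsto_intros m_lim)
      show "AE q in lborel. cmod (cis (- (q \<bullet> z)) * g q * m n q) \<le> B * cmod (g q)" for n
        using m_bound[of n] by (intro AE_I2) (simp add: norm_mult mult.commute[of B] mult_left_mono)
    qed measurable
  qed
  moreover have "?k * (LINT q|lborel. cis (- (q \<bullet> z)) * g q * f q) = fourier2 (\<lambda>p. f p * g p) z"
    by (simp add: fourier2_inner mult_ac)
  ultimately have "A \<longlonglongrightarrow> fourier2 (\<lambda>p. f p * g p) z" by simp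
  then have "(\<lambda>n. ennreal (cmod (A n))) \<longlonglongrightarrow> ennreal (cmod (fourier2 (\<lambda>p. f p * g p) z))"
    by (intro tendsto_ennrealI tendsto_norm)
  then show ?thesis unfolding X_def[symmetric] by (rule Lim_bounded[where M = 0]) (use A_le in auto)
qed

section \<open>Schwartz functions\<close>

lemma integrable_inverse_one_plus_square: "integrable lborel (\<lambda>x::real. complex_of_real (1 / (1 + x\<^sup>2)))"
  using integrable_inverse_1_plus_square
  by (intro integrable_of_real) (simp add: set_integrable_def inverse_eq_divide)

lemma integrable_of_square_decay:
  fixes f :: "real \<Rightarrow> complex"
  assumes f: "continuous_on UNIV f" and le: "\<And>x. cmod (f x) * (1 + x\<^sup>2) \<le> C"
  shows "integrable lborel f"
proof (rule Bochner_Integration.integrable_bound)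
  show "integrable lborel (\<lambda>x. complex_of_real C * complex_of_real (1 / (1 + x\<^sup>2)))"
    by (intro integrable_mult_right integrable_inverse_one_plus_square)
  show "f \<in> borel_measurable lborel" using borel_measurable_continuous_onI[OF f] by simp
  show "AE x in lborel. cmod (f x) \<le> cmod (complex_of_real C * complex_of_real (1 / (1 + x\<^sup>2)))"
  proof (rule AE_I2)
    fix x :: real
    have p: "0 < 1 + x\<^sup>2" by (simp add: add_pos_nonneg)
    have "cmod (f x) \<le> C / (1 + x\<^sup>2)" using le[of x] p by (simp add: pos_le_divide_eq)
    also have "\<dots> \<le> \<bar>C\<bar> * \<bar>1 / (1 + x\<^sup>2)\<bar>" using p by (simp add: divide_right_mono)
    finally show "cmod (f x) \<le> cmod (complex_of_real C * complex_of_real (1 / (1 + x\<^sup>2)))"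
      unfolding norm_mult norm_of_real .
  qed
qed

lemma tendsto_0_of_square_decay:
  fixes f :: "real \<Rightarrow> complex"
  assumes le: "\<And>x. cmod (f x) * (1 + x\<^sup>2) \<le> C" and F: "F = at_top \<or> F = at_bot"
  shows "(f \<longlongrightarrow> 0) F"
proof (rule Lim_null_comparison)
  show "\<forall>\<^sub>F x in F. cmod (f x) \<le> C / (1 + x\<^sup>2)"
    using le by (intro always_eventually allI) (simp add: pos_le_divide_eq add_pos_nonneg)
  have "filterlim (\<lambda>x::real. x\<^sup>2) at_top F"
    using F filterlim_pow_at_top[OF _ filterlim_ident, of 2] filterlim_pow_at_bot_even[OF _ filterlim_ident, of 2] by auto
  then have "filterlim (\<lambda>x::real. 1 + x\<^sup>2) at_top F"
    by (intro filterlim_tendsto_add_at_top[OF tendsto_const])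
  then show "((\<lambda>x. C / (1 + x\<^sup>2)) \<longlongrightarrow> 0) F"
    by (intro tendsto_divide_0[OF tendsto_const] filterlim_at_top_imp_at_infinity)
qed

text \<open>Decay sufficient for integrability on the plane and along each line of constant t. It
  passes directly to products and sums, hence to a product of Schwartz functions and its
  derivative.\<close>

definition plane_decay :: "(real \<times> real \<Rightarrow> complex) \<Rightarrow> real \<Rightarrow> bool" where
  "plane_decay f C \<longleftrightarrow> continuous_on UNIV f \<and> (\<forall>t x. cmod (f (t, x)) * ((1 + t\<^sup>2) * (1 + x\<^sup>2)) \<le> C)"

lemma plane_decayD:
  assumes "plane_decay f C"
  shows "continuous_on UNIV f" "cmod (f (t, x)) * ((1 + t\<^sup>2) * (1 + x\<^sup>2)) \<le> C"
    "0 \<le> C" "cmod (f p) \<le> C" "cmod (f (t, x)) * (1 + x\<^sup>2) \<le> C" "integrable lborel f"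
proof -
  show f: "continuous_on UNIV f" and le: "cmod (f (t, x)) * ((1 + t\<^sup>2) * (1 + x\<^sup>2)) \<le> C" for t x
    using assms by (auto simp: plane_decay_def)
  show C: "0 \<le> C" using order_trans[OF _ le[of 0 0]] by simp
  show 1: "cmod (f (t, x)) * (1 + x\<^sup>2) \<le> C" for t x
  proof -
    have "cmod (f (t, x)) * (1 * (1 + x\<^sup>2)) \<le> cmod (f (t, x)) * ((1 + t\<^sup>2) * (1 + x\<^sup>2))"
      by (intro mult_left_mono mult_right_mono) auto
    then show ?thesis using le[of t x] by simp
  qed
  show "cmod (f p) \<le> C"
  proof (cases p)
    case (Pair t x)
    have "cmod (f (t, x)) * 1 \<le> cmod (f (t, x)) * (1 + x\<^sup>2)" by (intro mult_left_mono) auto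
    then show ?thesis using 1[of t x] Pair by simp
  qed
  show "integrable lborel f"
  proof (rule Bochner_Integration.integrable_bound)
    let ?e = "\<lambda>x::real. complex_of_real (1 / (1 + x\<^sup>2))"
    have "integrable (lborel \<Otimes>\<^sub>M lborel) (\<lambda>(t, x). complex_of_real 1 * (?e t * ?e x))"
      by (intro integrable_tensor integrable_inverse_one_plus_square) auto
    then show "integrable lborel (\<lambda>p. complex_of_real C * (\<lambda>(t, x). complex_of_real 1 * (?e t * ?e x)) p)"
      unfolding lborel_prod by (rule integrable_mult_right)
    show "f \<in> borel_measurable lborel" using borel_measurable_continuous_onI[OF f] by simp
    show "AE p in lborel. cmod (f p) \<le> cmod (complex_of_real C * (\<lambda>(t, x). complex_of_real 1 * (?e t * ?e x)) p)"
    proof (rule AE_I2, clarify)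
      fix t x :: real
      have p: "0 < (1 + t\<^sup>2) * (1 + x\<^sup>2)" by (simp add: add_pos_nonneg)
      have "cmod (f (t, x)) \<le> C / ((1 + t\<^sup>2) * (1 + x\<^sup>2))" using le[of t x] p by (simp only: pos_le_divide_eq)
      also have "\<dots> = \<bar>C\<bar> * (\<bar>1\<bar> * (\<bar>1 / (1 + t\<^sup>2)\<bar> * \<bar>1 / (1 + x\<^sup>2)\<bar>))" using C by simp
      finally show "cmod (f (t, x)) \<le> cmod (complex_of_real C * (complex_of_real 1 * (?e t * ?e x)))"
        unfolding norm_mult norm_of_real .
    qed
  qed
qed

lemma schwartz_plane_decay:
  assumes "schwartz u"
  shows "\<exists>C. plane_decay (iterpd ds u) C"
proof -
  let ?f = "iterpd ds u"
  have "\<exists>B. \<forall>t x. \<bar>t ^ a * x ^ c\<bar> * cmod (?f (t, x)) \<le> B" for a c :: nat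
  proof -
    have "bounded (range (\<lambda>(t, x). complex_of_real (t ^ a * x ^ c) * ?f (t, x)))"
      using assms unfolding schwartz_def by blast
    then obtain B where "\<forall>y\<in>range (\<lambda>(t, x). complex_of_real (t ^ a * x ^ c) * ?f (t, x)). cmod y \<le> B"
      unfolding bounded_iff by blast
    then have "cmod (complex_of_real (t ^ a * x ^ c) * ?f (t, x)) \<le> B" for t x by auto
    then show ?thesis unfolding norm_mult norm_of_real by blast
  qed
  then obtain B where B: "\<And>a c t x. \<bar>t ^ a * x ^ c\<bar> * cmod (?f (t, x)) \<le> B a c" by metis
  \<comment> \<open>Expanding the weight leaves four monomials, each covered by one of the Schwartz
    bounds.\<close>
  have "cmod (?f (t, x)) * ((1 + t\<^sup>2) * (1 + x\<^sup>2)) \<le> B 0 0 + B 2 0 + B 0 2 + B 2 2" for t x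
  proof -
    have "cmod (?f (t, x)) * ((1 + t\<^sup>2) * (1 + x\<^sup>2)) = \<bar>t ^ 0 * x ^ 0\<bar> * cmod (?f (t, x)) + \<bar>t ^ 2 * x ^ 0\<bar> * cmod (?f (t, x))
       + \<bar>t ^ 0 * x ^ 2\<bar> * cmod (?f (t, x)) + \<bar>t ^ 2 * x ^ 2\<bar> * cmod (?f (t, x))"
      by (simp add: algebra_simps abs_mult)
    then show ?thesis using B[of t 0 x 0] B[of t 2 x 0] B[of t 0 x 2] B[of t 2 x 2] by linarith
  qed
  moreover have "continuous_on UNIV ?f" using assms unfolding schwartz_def by blast
  ultimately show ?thesis unfolding plane_decay_def by blast
qed

lemma schwartz_has_dx:
  assumes "schwartz u"
  shows "((\<lambda>y. u (t, y)) has_vector_derivative dx u (t, x)) (at x)"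
proof -
  have "(\<lambda>y. iterpd [] u (t, y)) differentiable (at x)" using assms unfolding schwartz_def by blast
  then show ?thesis by (simp add: dx_def pd_def vector_derivative_works)
qed

lemma plane_decay_mult:
  assumes "plane_decay f C" "plane_decay g D"
  shows "plane_decay (\<lambda>p. f p * g p) (C * D)"
  unfolding plane_decay_def
proof (intro conjI allI)
  show "continuous_on UNIV (\<lambda>p. f p * g p)" by (intro continuous_intros plane_decayD(1)[OF assms(1)] plane_decayD(1)[OF assms(2)])
  fix t x
  have "cmod (f (t, x)) * (cmod (g (t, x)) * ((1 + t\<^sup>2) * (1 + x\<^sup>2))) \<le> C * D"
    using plane_decayD[OF assms(1)] plane_decayD[OF assms(2)] by (intro mult_mono) auto
  then show "cmod (f (t, x) * g (t, x)) * ((1 + t\<^sup>2) * (1 + x\<^sup>2)) \<le> C * D" by (simp add: norm_mult mult.assoc)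
qed

lemma plane_decay_add:
  assumes "plane_decay f C" "plane_decay g D"
  shows "plane_decay (\<lambda>p. f p + g p) (C + D)"
  unfolding plane_decay_def
proof (intro conjI allI)
  show "continuous_on UNIV (\<lambda>p. f p + g p)" by (intro continuous_intros plane_decayD(1)[OF assms(1)] plane_decayD(1)[OF assms(2)])
  fix t x
  have "cmod (f (t, x) + g (t, x)) * ((1 + t\<^sup>2) * (1 + x\<^sup>2)) \<le> (cmod (f (t, x)) + cmod (g (t, x))) * ((1 + t\<^sup>2) * (1 + x\<^sup>2))"
    by (intro mult_right_mono norm_triangle_ineq) auto
  also have "\<dots> \<le> C + D"
    using plane_decayD(2)[OF assms(1), of t x] plane_decayD(2)[OF assms(2), of t x] by (simp only: distrib_right add_mono)
  finally show "cmod (f (t, x) + g (t, x)) * ((1 + t\<^sup>2) * (1 + x\<^sup>2)) \<le> C + D" .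
qed

text \<open>The difference \<open>?D\<close> is the x-derivative of the character times g, so its
  integral along every line of constant t vanishes: integration by parts without splitting the
  integrand.\<close>

lemma fourier2_derivative:
  assumes g: "plane_decay g C" and h: "plane_decay h D"
    and der: "\<And>t x. ((\<lambda>y. g (t, y)) has_vector_derivative h (t, x)) (at x)"
  shows "fourier2 h w = \<i> * complex_of_real (snd w) * fourier2 g w"
proof -
  have [measurable]: "g \<in> borel_measurable borel" "h \<in> borel_measurable borel"
    using plane_decayD(1)[OF g] plane_decayD(1)[OF h] by (auto intro: borel_measurable_continuous_onI)
  let ?c = "\<i> * complex_of_real (snd w)"
  let ?E = "\<lambda>p. cis (- (p \<bullet> w))"
  have Ei: "integrable lborel (\<lambda>p. ?E p * f p)" if "integrable lborel f" for f
  proof -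
    have [measurable]: "f \<in> borel_measurable borel" using that by (auto dest: borel_measurable_integrable)
    show ?thesis by (rule Bochner_Integration.integrable_bound[OF that]) (auto simp: norm_mult)
  qed
  note ig = Ei[OF plane_decayD(6)[OF g]] and ih = Ei[OF plane_decayD(6)[OF h]]
  let ?D = "\<lambda>p. ?E p * h p - ?c * (?E p * g p)"
  have iD: "integrable lborel ?D" by (intro Bochner_Integration.integrable_diff ih integrable_mult_right ig)
  have inner0: "(LINT x|lborel. ?D (t, x)) = 0" for t
  proof (rule integral_derivative_eq_0)
    show "((\<lambda>x. ?E (t, x) * g (t, x)) has_vector_derivative ?D (t, x)) (at x)" for x
    proof -
      have "((\<lambda>x. ?E (t, x)) has_vector_derivative - ?c * ?E (t, x)) (at x)"
      proof -
        let ?F = "\<lambda>z. exp (- (\<i> * (complex_of_real (t * fst w) + z * complex_of_real (snd w))))"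
        have "(?F has_field_derivative - ?c * ?F (complex_of_real x)) (at (complex_of_real x))"
          by (auto intro!: derivative_eq_intros)
        from has_vector_derivative_real_field[OF this]
        have "((\<lambda>x. ?F (complex_of_real x)) has_vector_derivative - ?c * ?F (complex_of_real x)) (at x)" .
        moreover have "?E (t, x) = ?F (complex_of_real x)" for x
          by (simp add: cis_conv_exp inner_prod_def algebra_simps)
        ultimately show ?thesis by (simp only:)
      qed
      from has_vector_derivative_mult[OF this der[of t x]] show ?thesis by (simp add: algebra_simps)
    qed
    have cont: "continuous_on UNIV (\<lambda>x. f (t, x))" if "plane_decay f B" for f B
      by (rule continuous_on_compose2[OF plane_decayD(1)[OF that]]) (auto intro!: continuous_intros)
    show contD: "continuous_on UNIV (\<lambda>x. ?D (t, x))"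
      by (intro continuous_intros cont[OF g] cont[OF h])
    show "integrable lborel (\<lambda>x. ?D (t, x))"
    proof (rule integrable_of_square_decay[OF contD])
      fix x
      have "cmod (?D (t, x)) \<le> cmod (h (t, x)) + \<bar>snd w\<bar> * cmod (g (t, x))"
        by (rule order_trans[OF norm_triangle_ineq4]) (simp add: norm_mult)
      then have "cmod (?D (t, x)) * (1 + x\<^sup>2) \<le> (cmod (h (t, x)) + \<bar>snd w\<bar> * cmod (g (t, x))) * (1 + x\<^sup>2)"
        by (intro mult_right_mono) auto
      also have "\<dots> = cmod (h (t, x)) * (1 + x\<^sup>2) + \<bar>snd w\<bar> * (cmod (g (t, x)) * (1 + x\<^sup>2))" by (simp only: distrib_right mult.assoc)
      also have "\<dots> \<le> D + \<bar>snd w\<bar> * C"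
        using plane_decayD(5)[OF h] plane_decayD(5)[OF g] by (intro add_mono mult_left_mono) auto
      finally show "cmod (?D (t, x)) * (1 + x\<^sup>2) \<le> D + \<bar>snd w\<bar> * C" .
    qed
    have dec: "cmod (?E (t, x) * g (t, x)) * (1 + x\<^sup>2) \<le> C" for x
      using plane_decayD(5)[OF g, of t x] by (simp add: norm_mult)
    show "((\<lambda>x. ?E (t, x) * g (t, x)) \<longlongrightarrow> 0) at_top" "((\<lambda>x. ?E (t, x) * g (t, x)) \<longlongrightarrow> 0) at_bot"
      using dec by (auto intro: tendsto_0_of_square_decay)
  qed
  have "(LINT p|lborel. ?D p) = (LINT t|lborel. LINT x|lborel. ?D (t, x))"
    using lborel_pair.integral_fst'[of ?D] iD unfolding lborel_prod by (simp only:)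
  also have "\<dots> = 0" unfolding inner0 by simp
  finally have "(LINT p|lborel. ?E p * h p) - ?c * (LINT p|lborel. ?E p * g p) = 0"
    using ih ig by simp
  then show ?thesis by (simp add: fourier2_inner)
qed

lemma schwartz_facts:
  assumes "schwartz u"
  shows "integrable lborel u" "continuous_on UNIV u" "\<exists>B. \<forall>p. cmod (u p) \<le> B"
  using schwartz_plane_decay[OF assms, of "[]"] by (auto dest: plane_decayD)

lemma cmod_fourier2_dx_mult:
  assumes u: "schwartz u" and v: "schwartz v"
  shows "cmod (fourier2 (dx (\<lambda>p. u p * v p)) w) = \<bar>snd w\<bar> * cmod (fourier2 (\<lambda>p. u p * v p) w)"
proof -
  obtain C D where C: "plane_decay u C" and D: "plane_decay v D"
    using schwartz_plane_decay[OF u, of "[]"] schwartz_plane_decay[OF v, of "[]"] by auto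
  obtain C' D' where C': "plane_decay (dx u) C'" and D': "plane_decay (dx v) D'"
    using schwartz_plane_decay[OF u, of "[False]"] schwartz_plane_decay[OF v, of "[False]"] by (auto simp: dx_def)
  let ?h = "\<lambda>p. u p * dx v p + dx u p * v p"
  have der: "((\<lambda>y. u (t, y) * v (t, y)) has_vector_derivative ?h (t, x)) (at x)" for t x
    by (rule has_vector_derivative_mult[OF schwartz_has_dx[OF u] schwartz_has_dx[OF v]])
  have "dx (\<lambda>p. u p * v p) = ?h"
    using vector_derivative_at[OF der] by (auto simp: dx_def pd_def fun_eq_iff)
  moreover have "fourier2 ?h w = \<i> * complex_of_real (snd w) * fourier2 (\<lambda>p. u p * v p) w"
    by (rule fourier2_derivative[OF plane_decay_mult[OF C D] plane_decay_add[OF plane_decay_mult[OF C D'] plane_decay_mult[OF C' D]] der])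
  ultimately show ?thesis by (simp add: norm_mult)
qed

section \<open>The bilinear estimate\<close>

lemma ennreal_power2_le_imp_le:
  fixes a c :: ennreal
  assumes "a\<^sup>2 \<le> c\<^sup>2" shows "a \<le> c"
proof (cases c)
  case (real r)
  show ?thesis
  proof (cases a)
    case (real q)
    then show ?thesis using assms \<open>c = ennreal r\<close> \<open>0 \<le> r\<close> by (auto simp: ennreal_power power_mono_iff)
  next
    case top
    then show ?thesis using assms real by (simp add: ennreal_power top_unique)
  qed
qed simp

text \<open>The squared norm as a functional on the Fourier side, so that the bilinear estimate
  applies to arbitrary measurable inputs.\<close>

definition Xint :: "real \<Rightarrow> real \<Rightarrow> real \<Rightarrow> real \<Rightarrow> (real \<times> real \<Rightarrow> complex) \<Rightarrow> ennreal" where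
  "Xint \<alpha> s \<omega> b F = (\<integral>\<^sup>+p. ennreal (Xweight \<alpha> s \<omega> b p * (cmod (F p))\<^sup>2) \<partial>lborel)"

lemma Xnorm_power2: "(Xnorm \<alpha> s \<omega> b u)\<^sup>2 = Xint \<alpha> s \<omega> b (fourier2 u)"
proof (cases "Xint \<alpha> s \<omega> b (fourier2 u)")
  case (real r)
  then show ?thesis by (simp add: Xnorm_def Let_def Xint_def ennreal_power)
next
  case top
  then show ?thesis by (simp add: Xnorm_def Let_def Xint_def)
qed

lemma Xweight_nonneg: "0 \<le> Xweight \<alpha> s \<omega> b p"
  by (simp add: Xweight_def split: prod.split)

lemma Xweight_pos: "snd p \<noteq> 0 \<Longrightarrow> 0 < Xweight \<alpha> s \<omega> b p"
  by (auto simp: Xweight_def jb_pos less_imp_neq[OF jb_pos, symmetric] split: prod.split)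

lemma Xweight_measurable[measurable]: "Xweight \<alpha> s \<omega> b \<in> borel_measurable borel"
proof -
  have "Xweight \<alpha> s \<omega> b = (\<lambda>p. \<bar>snd p\<bar> powr (-2 * \<omega>) * jb (snd p) powr (2 * s - 2 * \<alpha> * \<omega>)
      * jb (\<bar>fst p\<bar> + \<bar>snd p\<bar> powr (1 + \<alpha>)) powr (2 * \<omega>)
      * jb (fst p - snd p * \<bar>snd p\<bar> powr \<alpha>) powr (2 * b))"
    by (auto simp: Xweight_def fun_eq_iff)
  then show ?thesis by simp
qed

lemma Xweight_shift: "Xweight \<alpha> (r + q) \<omega> b p = (jb (snd p) powr q)\<^sup>2 * Xweight \<alpha> r \<omega> b p"
proof (cases p)
  case (Pair t x)
  have "(jb x powr q)\<^sup>2 = jb x powr (2 * q)" by (simp add: power2_eq_square powr_add[symmetric])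
  moreover have "jb x powr (2 * (r + q) - 2 * \<alpha> * \<omega>) = jb x powr (2 * q) * jb x powr (2 * r - 2 * \<alpha> * \<omega>)"
    unfolding powr_add[symmetric] by (simp add: algebra_simps)
  ultimately show ?thesis unfolding Pair Xweight_def prod.case snd_conv by (simp only: mult_ac)
qed

lemma Xint_mono:
  assumes "r \<le> s" shows "Xint \<alpha> r \<omega> b F \<le> Xint \<alpha> s \<omega> b F"
  unfolding Xint_def
proof (intro nn_integral_mono ennreal_leI mult_right_mono)
  fix p :: "real \<times> real"
  have "1 \<le> (jb (snd p) powr (s - r))\<^sup>2"
    using assms jb_ge_1[of "snd p"] by (intro one_le_power ge_one_powr_ge_zero) auto
  then have "1 * Xweight \<alpha> r \<omega> b p \<le> (jb (snd p) powr (s - r))\<^sup>2 * Xweight \<alpha> r \<omega> b p"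
    by (intro mult_right_mono Xweight_nonneg)
  also have "\<dots> = Xweight \<alpha> s \<omega> b p" using Xweight_shift[of \<alpha> r "s - r" \<omega> b p] by simp
  finally show "Xweight \<alpha> r \<omega> b p \<le> Xweight \<alpha> s \<omega> b p" by simp
qed simp

lemma jb_powr_add_le:
  assumes "0 \<le> q" shows "jb (a + c) powr q \<le> 2 powr q * (jb a powr q + jb c powr q)"
proof -
  have "jb (a + c) \<le> 2 * max (jb a) (jb c)" using jb_add[of a c] by (simp add: max_def)
  then have "jb (a + c) powr q \<le> (2 * max (jb a) (jb c)) powr q"
    using assms jb_pos[of "a + c"] by (intro powr_mono2) auto
  also have "\<dots> = 2 powr q * max (jb a) (jb c) powr q" by (rule powr_mult)
  also have "\<dots> \<le> 2 powr q * (jb a powr q + jb c powr q)" by (intro mult_left_mono) (auto simp: max_def)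
  finally show ?thesis .
qed

text \<open>Used to discard zero input frequencies, where the weight vanishes and
  \<open>K_factorization\<close> cannot divide by it.\<close>

lemma AE_lborel_snd_neq: "AE w in (lborel :: (real \<times> real) measure). snd w \<noteq> r"
proof -
  have "emeasure (lborel \<Otimes>\<^sub>M lborel) ((UNIV :: real set) \<times> {r}) = emeasure lborel (UNIV :: real set) * emeasure lborel {r}"
    by (intro lborel.emeasure_pair_measure_Times) auto
  then have "(UNIV :: real set) \<times> {r} \<in> null_sets (lborel :: (real \<times> real) measure)"
    by (auto simp: null_sets_def lborel_prod intro: borel_closed closed_Times)
  then show ?thesis by (rule AE_I') auto
qed

context dispersion_params
begin

lemma K_factorization:
  assumes "snd w \<noteq> 0" "snd z - snd w \<noteq> 0"
  shows "\<bar>snd z\<bar> * sqrt (Xweight \<alpha> (- \<rho>) \<omega> b' z) = K z w * (sqrt (Xweight \<alpha> (- \<rho>) \<omega> b w) * sqrt (Xweight \<alpha> (- \<rho>) \<omega> b (z - w)))"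
proof -
  have "0 < Xweight \<alpha> (- \<rho>) \<omega> b w" "0 < Xweight \<alpha> (- \<rho>) \<omega> b (z - w)"
    using assms by (auto intro!: Xweight_pos)
  then have "(snd z)\<^sup>2 * Xweight \<alpha> (- \<rho>) \<omega> b' z = Kq (fst w) (snd w) (fst z - fst w) (snd z - snd w) * (Xweight \<alpha> (- \<rho>) \<omega> b w * Xweight \<alpha> (- \<rho>) \<omega> b (z - w))"
    by (simp add: Kq_def minus_prod_def)
  from arg_cong[OF this, of sqrt] show ?thesis
    by (simp add: real_sqrt_mult K_def)
qed

lemma K_nonneg: "0 \<le> K z w"
  by (simp add: K_def Kq_def Xweight_nonneg)

text \<open>Only a pointwise bound of U by the convolution of the moduli enters, so the inequality
  of \<open>fourier2_mult_le\<close> takes the place of a convolution identity. \<open>?I\<close>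
  and \<open>?J\<close> put the excess bracket on the first and on the second input.\<close>

lemma bilinear_Xint:
  assumes s: "- \<rho> \<le> s" and F[measurable]: "F \<in> borel_measurable borel" and G[measurable]: "G \<in> borel_measurable borel"
    and conv: "\<And>z. ennreal (cmod (U z)) \<le> ennreal \<bar>snd z\<bar> * (\<integral>\<^sup>+w. ennreal (cmod (F w)) * ennreal (cmod (G (z - w))) \<partial>lborel)"
  shows "Xint \<alpha> s \<omega> b' U \<le> ennreal (4 * (2 powr (s + \<rho>))\<^sup>2) * CB * (Xint \<alpha> s \<omega> b F * Xint \<alpha> (- \<rho>) \<omega> b G + Xint \<alpha> (- \<rho>) \<omega> b F * Xint \<alpha> s \<omega> b G)"
proof -
  define q where "q = s + \<rho>"
  have q: "0 \<le> q" "s = - \<rho> + q" using s by (auto simp: q_def)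
  define wt where "wt r H p = ennreal (sqrt (Xweight \<alpha> r \<omega> b p) * cmod (H p))" for r p and H :: "real \<times> real \<Rightarrow> complex"
  have [measurable]: "wt r F \<in> borel_measurable borel" "wt r G \<in> borel_measurable borel" for r
    unfolding wt_def by measurable
  have wt_sq: "(\<integral>\<^sup>+w. (wt r H w)\<^sup>2 \<partial>lborel) = Xint \<alpha> r \<omega> b H" for r H
    unfolding wt_def Xint_def
    by (intro nn_integral_cong) (simp add: ennreal_power power_mult_distrib Xweight_nonneg)
  let ?I = "\<lambda>z. \<integral>\<^sup>+w. ennreal (K z w) * (wt s F w * wt (- \<rho>) G (z - w)) \<partial>lborel"
  let ?J = "\<lambda>z. \<integral>\<^sup>+w. ennreal (K z w) * (wt (- \<rho>) F w * wt s G (z - w)) \<partial>lborel"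
  have K_meas[measurable]: "(\<lambda>(z, w). ennreal (K z w)) \<in> borel_measurable (borel \<Otimes>\<^sub>M borel)"
    unfolding K_def Kq_def by measurable
  have sqrt_shift: "sqrt (Xweight \<alpha> s \<omega> c p) = jb (snd p) powr q * sqrt (Xweight \<alpha> (- \<rho>) \<omega> c p)" for c p
    unfolding q(2) Xweight_shift by (simp add: real_sqrt_mult)
  have pt: "ennreal (sqrt (Xweight \<alpha> s \<omega> b' z) * cmod (U z)) \<le> ennreal (2 powr q) * (?I z + ?J z)" for z
  proof -
    have "ennreal (sqrt (Xweight \<alpha> s \<omega> b' z) * cmod (U z)) \<le> ennreal (sqrt (Xweight \<alpha> s \<omega> b' z)) * (ennreal \<bar>snd z\<bar> * (\<integral>\<^sup>+w. ennreal (cmod (F w)) * ennreal (cmod (G (z - w))) \<partial>lborel))"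
      using conv[of z] by (simp add: ennreal_mult Xweight_nonneg mult_left_mono)
    also have "\<dots> = (\<integral>\<^sup>+w. ennreal (sqrt (Xweight \<alpha> s \<omega> b' z)) * (ennreal \<bar>snd z\<bar> * (ennreal (cmod (F w)) * ennreal (cmod (G (z - w))))) \<partial>lborel)"
      by (simp add: nn_integral_cmult)
    also have "\<dots> \<le> (\<integral>\<^sup>+w. ennreal (2 powr q) * (ennreal (K z w) * (wt s F w * wt (- \<rho>) G (z - w)) + ennreal (K z w) * (wt (- \<rho>) F w * wt s G (z - w))) \<partial>lborel)"
    proof (rule nn_integral_mono_AE)
      have "AE w in (lborel :: (real \<times> real) measure). snd w \<noteq> 0 \<and> snd w \<noteq> snd z"
        using AE_lborel_snd_neq[of 0] AE_lborel_snd_neq[of "snd z"] by eventually_elim simp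
      then show "AE w in lborel. ennreal (sqrt (Xweight \<alpha> s \<omega> b' z)) * (ennreal \<bar>snd z\<bar> * (ennreal (cmod (F w)) * ennreal (cmod (G (z - w))))) \<le>
        ennreal (2 powr q) * (ennreal (K z w) * (wt s F w * wt (- \<rho>) G (z - w)) + ennreal (K z w) * (wt (- \<rho>) F w * wt s G (z - w)))"
      proof eventually_elim
        case (elim w)
        define X where "X c p = sqrt (Xweight \<alpha> (- \<rho>) \<omega> c p)" for c p
        define \<phi>F where "\<phi>F = cmod (F w)"
        define \<phi>G where "\<phi>G = cmod (G (z - w))"
        have X0: "0 \<le> X c p" for c p by (simp add: X_def Xweight_nonneg)
        have pos: "0 \<le> \<phi>F" "0 \<le> \<phi>G" by (auto simp: \<phi>F_def \<phi>G_def)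
        have fac: "\<bar>snd z\<bar> * X b' z = K z w * (X b w * X b (z - w))"
          unfolding X_def using elim by (intro K_factorization) auto
        have "jb (snd z) powr q \<le> 2 powr q * (jb (snd w) powr q + jb (snd (z - w)) powr q)"
          using jb_powr_add_le[OF q(1), of "snd w" "snd (z - w)"] by simp
        then have "jb (snd z) powr q * (\<bar>snd z\<bar> * X b' z * \<phi>F * \<phi>G) \<le> 2 powr q * (jb (snd w) powr q + jb (snd (z - w)) powr q) * (\<bar>snd z\<bar> * X b' z * \<phi>F * \<phi>G)"
          using X0 pos by (intro mult_right_mono) auto
        also have "\<dots> = 2 powr q * (K z w * ((jb (snd w) powr q * X b w * \<phi>F) * (X b (z - w) * \<phi>G)) + K z w * ((X b w * \<phi>F) * (jb (snd (z - w)) powr q * X b (z - w) * \<phi>G)))"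
          unfolding fac by (simp add: algebra_simps)
        finally have "ennreal (jb (snd z) powr q * (\<bar>snd z\<bar> * X b' z * \<phi>F * \<phi>G)) \<le> ennreal (2 powr q * (K z w * ((jb (snd w) powr q * X b w * \<phi>F) * (X b (z - w) * \<phi>G)) + K z w * ((X b w * \<phi>F) * (jb (snd (z - w)) powr q * X b (z - w) * \<phi>G))))"
          by (rule ennreal_leI)
        moreover have "ennreal (sqrt (Xweight \<alpha> s \<omega> b' z)) * (ennreal \<bar>snd z\<bar> * (ennreal (cmod (F w)) * ennreal (cmod (G (z - w))))) = ennreal (jb (snd z) powr q * (\<bar>snd z\<bar> * X b' z * \<phi>F * \<phi>G))"
          unfolding sqrt_shift X_def[symmetric] \<phi>F_def[symmetric] \<phi>G_def[symmetric]
          using X0 pos by (simp add: ennreal_mult[symmetric] mult_ac)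
        moreover have "ennreal (2 powr q) * (ennreal (K z w) * (wt s F w * wt (- \<rho>) G (z - w)) + ennreal (K z w) * (wt (- \<rho>) F w * wt s G (z - w)))
           = ennreal (2 powr q * (K z w * ((jb (snd w) powr q * X b w * \<phi>F) * (X b (z - w) * \<phi>G)) + K z w * ((X b w * \<phi>F) * (jb (snd (z - w)) powr q * X b (z - w) * \<phi>G))))"
          unfolding wt_def sqrt_shift X_def[symmetric] \<phi>F_def[symmetric] \<phi>G_def[symmetric]
          using X0 pos K_nonneg by (simp add: ennreal_mult[symmetric] ennreal_plus[symmetric] del: ennreal_plus)
        ultimately show ?case by simp
      qed
    qed
    also have "\<dots> = ennreal (2 powr q) * (?I z + ?J z)"
      by (simp add: nn_integral_cmult nn_integral_add)
    finally show ?thesis .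
  qed
  have "Xint \<alpha> s \<omega> b' U = (\<integral>\<^sup>+z. (ennreal (sqrt (Xweight \<alpha> s \<omega> b' z) * cmod (U z)))\<^sup>2 \<partial>lborel)"
    unfolding Xint_def by (intro nn_integral_cong) (simp add: ennreal_power power_mult_distrib Xweight_nonneg)
  also have "\<dots> \<le> (\<integral>\<^sup>+z. ennreal (4 * (2 powr q)\<^sup>2) * ((?I z)\<^sup>2 + (?J z)\<^sup>2) \<partial>lborel)"
  proof (intro nn_integral_mono)
    fix z
    have "(ennreal (sqrt (Xweight \<alpha> s \<omega> b' z) * cmod (U z)))\<^sup>2 \<le> (ennreal (2 powr q) * (?I z + ?J z))\<^sup>2"
      by (intro power_mono pt) auto
    also have "\<dots> = ennreal ((2 powr q)\<^sup>2) * (?I z + ?J z)\<^sup>2" by (simp add: power_mult_distrib ennreal_power)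
    also have "\<dots> \<le> ennreal ((2 powr q)\<^sup>2) * (4 * ((?I z)\<^sup>2 + (?J z)\<^sup>2))" by (intro mult_left_mono ennreal_add_power2_le) auto
    also have "\<dots> = ennreal (4 * (2 powr q)\<^sup>2) * ((?I z)\<^sup>2 + (?J z)\<^sup>2)"
    proof -
      have "ennreal (4 * (2 powr q)\<^sup>2) = 4 * ennreal ((2 powr q)\<^sup>2)" by (simp add: ennreal_mult)
      then show ?thesis by (simp only: mult_ac)
    qed
    finally show "(ennreal (sqrt (Xweight \<alpha> s \<omega> b' z) * cmod (U z)))\<^sup>2 \<le> ennreal (4 * (2 powr q)\<^sup>2) * ((?I z)\<^sup>2 + (?J z)\<^sup>2)" .
  qed
  also have "\<dots> = ennreal (4 * (2 powr q)\<^sup>2) * ((\<integral>\<^sup>+z. (?I z)\<^sup>2 \<partial>lborel) + (\<integral>\<^sup>+z. (?J z)\<^sup>2 \<partial>lborel))"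
    by (simp add: nn_integral_cmult nn_integral_add)
  also have "\<dots> \<le> ennreal (4 * (2 powr q)\<^sup>2) * (CB * (Xint \<alpha> s \<omega> b F * Xint \<alpha> (- \<rho>) \<omega> b G) + CB * (Xint \<alpha> (- \<rho>) \<omega> b F * Xint \<alpha> s \<omega> b G))"
    unfolding wt_sq[symmetric] by (intro mult_left_mono add_mono bilinear_K) auto
  finally show ?thesis unfolding q_def by (simp only: distrib_left mult.assoc)
qed

end

theorem theorem3p1:
  fixes \<alpha> s s\<^sub>0 \<omega> :: real
  assumes "1 < \<alpha>" and "\<alpha> < 2"
    and "s\<^sub>0 \<le> s" and "s\<^sub>0 > - (3 / 4) * (\<alpha> - 1)"
    and "\<omega> = 1 / \<alpha> - 1 / 2"
  shows "\<exists>b' b c. b' > - 1 / 2 \<and> 1 / 2 < b \<and> b < b' + 1 \<and> c > 0 \<and>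
    (\<forall>u\<^sub>1 u\<^sub>2. schwartz u\<^sub>1 \<longrightarrow> schwartz u\<^sub>2 \<longrightarrow>
       Xnorm \<alpha> s \<omega> b' (dx (\<lambda>p. u\<^sub>1 p * u\<^sub>2 p))
         \<le> ennreal c * (Xnorm \<alpha> s \<omega> b u\<^sub>1 * Xnorm \<alpha> s\<^sub>0 \<omega> b u\<^sub>2
                        + Xnorm \<alpha> s\<^sub>0 \<omega> b u\<^sub>1 * Xnorm \<alpha> s \<omega> b u\<^sub>2))"
proof -
  \<comment> \<open>The exponent bounds need \<rho> >= 0; for positive s0 the estimate is run at
    regularity 0, and monotonicity in the regularity gives the rest.\<close>
  define \<rho> where "\<rho> = max 0 (- s\<^sub>0)"
  \<comment> \<open>All remaining room is spent: the defining inequality of the locale becomes an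
    equality. The choice of \<open>b\<close> with half of \<epsilon> keeps it strictly below b' +
    1.\<close>
  define \<epsilon> where "\<epsilon> = (3 * (\<alpha> - 1) - 4 * \<rho>) / 12"
  define b where "b = 1 / 2 + \<epsilon> / 2"
  define b' where "b' = - 1 / 2 + \<epsilon>"
  have rho_bounds: "0 \<le> \<rho>" "- \<rho> \<le> s\<^sub>0" "4 * \<rho> < 3 * (\<alpha> - 1)"
    unfolding \<rho>_def max_def using assms(1,4) by argo+
  then have eps_pos: "0 < \<epsilon>" by (simp add: \<epsilon>_def)
  have "4 * \<rho> + 12 * \<epsilon> = 3 * (\<alpha> - 1)" unfolding \<epsilon>_def by argo
  then interpret dispersion_params \<alpha> \<omega> \<rho> \<epsilon> b b'
    by unfold_locales (use assms rho_bounds eps_pos in \<open>auto simp: b_def b'_def\<close>)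
  define M where "M = ennreal (4 * (2 powr (s + \<rho>))\<^sup>2) * CB"
  have M: "M < \<infinity>" using CB_finite by (simp add: M_def ennreal_mult_less_top)
  \<comment> \<open>The summand 1 makes c strictly positive whatever the value of M.\<close>
  define c where "c = sqrt (enn2real M) + 1"
  have c: "0 < c" by (simp add: c_def add_nonneg_pos)
  have Mc: "M \<le> (ennreal c)\<^sup>2"
  proof -
    have "enn2real M = (sqrt (enn2real M))\<^sup>2" by simp
    also have "\<dots> \<le> c\<^sup>2" by (intro power_mono) (auto simp: c_def)
    finally have "ennreal (enn2real M) \<le> ennreal (c\<^sup>2)" by (rule ennreal_leI)
    then show ?thesis using M c by (simp add: ennreal_power)
  qed
  have main: "Xnorm \<alpha> s \<omega> b' (dx (\<lambda>p. u p * v p)) \<le> ennreal c * (Xnorm \<alpha> s \<omega> b u * Xnorm \<alpha> s\<^sub>0 \<omega> b v + Xnorm \<alpha> s\<^sub>0 \<omega> b u * Xnorm \<alpha> s \<omega> b v)"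
    if u: "schwartz u" and v: "schwartz v" for u v
  proof (rule ennreal_power2_le_imp_le)
    let ?A = "Xnorm \<alpha> s \<omega> b u * Xnorm \<alpha> s\<^sub>0 \<omega> b v" and ?B = "Xnorm \<alpha> s\<^sub>0 \<omega> b u * Xnorm \<alpha> s \<omega> b v"
    have [measurable]: "u \<in> borel_measurable borel" "v \<in> borel_measurable borel"
      using schwartz_facts(2)[OF u] schwartz_facts(2)[OF v] by (auto intro: borel_measurable_continuous_onI)
    obtain B where B: "\<And>p. cmod (u p) \<le> B" using schwartz_facts(3)[OF u] by blast
    have conv: "ennreal (cmod (fourier2 (dx (\<lambda>p. u p * v p)) z)) \<le> ennreal \<bar>snd z\<bar> * (\<integral>\<^sup>+w. ennreal (cmod (fourier2 u w)) * ennreal (cmod (fourier2 v (z - w))) \<partial>lborel)" for z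
      unfolding cmod_fourier2_dx_mult[OF u v] ennreal_mult'[OF abs_ge_zero]
      by (rule mult_left_mono[OF fourier2_mult_le[OF schwartz_facts(1,2)[OF u] B schwartz_facts(1)[OF v]]]) simp
    have "(Xnorm \<alpha> s \<omega> b' (dx (\<lambda>p. u p * v p)))\<^sup>2 \<le> M * (Xint \<alpha> s \<omega> b (fourier2 u) * Xint \<alpha> (- \<rho>) \<omega> b (fourier2 v) + Xint \<alpha> (- \<rho>) \<omega> b (fourier2 u) * Xint \<alpha> s \<omega> b (fourier2 v))"
      unfolding Xnorm_power2 M_def using rho_bounds assms by (intro bilinear_Xint conv) auto
    also have "\<dots> \<le> M * (Xint \<alpha> s \<omega> b (fourier2 u) * Xint \<alpha> s\<^sub>0 \<omega> b (fourier2 v) + Xint \<alpha> s\<^sub>0 \<omega> b (fourier2 u) * Xint \<alpha> s \<omega> b (fourier2 v))"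
      using rho_bounds by (intro mult_left_mono add_mono mult_right_mono Xint_mono) auto
    also have "\<dots> = M * (?A\<^sup>2 + ?B\<^sup>2)" by (simp add: Xnorm_power2 power_mult_distrib)
    also have "\<dots> \<le> (ennreal c)\<^sup>2 * (?A + ?B)\<^sup>2"
      by (intro mult_mono Mc) (auto simp: power2_sum)
    finally show "(Xnorm \<alpha> s \<omega> b' (dx (\<lambda>p. u p * v p)))\<^sup>2 \<le> (ennreal c * (?A + ?B))\<^sup>2"
      by (simp only: power_mult_distrib)
  qed
  have "- 1 / 2 < b'" "1 / 2 < b" "b < b' + 1" using eps_pos by (auto simp: b_def b'_def)
  with main c show ?thesis by blast
qed

end
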